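(* Let $k\ge 1$, let $a_1\ge\cdots\ge a_k\ge 1$ and $b_1\ge 1$ be integers. Let $F=\left(\bigcup_{i=1}^k P_{2a_i}\right)\bigcup P_{2b_1+1}$ and $h=\sum_{i=1}^k a_i+b_1-1\ge 1$. Let $G$ be a connected graph of order $n$, where $n\ge 2h+3$. If $\delta(G)\ge h$, then $F\subseteq G$, unless one of the following holds: (i) $G\subseteq S_{n,h}$; (ii) $F=P_6\bigcup P_3$ and $G\subseteq K_2\bigvee\frac{n-2}{2}K_2$, where $n$ is even; (iii) $F\in\{P_{2b_1}\bigcup P_{2b_1+1},\ P_{2b_1+2}\bigcup P_{2b_1+1}\}$ and $G=L_{t,h}$, where $n=th+1$.
   Context: All graphs are finite, simple and undirected; $\delta(G)$ is the minimum degree of $G$. $P_m$ is the path of order $m$ (on $m$ vertices), $K_m$ the complete graph of order $m$. For disjoint graphs, $G\bigcup H$ is the disjoint union, $G\bigvee H$ is the join (add all edges between $G$ and $H$ to the disjoint union), $kG$ is the disjoint union of $k$ copies of $G$, and $\overline{G}$ is the complement. $H\subseteq G$ means that $G$ contains $H$ as a (not necessarily induced) subgraph, up to isomorphism; equality of graphs means isomorphism. $S_{n,h}:=K_h\bigvee\overline{K}_{n-h}$. $L_{t,h}:=K_1\bigvee tK_h$ (that is, $t$ copies of $K_{h+1}$ sharing one common vertex). *)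

theory Defs
  imports "Graph_Theory.Graph_Theory"
begin

text \<open>
  Finite simple undirected graphs are the symmetric loop-free digraphs of the locale
  \<^locale>\<open>pair_graph\<close>: every undirected edge is represented by its two orientations, so the
  degree of a vertex is its out-degree.
\<close>

definition min_degree :: "'a pair_pre_digraph \<Rightarrow> nat" where
  "min_degree G = Min (out_degree (with_proj G) ` pverts G)"

definition isomorphic :: "'a pair_pre_digraph \<Rightarrow> 'b pair_pre_digraph \<Rightarrow> bool" where
  "isomorphic G H \<longleftrightarrow> digraph_iso (with_proj G) (with_proj H)"

text \<open>Containment as a not necessarily induced subgraph, up to isomorphism.\<close>

definition contained_in :: "'a pair_pre_digraph \<Rightarrow> 'b pair_pre_digraph \<Rightarrow> bool" where
  "contained_in H G \<longleftrightarrow>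
     (\<exists>H'. subgraph (with_proj H') (with_proj G) \<and> isomorphic H H')"

text \<open>The number \<open>m\<close> is the order of the path, i.e. its number of vertices.\<close>

definition path_graph :: "nat \<Rightarrow> nat pair_pre_digraph" where
  "path_graph m = \<lparr> pverts = {..<m},
     parcs = {(i, j). i < m \<and> j < m \<and> (j = Suc i \<or> i = Suc j)} \<rparr>"

definition complete_graph :: "nat \<Rightarrow> nat pair_pre_digraph" where
  "complete_graph m = \<lparr> pverts = {..<m}, parcs = {(i, j). i < m \<and> j < m \<and> i \<noteq> j} \<rparr>"

definition complement_graph :: "'a pair_pre_digraph \<Rightarrow> 'a pair_pre_digraph" where
  "complement_graph G = \<lparr> pverts = pverts G,
     parcs = {(u, v). u \<in> pverts G \<and> v \<in> pverts G \<and> u \<noteq> v \<and> (u, v) \<notin> parcs G} \<rparr>"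

definition disjoint_union ::
  "'a pair_pre_digraph \<Rightarrow> 'b pair_pre_digraph \<Rightarrow> ('a + 'b) pair_pre_digraph" where
  "disjoint_union G H = \<lparr> pverts = pverts G <+> pverts H,
     parcs = map_prod Inl Inl ` parcs G \<union> map_prod Inr Inr ` parcs H \<rparr>"

definition graph_join ::
  "'a pair_pre_digraph \<Rightarrow> 'b pair_pre_digraph \<Rightarrow> ('a + 'b) pair_pre_digraph" where
  "graph_join G H = \<lparr> pverts = pverts G <+> pverts H,
     parcs = parcs (disjoint_union G H)
       \<union> (Inl ` pverts G) \<times> (Inr ` pverts H) \<union> (Inr ` pverts H) \<times> (Inl ` pverts G) \<rparr>"

text \<open>Disjoint union of an indexed family; the index tags the vertices of each member.\<close>

definition disjoint_Union ::
  "'i set \<Rightarrow> ('i \<Rightarrow> 'a pair_pre_digraph) \<Rightarrow> ('i \<times> 'a) pair_pre_digraph" where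
  "disjoint_Union I G = \<lparr> pverts = (SIGMA i:I. pverts (G i)),
     parcs = (\<Union>i\<in>I. map_prod (Pair i) (Pair i) ` parcs (G i)) \<rparr>"

definition copies :: "nat \<Rightarrow> 'a pair_pre_digraph \<Rightarrow> (nat \<times> 'a) pair_pre_digraph" where
  "copies t G = disjoint_Union {1..t} (\<lambda>_. G)"

definition S_graph :: "nat \<Rightarrow> nat \<Rightarrow> (nat + nat) pair_pre_digraph" where
  "S_graph n h = graph_join (complete_graph h) (complement_graph (complete_graph (n - h)))"

definition L_graph :: "nat \<Rightarrow> nat \<Rightarrow> (nat + nat \<times> nat) pair_pre_digraph" where
  "L_graph t h = graph_join (complete_graph 1) (copies t (complete_graph h))"

lemma pair_graph_iff:
  "pair_graph G \<longleftrightarrow> finite (pverts G) \<and> parcs G \<subseteq> pverts G \<times> pverts G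
     \<and> sym (parcs G) \<and> irrefl (parcs G)"
proof
  assume "pair_graph G"
  then interpret pair_graph G .
  show "finite (pverts G) \<and> parcs G \<subseteq> pverts G \<times> pverts G \<and> sym (parcs G) \<and> irrefl (parcs G)"
    using pair_finite_verts pair_sym_arcs in_arcsD1 in_arcsD2 pair_no_loops
    by (fastforce simp: symmetric_def irrefl_def)
next
  assume A: "finite (pverts G) \<and> parcs G \<subseteq> pverts G \<times> pverts G \<and> sym (parcs G) \<and> irrefl (parcs G)"
  then have "finite (parcs G)"
    by (meson finite_SigmaI finite_subset)
  with A show "pair_graph G"
    by unfold_locales (auto simp: symmetric_def irrefl_def)
qed

lemma pair_graph_path_graph: "pair_graph (path_graph m)"
  by (auto simp: pair_graph_iff path_graph_def sym_def irrefl_def)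

lemma pair_graph_complete_graph: "pair_graph (complete_graph m)"
  by (auto simp: pair_graph_iff complete_graph_def sym_def irrefl_def)

lemma pair_graph_complement_graph:
  "pair_graph G \<Longrightarrow> pair_graph (complement_graph G)"
  by (auto simp: pair_graph_iff complement_graph_def sym_def irrefl_def)

lemma pair_graph_disjoint_union:
  "pair_graph G \<Longrightarrow> pair_graph H \<Longrightarrow> pair_graph (disjoint_union G H)"
  by (fastforce simp: pair_graph_iff disjoint_union_def sym_def irrefl_def)

lemma pair_graph_graph_join:
  "pair_graph G \<Longrightarrow> pair_graph H \<Longrightarrow> pair_graph (graph_join G H)"
  by (fastforce simp: pair_graph_iff disjoint_union_def graph_join_def sym_def irrefl_def)

lemma pair_graph_disjoint_Union:
  "finite I \<Longrightarrow> (\<And>i. i \<in> I \<Longrightarrow> pair_graph (G i)) \<Longrightarrow> pair_graph (disjoint_Union I G)"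
  by (fastforce simp: pair_graph_iff disjoint_Union_def sym_def irrefl_def)

lemma isomorphic_iff:
  assumes "pair_graph G"
  shows "isomorphic G H \<longleftrightarrow>
    (\<exists>f. bij_betw f (pverts G) (pverts H) \<and> parcs H = map_prod f f ` parcs G)"
proof
  assume "isomorphic G H"
  then obtain f where f: "pre_digraph.digraph_isomorphism (with_proj G) f"
    and H: "with_proj H = app_iso f (with_proj G)"
    unfolding isomorphic_def digraph_iso_def by auto
  let ?g = "iso_verts f"
  have "pverts H = ?g ` pverts G" "parcs H = iso_arcs f ` parcs G"
    and th: "iso_tail f = fst" "iso_head f = snd"
    using H by (simp_all add: with_proj_def app_iso_def)
  moreover have "inj_on ?g (pverts G)"
    and "\<forall>e\<in>parcs G. iso_arcs f e = map_prod ?g ?g e"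
    using f th unfolding pre_digraph.digraph_isomorphism_def
    by (auto simp: prod_eq_iff)
  ultimately have "bij_betw ?g (pverts G) (pverts H)" "parcs H = map_prod ?g ?g ` parcs G"
    by (auto simp: bij_betw_def)
  then show "\<exists>g. bij_betw g (pverts G) (pverts H) \<and> parcs H = map_prod g g ` parcs G"
    by blast
next
  assume "\<exists>g. bij_betw g (pverts G) (pverts H) \<and> parcs H = map_prod g g ` parcs G"
  then obtain g where g: "inj_on g (pverts G)" "pverts H = g ` pverts G"
    and arcs: "parcs H = map_prod g g ` parcs G"
    by (auto simp: bij_betw_def)
  interpret pair_graph G by (rule assms)
  let ?f = "\<lparr> iso_verts = g, iso_arcs = map_prod g g, iso_head = snd, iso_tail = fst \<rparr>"
  have "inj_on (map_prod g g) (parcs G)"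
    using map_prod_inj_on[OF g(1) g(1)] assms
    by (auto simp: pair_graph_iff intro: inj_on_subset)
  then have "digraph_isomorphism ?f"
    using g(1) wf_digraph by (simp add: digraph_isomorphism_def)
  moreover have "with_proj H = app_iso ?f (with_proj G)"
    by (simp add: with_proj_def app_iso_def g(2) arcs)
  ultimately show "isomorphic G H"
    unfolding isomorphic_def digraph_iso_def by auto
qed

lemma contained_in_iff:
  assumes "pair_graph H" "pair_graph G"
  shows "contained_in H G \<longleftrightarrow>
    (\<exists>f. inj_on f (pverts H) \<and> f ` pverts H \<subseteq> pverts G \<and> map_prod f f ` parcs H \<subseteq> parcs G)"
proof
  assume "contained_in H G"
  then obtain H' where "pverts H' \<subseteq> pverts G" "parcs H' \<subseteq> parcs G" "isomorphic H H'"
    by (auto simp: contained_in_def subgraph_def)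
  then show "\<exists>f. inj_on f (pverts H) \<and> f ` pverts H \<subseteq> pverts G \<and> map_prod f f ` parcs H \<subseteq> parcs G"
    unfolding isomorphic_iff[OF assms(1)] by (metis bij_betw_def)
next
  assume "\<exists>f. inj_on f (pverts H) \<and> f ` pverts H \<subseteq> pverts G \<and> map_prod f f ` parcs H \<subseteq> parcs G"
  then obtain f where f: "inj_on f (pverts H)" "f ` pverts H \<subseteq> pverts G"
    "map_prod f f ` parcs H \<subseteq> parcs G" by blast
  define H' where "H' = \<lparr> pverts = f ` pverts H, parcs = map_prod f f ` parcs H \<rparr>"
  interpret G: pair_graph G by (rule assms)
  interpret H: pair_graph H by (rule assms)
  have "isomorphic H H'"
    unfolding isomorphic_iff[OF assms(1)] H'_def using f(1) by (auto simp: bij_betw_def)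
  moreover have "wf_digraph (with_proj H')"
    by unfold_locales (auto simp: H'_def H.in_arcsD1 H.in_arcsD2)
  then have "subgraph (with_proj H') (with_proj G)"
    using f G.wf_digraph by (auto simp: subgraph_def compatible_def H'_def)
  ultimately show "contained_in H G"
    unfolding contained_in_def by blast
qed

end

theory Submission
  imports Defs
begin

text \<open>
  Put \<open>b = a\<^sub>1 + \<dots> + a\<^bsub>k-1\<^esub> + b\<^sub>1\<close>, so that \<open>a\<^sub>k + b = h + 1\<close>. The components of \<open>F\<close> other than the
  path of order \<open>2 a\<^sub>k\<close> can be laid end to end along a path of order \<open>2 b + 1\<close>, so it is enough to find two
  disjoint paths of the orders \<open>2 a\<^sub>k\<close> and \<open>2 b + 1\<close>. For \<open>k \<ge> 2\<close> the smallest part satisfies \<open>a\<^sub>k < b\<close>,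
  whereas the join of two vertices with a matching and the graphs \<open>L\<^bsub>t,h\<^esub>\<close> obstruct the two paths only if
  \<open>a\<^sub>k \<ge> b\<close>. Hence these two exceptions occur only for \<open>k = 1\<close>, where nothing has been lost: then the two
  paths are \<open>F\<close> itself.

  The two paths have \<open>2 h + 3\<close> vertices altogether, so a path of that order can simply be cut. Otherwise
  consider a longest path, of order \<open>m \<le> 2 h + 2 < n\<close>. Its vertex set does not span a cycle, since by
  connectivity such a cycle would extend to a longer path. Hence no chord from the first vertex ends
  right after the end of a chord from the last vertex, and counting the neighbours of both ends gives
  \<open>m \<ge> 2 h + 1\<close> and the dichotomy of \<open>longest_path_crossing\<close>: either two crossing chords close up a
  cycle that misses only one or two vertices of the path, or all neighbours of the first vertex come
  before those of the last vertex, up to a common one.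

  With crossing chords there are three kinds of cycles. If \<open>m = 2 h + 1\<close>, the cycle has length \<open>2 h\<close>
  and the vertices outside it are independent; they are all adjacent to the same alternate half of
  the cycle, and that half is a vertex cover of order \<open>h\<close> (\<open>vertex_cover_of_even_cycle\<close>), which means
  that the graph is contained in \<open>S\<^bsub>n,h\<^esub>\<close>. If \<open>m = 2 h + 2\<close> and the cycle has length \<open>2 h + 1\<close>, any two
  outside vertices have the same alternating neighbourhood; they prolong an arc of the cycle at both
  ends to a path of order \<open>2 b + 1\<close>, and an arc of order \<open>2 a\<^sub>k\<close> is left (\<open>two_paths_of_odd_cycle\<close>). If
  \<open>m = 2 h + 2\<close> and the cycle has length \<open>2 h\<close>, it misses an edge; the distances between the attachments
  of the two ends of this edge force \<open>h = 3\<close>, and the graph is a perfect matching joined to two vertices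
  (\<open>two_paths_or_joined_matching\<close>).

  Without crossing chords, reversing an initial or a final segment of the path turns most of its vertices
  into ends of longest paths, so they have no neighbours outside the path and the rest of the graph is
  attached near its middle. If \<open>m = 2 h + 1\<close>, the two halves are even cliques; this propagates to the
  whole graph, which is \<open>L\<^bsub>t,h\<^esub>\<close> (\<open>windmill_of_tight_path\<close>), and the shorter of the two required paths
  fits into a clique outside the longest path unless both have more than \<open>h\<close> vertices. If
  \<open>m = 2 h + 2\<close>, an outside vertex next to the middle starts a third branch of order \<open>h\<close>, apart from a
  small configuration with \<open>h = 2\<close>, and the two paths are visible (\<open>two_paths_of_no_crossing\<close>).
\<close>

section \<open>Sets of naturals without consecutive elements\<close>

lemma card_no_consecutive_le:
  fixes S :: "nat set"
  assumes "S \<subseteq> {..<2 * q}" "\<And>i. i \<in> S \<Longrightarrow> Suc i \<notin> S"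
  shows "card S \<le> q"
  using assms
proof (induction q arbitrary: S)
  case (Suc q)
  have "S = (S \<inter> {..<2 * q}) \<union> (S \<inter> {2 * q, Suc (2 * q)})"
    using Suc.prems(1) by auto
  then have "card S \<le> card (S \<inter> {..<2 * q}) + card (S \<inter> {2 * q, Suc (2 * q)})"
    using card_Un_le by metis
  moreover have "card (S \<inter> {..<2 * q}) \<le> q"
    by (rule Suc.IH) (use Suc.prems(2) in auto)
  moreover have "card (S \<inter> {2 * q, Suc (2 * q)}) \<le> 1"
    using Suc.prems(2)[of "2 * q"] by (auto simp: Int_insert_right)
  ultimately show ?case by simp
qed simp

text \<open>
  An interval of odd length has only one extremal set without consecutive elements. This rigidity
  turns a degree bound into the exact position of the neighbours on a cycle.
\<close>

lemma no_consecutive_extremal: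
  fixes S :: "nat set"
  assumes "S \<subseteq> {..<2 * q + 1}" "\<And>i. i \<in> S \<Longrightarrow> Suc i \<notin> S" "q + 1 \<le> card S"
  shows "S = {i. i < 2 * q + 1 \<and> even i}"
  using assms
proof (induction q arbitrary: S)
  case 0
  then have "S \<subseteq> {0}" "S \<noteq> {}" by auto
  then have "S = {0}" by blast
  then show ?case by auto
next
  case (Suc q)
  let ?T = "S \<inter> {..<2 * q + 1}"
  have S: "S = ?T \<union> (S \<inter> {2 * q + 1, 2 * q + 2})"
    using Suc.prems(1) by auto
  then have "card S \<le> card ?T + card (S \<inter> {2 * q + 1, 2 * q + 2})"
    using card_Un_le by metis
  moreover have two: "card (S \<inter> {2 * q + 1, 2 * q + 2}) \<le> 1"
    using Suc.prems(2)[of "2 * q + 1"] by (auto simp: Int_insert_right)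
  ultimately have "q + 1 \<le> card ?T"
    using Suc.prems(3) by linarith
  then have T: "?T = {i. i < 2 * q + 1 \<and> even i}"
    by (intro Suc.IH) (use Suc.prems(2) in auto)
  have "2 * q \<in> ?T" unfolding T by simp
  then have "2 * q \<in> S" by blast
  then have "2 * q + 1 \<notin> S" using Suc.prems(2)[of "2 * q"] by auto
  moreover have "2 * q + 2 \<in> S"
  proof (rule ccontr)
    assume "2 * q + 2 \<notin> S"
    then have "S \<subseteq> {..<2 * (q + 1)}"
      using Suc.prems(1) by (force simp: less_Suc_eq)
    from card_no_consecutive_le[OF this Suc.prems(2)] Suc.prems(3) show False by simp
  qed
  ultimately have "S = ?T \<union> {2 * q + 2}" using S by blast
  then have "S = {i. i < 2 * q + 1 \<and> even i} \<union> {2 * q + 2}" unfolding T .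
  also have "\<dots> = {i. i < 2 * Suc q + 1 \<and> even i}"
    by (auto simp: less_Suc_eq)
  finally show ?case .
qed

text \<open>
  Were \<open>i\<close> and \<open>Suc i\<close> both gaps, the window of length \<open>2 h\<close> that starts at \<open>i\<close> would have all its
  elements in the last \<open>2 h - 2\<close> positions, where only \<open>h - 1\<close> of them fit.
\<close>

lemma alternating_of_even_period:
  fixes g :: "nat \<Rightarrow> bool"
  assumes "1 \<le> h" "\<And>i. g i \<Longrightarrow> \<not> g (Suc i)"
    and "\<And>s. h \<le> card {i. i < 2 * h \<and> g (s + i)}"
  shows "g (Suc i) \<longleftrightarrow> \<not> g i"
proof (rule ccontr)
  assume "(g (Suc i)) \<noteq> (\<not> g i)"
  then have i: "\<not> g i" "\<not> g (Suc i)" using assms(2)[of i] by auto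
  let ?S = "{j. j < 2 * (h - 1) \<and> g (i + 2 + j)}"
  have "card ?S \<le> h - 1"
    by (rule card_no_consecutive_le) (use assms(2) in auto)
  moreover have "j \<in> (\<lambda>j. j + 2) ` ?S" if "j < 2 * h" "g (i + j)" for j
  proof -
    obtain j' where "j = j' + 2"
      using i \<open>g (i + j)\<close> by (cases j; cases "j - 1") auto
    then show ?thesis using that by (intro image_eqI[of _ _ j']) (auto simp: add.commute add.left_commute)
  qed
  then have "card {j. j < 2 * h \<and> g (i + j)} \<le> card ?S"
    by (intro surj_card_le[of _ _ "\<lambda>j. j + 2"]) auto
  ultimately show False using assms(3)[of i] assms(1) by simp
qed

text \<open>
  An odd period cannot alternate all the way round, so two consecutive gaps exist. Rotating them to
  the two ends of the window leaves \<open>2 h - 1\<close> positions for \<open>h\<close> elements, which is the extremal case.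
\<close>

lemma alternating_of_odd_period:
  fixes g :: "nat \<Rightarrow> bool"
  assumes "1 \<le> h" "\<And>i. g i \<Longrightarrow> \<not> g (Suc i)" "\<And>i. g (i + (2 * h + 1)) = g i"
    and "\<And>s. h \<le> card {i. i < 2 * h + 1 \<and> g (s + i)}"
  shows "\<exists>s. \<forall>i<2 * h + 1. g (s + i) \<longleftrightarrow> odd i"
proof -
  have "\<exists>s. \<not> g s \<and> \<not> g (Suc s)"
  proof (rule ccontr)
    assume "\<not> ?thesis"
    then have alt: "g (Suc i) \<longleftrightarrow> \<not> g i" for i using assms(2) by blast
    have "g i \<longleftrightarrow> (even i \<longleftrightarrow> g 0)" for i
      by (induction i) (auto simp: alt)
    from this[of "2 * h + 1"] assms(3)[of 0] show False by simp
  qed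
  then obtain r where r: "\<not> g r" "\<not> g (Suc r)" by blast
  let ?s = "Suc r"
  have ends: "\<not> g ?s" "\<not> g (?s + 2 * h)"
    using r assms(3)[of r] by simp_all
  let ?S = "{i. i < 2 * (h - 1) + 1 \<and> g (Suc (?s + i))}"
  have "i \<in> Suc ` ?S" if "i < 2 * h + 1" "g (?s + i)" for i
  proof -
    have "i \<noteq> 0" "i \<noteq> 2 * h" using ends that(2) by (auto intro: ccontr)
    then show ?thesis using that by (intro image_eqI[of _ _ "i - 1"]) auto
  qed
  then have "card {i. i < 2 * h + 1 \<and> g (?s + i)} \<le> card ?S"
    by (intro surj_card_le[of _ _ Suc]) auto
  then have "h - 1 + 1 \<le> card ?S" using assms(1) assms(4)[of ?s] by simp
  then have S: "?S = {i. i < 2 * (h - 1) + 1 \<and> even i}"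
    by (intro no_consecutive_extremal) (use assms(2) in auto)
  have "g (?s + i) \<longleftrightarrow> odd i" if "i < 2 * h + 1" for i
  proof (cases "i = 0 \<or> i = 2 * h")
    case True
    then show ?thesis using ends by auto
  next
    case False
    then have "i - 1 < 2 * (h - 1) + 1" "?s + i = Suc (?s + (i - 1))" using that by auto
    then have "g (?s + i) \<longleftrightarrow> i - 1 \<in> ?S" by auto
    also have "\<dots> \<longleftrightarrow> odd i" unfolding S using False that by auto
    finally show ?thesis .
  qed
  then show ?thesis by blast
qed

section \<open>Paths in connected graphs of given minimum degree\<close>

text \<open>
  Connectivity is the assumption \<open>closed_eq_V\<close>: a nonempty set of vertices that contains all
  neighbours of its members is the whole vertex set.
\<close>

locale min_degree_graph =
  fixes V :: "'a set" and E :: "'a \<Rightarrow> 'a \<Rightarrow> bool" and h :: nat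
  assumes finite_V: "finite V"
    and edge_in_V: "E u v \<Longrightarrow> u \<in> V"
    and edge_sym: "E u v \<Longrightarrow> E v u"
    and edge_irrefl: "\<not> E u u"
    and closed_eq_V: "\<lbrakk>U \<subseteq> V; U \<noteq> {}; \<And>u v. u \<in> U \<Longrightarrow> E u v \<Longrightarrow> v \<in> U\<rbrakk> \<Longrightarrow> U = V"
    and degree_ge: "v \<in> V \<Longrightarrow> h \<le> card {u. E v u}"
    and h_pos: "1 \<le> h"
    and order_ge: "2 * h + 3 \<le> card V"
begin

lemma edge_commute: "E u v \<longleftrightarrow> E v u"
  using edge_sym by blast

lemma edge_in_V': "E u v \<Longrightarrow> v \<in> V"
  using edge_in_V edge_sym by blast

definition path :: "'a list \<Rightarrow> bool" where
  "path xs \<longleftrightarrow> distinct xs \<and> set xs \<subseteq> V \<and> successively E xs"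

definition has_path :: "nat \<Rightarrow> bool" where
  "has_path m \<longleftrightarrow> (\<exists>xs. path xs \<and> length xs = m)"

definition has_two_paths :: "nat \<Rightarrow> nat \<Rightarrow> bool" where
  "has_two_paths p q \<longleftrightarrow> (\<exists>xs ys. path xs \<and> path ys \<and> set xs \<inter> set ys = {}
     \<and> length xs = p \<and> length ys = q)"

lemma path_append: "path (xs @ ys) \<longleftrightarrow> path xs \<and> path ys \<and> set xs \<inter> set ys = {}
    \<and> (xs = [] \<or> ys = [] \<or> E (last xs) (hd ys))"
  by (auto simp: path_def successively_append_iff)

lemma path_rev: "path (rev xs) \<longleftrightarrow> path xs"
  using edge_commute by (auto simp: path_def successively_rev)

lemma path_take: "path xs \<Longrightarrow> path (take i xs)"
  by (metis append_take_drop_id path_append)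

lemma path_drop: "path xs \<Longrightarrow> path (drop i xs)"
  by (metis append_take_drop_id path_append)

lemma path_nth_edge: "path xs \<Longrightarrow> Suc i < length xs \<Longrightarrow> E (xs ! i) (xs ! Suc i)"
  by (simp add: path_def successively_conv_nth)

lemma path_singleton: "path [v] \<longleftrightarrow> v \<in> V"
  by (simp add: path_def)

lemma path_length_le: "path xs \<Longrightarrow> length xs \<le> card V"
  unfolding path_def by (metis card_mono distinct_card finite_V)

lemma path_Cons: "path (x # xs) \<longleftrightarrow> x \<in> V \<and> path xs \<and> x \<notin> set xs \<and> (xs = [] \<or> E x (hd xs))"
  using path_append[of "[x]" xs] by (auto simp: path_singleton)

lemma path_snoc: "path (xs @ [x]) \<longleftrightarrow> x \<in> V \<and> path xs \<and> x \<notin> set xs \<and> (xs = [] \<or> E (last xs) x)"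
  using path_append[of xs "[x]"] by (auto simp: path_singleton)

lemma has_path_mono: "has_path m \<Longrightarrow> m' \<le> m \<Longrightarrow> has_path m'"
  unfolding has_path_def by (metis length_take min.absorb2 path_take)

lemma has_pathI: "path xs \<Longrightarrow> m \<le> length xs \<Longrightarrow> has_path m"
  using has_path_mono has_path_def by blast

lemma has_two_paths_sym: "has_two_paths p q \<Longrightarrow> has_two_paths q p"
  unfolding has_two_paths_def by blast

lemma has_two_pathsI:
  assumes "path xs" "path ys" "set xs \<inter> set ys = {}" "p \<le> length xs" "q \<le> length ys"
  shows "has_two_paths p q"
proof -
  have "path (take p xs)" "path (take q ys)" "set (take p xs) \<inter> set (take q ys) = {}"
    using assms set_take_subset[of p xs] set_take_subset[of q ys] by (auto simp: path_take)
  then show ?thesis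
    unfolding has_two_paths_def using assms(4,5) by (metis length_take min.absorb2)
qed

lemma has_two_paths_of_long_path: "has_path (p + q) \<Longrightarrow> has_two_paths p q"
proof -
  assume "has_path (p + q)"
  then obtain xs where xs: "path xs" "length xs = p + q"
    by (auto simp: has_path_def)
  have "path (take p xs)" "path (drop p xs)" "set (take p xs) \<inter> set (drop p xs) = {}"
    using xs path_take path_drop by (auto simp: path_def dest: set_take_disj_set_drop_if_distinct[of xs p p])
  then show ?thesis
    using xs by (intro has_two_pathsI[of "take p xs" "drop p xs"]) auto
qed

lemma exists_edge_out:
  assumes "U \<subseteq> V" "U \<noteq> {}" "U \<noteq> V"
  obtains u v where "u \<in> U" "v \<in> V - U" "E u v"
proof -
  have "\<exists>u v. u \<in> U \<and> E u v \<and> v \<notin> U"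
    using closed_eq_V[OF assms(1,2)] assms(3) by blast
  then show ?thesis
    using that edge_in_V' by blast
qed

lemma longest_path_hd_nbrs:
  assumes "path xs" "xs \<noteq> []" "\<not> has_path (Suc (length xs))"
  shows "E (hd xs) u \<Longrightarrow> u \<in> set xs"
proof (rule ccontr)
  assume "E (hd xs) u" "u \<notin> set xs"
  then have "path (u # xs)"
    using assms edge_sym edge_in_V' by (auto simp: path_Cons)
  then show False
    using assms(3) by (auto simp: has_path_def dest!: spec[of _ "u # xs"])
qed

lemma longest_path_last_nbrs:
  assumes "path xs" "xs \<noteq> []" "\<not> has_path (Suc (length xs))"
  shows "E (last xs) u \<Longrightarrow> u \<in> set xs"
  using longest_path_hd_nbrs[of "rev xs" u] assms by (simp add: path_rev hd_rev)

section \<open>Cycles and the vertices outside them\<close>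

text \<open>
  A cycle is a periodic sequence of vertices, so that rotating it is a shift of the argument and its arcs
  are intervals. An edge that is traversed back and forth counts as a cycle of length two; thus the
  case \<open>h = 1\<close> fits into the treatment of cycles of length \<open>2 h\<close>.
\<close>

definition cyc :: "nat \<Rightarrow> (nat \<Rightarrow> 'a) \<Rightarrow> bool" where
  "cyc l c \<longleftrightarrow> 0 < l \<and> (\<forall>i. E (c i) (c (Suc i))) \<and> (\<forall>i. c (i + l) = c i) \<and> inj_on c {..<l}"

lemma cyc_mod: assumes "cyc l c" shows "c (i mod l) = c i"
proof -
  have "c (j + k * l) = c j" for j k
  proof (induction k)
    case (Suc k)
    have "j + Suc k * l = (j + k * l) + l" by simp
    then show ?case using assms Suc by (metis cyc_def)
  qed simp
  from this[of "i mod l" "i div l"] show ?thesis by simp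
qed

lemma cyc_eq_iff: assumes "cyc l c" shows "c i = c j \<longleftrightarrow> i mod l = j mod l"
proof
  assume "c i = c j"
  then have "c (i mod l) = c (j mod l)" using cyc_mod[OF assms] by metis
  then show "i mod l = j mod l"
    using assms by (auto simp: cyc_def inj_on_def)
next
  assume "i mod l = j mod l"
  then show "c i = c j" using cyc_mod[OF assms] by metis
qed

lemma cyc_range: assumes "cyc l c" shows "range c = c ` {..<l}"
  using cyc_mod[OF assms] assms unfolding cyc_def
  by (metis (no_types, lifting) image_subset_iff lessThan_iff mod_less_divisor rangeI image_eqI
      subset_UNIV subset_antisym image_mono rangeE subsetI)

lemma cyc_card: "cyc l c \<Longrightarrow> card (range c) = l"
  unfolding cyc_range by (auto simp: cyc_def card_image)

lemma cyc_in_V: "cyc l c \<Longrightarrow> c i \<in> V"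
  using edge_in_V by (auto simp: cyc_def)

lemma cyc_inj_window:
  assumes "cyc l c" "i \<noteq> j" "s \<le> i" "s \<le> j" "i < s + l" "j < s + l"
  shows "c i \<noteq> c j"
proof -
  have False if "p < q" "q < p + l" "p mod l = q mod l" for p q
  proof -
    have "l dvd q - p" using that by (metis less_imp_le mod_eq_dvd_iff_nat)
    then show False using that by (auto dest: dvd_imp_le)
  qed
  from this[of i j] this[of j i] show ?thesis
    unfolding cyc_eq_iff[OF assms(1)] using assms by (cases i j rule: linorder_cases) auto
qed

lemma cyc_shift: assumes "cyc l c" shows "cyc l (\<lambda>i. c (s + i))"
proof -
  have "inj_on (\<lambda>i. c (s + i)) {..<l}"
    using cyc_inj_window[OF assms] by (auto simp: inj_on_def) (metis add_left_cancel le_add1 nat_add_left_cancel_less)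
  then show ?thesis using assms by (auto simp: cyc_def add.assoc[symmetric])
qed

lemma range_shift: assumes "cyc l c" shows "range (\<lambda>i. c (s + i)) = range c"
proof -
  have "c i \<in> range (\<lambda>i. c (s + i))" for i
  proof -
    have "0 < l" using assms by (simp add: cyc_def)
    then have "s \<le> l * s" by (cases l) auto
    then have "s + (i + (l * s - s)) = i + l * s" by linarith
    then have "c i = c (s + (i + (l * s - s)))"
      by (simp only: cyc_eq_iff[OF assms] mod_mult_self2)
    then show ?thesis by blast
  qed
  then show ?thesis by auto
qed

lemma cyc_arc: assumes "cyc l c" "r \<le> l" shows "path (map c [s..<s + r])"
proof -
  have "distinct (map c [s..<s + r])"
    using cyc_inj_window[OF assms(1)] assms(2) by (auto simp: distinct_map inj_on_def) (metis less_le_trans nat_add_left_cancel_le)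
  then show ?thesis
    using assms cyc_in_V[OF assms(1)]
    by (auto simp: path_def successively_conv_nth cyc_def)
qed

lemma cyc_of_path:
  assumes "path xs" "xs \<noteq> []" "E (last xs) (hd xs)"
  shows "cyc (length xs) (\<lambda>i. xs ! (i mod length xs))"
    and "range (\<lambda>i. xs ! (i mod length xs)) = set xs"
proof -
  let ?l = "length xs"
  have edge: "E (xs ! (i mod ?l)) (xs ! (Suc i mod ?l))" for i
  proof (cases "Suc (i mod ?l) = ?l")
    case True
    then have "Suc i mod ?l = 0" by (simp add: mod_Suc)
    moreover have "i mod ?l = ?l - 1" using True by simp
    ultimately show ?thesis using assms by (simp add: last_conv_nth hd_conv_nth)
  next
    case False
    then have "Suc i mod ?l = Suc (i mod ?l)" by (simp add: mod_Suc)
    moreover have "Suc (i mod ?l) < ?l"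
      using False assms(2) by (metis Suc_lessI length_greater_0_conv mod_less_divisor)
    ultimately show ?thesis using path_nth_edge[OF assms(1)] by metis
  qed
  have "inj_on (\<lambda>i. xs ! (i mod ?l)) {..<?l}"
    using assms(1) by (auto simp: path_def inj_on_def nth_eq_iff_index_eq)
  then show *: "cyc ?l (\<lambda>i. xs ! (i mod ?l))"
    using edge assms(2) by (auto simp: cyc_def)
  show "range (\<lambda>i. xs ! (i mod ?l)) = set xs"
    unfolding cyc_range[OF *] by (auto simp: set_conv_nth image_def)
qed

lemma cyc_extend:
  assumes "cyc l c" "path ws" "ws \<noteq> []" "set ws \<inter> range c = {}" "E (hd ws) (c i)"
  shows "has_path (l + length ws)"
proof -
  have "path (rev ws @ map c [i..<i + l])"
    unfolding path_append using assms cyc_arc[OF assms(1), of l i]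
    by (auto simp: path_rev last_rev cyc_def hd_map)
  then show ?thesis by (rule has_pathI) simp
qed

lemma cyc_extend_path:
  assumes "cyc l c" "l < card V"
  shows "has_path (Suc l)"
proof -
  have "range c \<subseteq> V" "range c \<noteq> V" using cyc_in_V[OF assms(1)] cyc_card[OF assms(1)] assms(2) by auto
  then obtain u v where "u \<in> range c" "v \<in> V - range c" "E u v"
    using exists_edge_out[of "range c"] by blast
  then show ?thesis
    using cyc_extend[OF assms(1), of "[v]"] by (auto simp: path_singleton edge_commute)
qed

lemma no_closed_path:
  assumes "path xs" "xs \<noteq> []" "length xs < card V" "\<not> has_path (Suc (length xs))"
  shows "\<not> E (last xs) (hd xs)"
  using cyc_of_path(1)[OF assms(1,2)] cyc_extend_path assms(3,4) by blast

text \<open>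
  Outside vertices that have an outside neighbour cannot be adjacent to the cycle, for this would give
  a path with two vertices more than the cycle. So they form a set that is closed under adjacency.
\<close>

lemma outside_independent:
  assumes "cyc l c" "\<not> has_path (l + 2)" "u \<notin> range c" "v \<notin> range c"
  shows "\<not> E u v"
proof
  assume "E u v"
  define W where "W = {w. w \<notin> range c \<and> (\<exists>w'. w' \<notin> range c \<and> E w w')}"
  have "W \<subseteq> V" using edge_in_V by (auto simp: W_def)
  moreover have "W \<noteq> {}" using \<open>E u v\<close> assms by (auto simp: W_def)
  moreover have "y \<in> W" if "x \<in> W" "E x y" for x y
  proof -
    obtain x' where x': "x' \<notin> range c" "E x x'" "x \<notin> range c" using \<open>x \<in> W\<close> by (auto simp: W_def)
    have "path [x, x']" using x' edge_irrefl edge_in_V edge_in_V' by (auto simp: path_def)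
    then have "y \<notin> range c"
      using cyc_extend[OF assms(1), of "[x, x']"] x' assms(2) that(2) by auto
    then show ?thesis using x' that(2) edge_sym by (auto simp: W_def)
  qed
  ultimately have "W = V" by (rule closed_eq_V)
  moreover have "c 0 \<in> V" "c 0 \<notin> W" using cyc_in_V[OF assms(1)] by (auto simp: W_def)
  ultimately show False by simp
qed

text \<open>
  If \<open>w = w'\<close>, inserting \<open>w\<close> gives a cycle of length \<open>l + 1\<close>, and some vertex is still left to extend it.
  If \<open>w \<noteq> w'\<close>, the cycle is opened between the two neighbours and prolonged at both ends.
\<close>

lemma no_consecutive_outside:
  assumes "cyc l c" "\<not> has_path (l + 2)" "l + 2 \<le> card V"
    and "w \<notin> range c" "w' \<notin> range c" "E w (c i)" "E w' (c (Suc i))"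
  shows False
proof (cases "w = w'")
  case True
  have l: "l \<noteq> 0" using assms(1) by (auto simp: cyc_def)
  have p: "path (map c [Suc i..<Suc i + l] @ [w])"
    unfolding path_snoc using cyc_arc[OF assms(1), of l "Suc i"] l assms edge_in_V
    using assms(1) by (auto simp: last_map cyc_def edge_commute)
  then have "cyc (Suc l) (\<lambda>i'. (map c [Suc i..<Suc i + l] @ [w]) ! (i' mod Suc l))"
    using cyc_of_path(1)[OF p] l True assms(7) by (simp add: hd_append hd_map del: upt_Suc)
  then show False using cyc_extend_path assms(2,3) by fastforce
next
  case False
  have l: "l \<noteq> 0" using assms(1) by (auto simp: cyc_def)
  have "path (w' # map c [Suc i..<Suc i + l] @ [w])"
    unfolding path_Cons path_snoc using cyc_arc[OF assms(1), of l "Suc i"] l assms edge_in_V False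
    using assms(1) by (auto simp: last_map cyc_def edge_commute hd_append hd_map simp del: upt_Suc)
  then show False using assms(2) by (auto dest: has_pathI[of _ "l + 2"])
qed

lemma nbrs_outside_card:
  assumes "cyc l c" "w \<in> V" "\<And>u. E w u \<Longrightarrow> u \<in> range c \<union> X" "finite X"
  shows "h \<le> card {i. i < l \<and> E w (c i)} + card X"
proof -
  have "{u. E w u} \<subseteq> c ` {i. i < l \<and> E w (c i)} \<union> X"
    using assms(3) unfolding cyc_range[OF assms(1)] by auto
  then have "card {u. E w u} \<le> card (c ` {i. i < l \<and> E w (c i)} \<union> X)"
    using assms(4) by (intro card_mono) auto
  also have "\<dots> \<le> card (c ` {i. i < l \<and> E w (c i)}) + card X" by (rule card_Un_le)
  also have "card (c ` {i. i < l \<and> E w (c i)}) \<le> card {i. i < l \<and> E w (c i)}"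
    by (rule card_image_le) simp
  finally show ?thesis using degree_ge[OF assms(2)] by simp
qed

text \<open>
  An arc of the cycle, given by its start \<open>s\<close> and its order \<open>r\<close>, is closed up through the outside
  path \<open>ws\<close>.
\<close>

lemma cyc_detour:
  assumes "cyc l c" "1 \<le> r" "r \<le> l" "path ws" "ws \<noteq> []" "set ws \<inter> range c = {}"
    and "E (hd ws) (c (s + r - 1))" "E (last ws) (c s)"
  shows "\<exists>d. cyc (r + length ws) d"
proof -
  let ?xs = "map c [s..<s + r]"
  have xs: "path ?xs" "?xs \<noteq> []" "hd ?xs = c s" "last ?xs = c (s + r - 1)" "length ?xs = r"
    using cyc_arc[OF assms(1,3)] assms(2) by (simp_all add: hd_map last_map)
  have "set ?xs \<inter> set ws = {}" using assms(6) by auto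
  then have p: "path (?xs @ ws)"
    unfolding path_append using xs assms(4,7) edge_sym by metis
  have "E (last (?xs @ ws)) (hd (?xs @ ws))"
    using xs assms(5,8) by (metis append_is_Nil_conv hd_append2 last_append)
  from cyc_of_path(1)[OF p _ this] assms(5) show ?thesis unfolding length_append xs(5) by auto
qed

lemma obtain_two_outside:
  assumes "cyc l c" "l + 2 \<le> card V"
  obtains w w' where "w \<in> V" "w' \<in> V" "w \<noteq> w'" "w \<notin> range c" "w' \<notin> range c"
proof -
  have "range c \<subseteq> V" using cyc_in_V[OF assms(1)] by auto
  then have "card (V - range c) = card V - card (range c)"
    by (rule card_Diff_subset[OF finite_subset[OF _ finite_V]]) fact
  then have "2 \<le> card (V - range c)" using assms(2) unfolding cyc_card[OF assms(1)] by linarith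
  then obtain W where W: "W \<subseteq> V - range c" "card W = 2"
    using obtain_subset_with_card_n[of 2 "V - range c"] by metis
  then obtain w w' where "W = {w, w'}" "w \<noteq> w'"
    unfolding card_2_iff by metis
  then show ?thesis using W(1) that[of w w'] by blast
qed

lemma outside_nbrs_on_cycle_card:
  assumes "cyc l c" "\<not> has_path (l + 2)" "w \<in> V" "w \<notin> range c"
  shows "h \<le> card {i. i < l \<and> E w (c (s + i))}"
proof -
  have "u \<in> range (\<lambda>i. c (s + i)) \<union> {}" if "E w u" for u
    unfolding range_shift[OF assms(1)] using outside_independent[OF assms(1,2,4), of u] that by blast
  then have "h \<le> card {i. i < l \<and> E w (c (s + i))} + card ({} :: 'a set)"
    by (intro nbrs_outside_card[OF cyc_shift[OF assms(1)] assms(3)]) simp_all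
  then show ?thesis by simp
qed

section \<open>A cycle of length $2h$ with independent complement\<close>

lemma outside_nbrs_alternate:
  assumes "cyc (2 * h) c" "\<not> has_path (2 * h + 2)" "w \<in> V" "w \<notin> range c"
  shows "E w (c (Suc i)) \<longleftrightarrow> \<not> E w (c i)"
proof -
  have n: "2 * h + 2 \<le> card V" using order_ge by simp
  show ?thesis
    using alternating_of_even_period[of h "\<lambda>i. E w (c i)", OF h_pos _ outside_nbrs_on_cycle_card[OF assms]]
      no_consecutive_outside[OF assms(1,2) n assms(4,4)] by blast
qed

text \<open>
  If \<open>w\<close> is adjacent to \<open>c i\<close>, then \<open>w'\<close> is not adjacent to \<open>c (Suc i)\<close> and, as its neighbours
  alternate too, it is adjacent to \<open>c i\<close>.
\<close>

lemma outside_nbrs_equal: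
  assumes "cyc (2 * h) c" "\<not> has_path (2 * h + 2)" "w \<in> V" "w \<notin> range c" "w' \<in> V" "w' \<notin> range c"
  shows "E w (c i) \<longleftrightarrow> E w' (c i)"
proof -
  have n: "2 * h + 2 \<le> card V" using order_ge by simp
  show ?thesis
    using no_consecutive_outside[OF assms(1,2) n assms(4,6), of i]
      no_consecutive_outside[OF assms(1,2) n assms(6,4), of i]
      outside_nbrs_alternate[OF assms(1,2,3,4), of i] outside_nbrs_alternate[OF assms(1,2,5,6), of i]
    by blast
qed

text \<open>
  The cover is the common neighbourhood \<open>A\<close> of the outside vertices. A cycle vertex that is not in \<open>A\<close> can
  be exchanged with the outside vertex \<open>w\<close>: this gives another cycle of length \<open>2 h\<close>, outside which
  lie the removed vertex and a second outside vertex \<open>w'\<close>, so both have the same neighbours on it.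
\<close>

lemma vertex_cover_of_even_cycle:
  assumes "cyc (2 * h) c" "\<not> has_path (2 * h + 2)"
  shows "\<exists>A\<subseteq>V. card A = h \<and> (\<forall>u v. E u v \<longrightarrow> u \<in> A \<or> v \<in> A)"
proof -
  have n: "2 * h + 2 \<le> card V" using order_ge by simp
  obtain w w' where w: "w \<in> V" "w' \<in> V" "w \<noteq> w'" "w \<notin> range c" "w' \<notin> range c"
    using obtain_two_outside[OF assms(1) n] .
  note alt = outside_nbrs_alternate[OF assms w(1,4)]
  let ?A = "{u. E w u}"
  have A_cyc: "?A \<subseteq> range c"
    using outside_independent[OF assms w(4)] by blast
  have "?A = c ` {i. i < 2 * h \<and> E w (c i)}"
    using A_cyc unfolding cyc_range[OF assms(1)] by auto
  then have "card ?A \<le> card {i. i < 2 * h \<and> E w (c i)}" by (simp add: card_image_le)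
  also have "\<dots> \<le> h"
    by (rule card_no_consecutive_le) (use alt in auto)
  finally have "card ?A = h" using degree_ge[OF w(1)] by simp
  moreover have "u \<in> ?A \<or> v \<in> ?A" if "E u v" for u v
  proof -
    have mixed: "y \<in> ?A" if "E x y" "x \<notin> range c" for x y
    proof -
      have "y \<in> range c" using outside_independent[OF assms that(2)] that(1) by blast
      then show ?thesis
        using outside_nbrs_equal[OF assms edge_in_V[OF that(1)] that(2) w(1,4)] that(1) by auto
    qed
    show ?thesis
    proof (cases "u \<in> range c \<and> v \<in> range c \<and> u \<notin> ?A")
      case False
      then show ?thesis using mixed[of u v] mixed[of v u] \<open>E u v\<close> edge_sym by blast
    next
      case True
      then obtain i j where ij: "u = c i" "v = c j" "\<not> E w (c i)" by auto
      \<comment> \<open>the cycle with \<open>u\<close> exchanged for \<open>w\<close>\<close>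
      define d where "d k = (if c k = c i then w else c k)" for k
      have "inj_on d {..<2 * h}"
        using assms(1) w(4) by (auto simp: inj_on_def d_def cyc_def)
      moreover have "E (d k) (d (Suc k))" for k
      proof -
        have k: "E (c k) (c (Suc k))" using assms(1) by (simp add: cyc_def)
        consider "c k = c i" "c (Suc k) \<noteq> c i" | "c k \<noteq> c i" "c (Suc k) = c i"
          | "c k \<noteq> c i" "c (Suc k) \<noteq> c i"
          using k edge_irrefl by metis
        then show ?thesis
        proof cases
          case 1
          then show ?thesis using alt[of k] ij(3) by (simp add: d_def)
        next
          case 2
          then show ?thesis using alt[of k] ij(3) edge_sym[of w "c k"] by (simp add: d_def)
        next
          case 3
          then show ?thesis using k by (simp add: d_def)
        qed
      qed
      ultimately have d: "cyc (2 * h) d"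
        using assms(1) by (auto simp: cyc_def d_def)
      have "u \<notin> range d" "w' \<notin> range d"
        using w ij(1) by (auto simp: d_def)
      moreover have "v = d j" using ij \<open>E u v\<close> edge_irrefl by (auto simp: d_def)
      ultimately have "E w' (c j)"
        using outside_nbrs_equal[OF d assms(2) edge_in_V[OF \<open>E u v\<close>] _ w(2), of j] \<open>E u v\<close> ij
        by auto
      then have "E w (c j)"
        using outside_nbrs_equal[OF assms w(1,4) w(2,5)] by blast
      then show ?thesis using ij by simp
    qed
  qed
  ultimately show ?thesis
    using edge_in_V' by (intro exI[of _ ?A]) auto
qed

section \<open>A cycle of length $2h+1$\<close>

text \<open>
  After a rotation every outside vertex is adjacent exactly to the odd positions below \<open>2 h + 1\<close>. The arc
  from position \<open>1\<close> to position \<open>2 b - 1\<close> has odd ends, so two outside vertices prolong it at both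
  ends; the remaining arc has order \<open>2 h + 2 - 2 b = 2 a\<close>.
\<close>

lemma two_paths_of_odd_cycle:
  assumes "cyc (2 * h + 1) c" "\<not> has_path (2 * h + 3)" "1 \<le> a" "1 \<le> b" "a + b = h + 1"
  shows "has_two_paths (2 * a) (2 * b + 1)"
proof -
  let ?l = "2 * h + 1"
  have n: "?l + 2 \<le> card V" using order_ge by simp
  have np: "\<not> has_path (?l + 2)" using assms(2) by (simp add: numeral_3_eq_3)
  obtain w w' where w: "w \<in> V" "w' \<in> V" "w \<noteq> w'" "w \<notin> range c" "w' \<notin> range c"
    using obtain_two_outside[OF assms(1) n] .
  have period: "E w (c (i + ?l)) = E w (c i)" for i using assms(1) by (simp add: cyc_def)
  have "\<exists>s. \<forall>i<?l. E w (c (s + i)) \<longleftrightarrow> odd i"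
    using alternating_of_odd_period[of h "\<lambda>i. E w (c i)", OF h_pos _ period
        outside_nbrs_on_cycle_card[OF assms(1) np w(1,4)]]
      no_consecutive_outside[OF assms(1) np n w(4) w(4)] by blast
  then obtain s where s: "\<And>i. i < ?l \<Longrightarrow> E w (c (s + i)) \<longleftrightarrow> odd i" by blast
  define d where "d i = c (s + i)" for i
  have d: "cyc ?l d" and range_d: "range d = range c"
    using cyc_shift[OF assms(1)] range_shift[OF assms(1)] by (simp_all add: d_def[abs_def])
  have w_nbrs: "E w (d i) \<longleftrightarrow> odd i" if "i < ?l" for i using s that by (simp add: d_def)
  have consec: "\<not> (E w (d i) \<and> E w' (d (Suc i)))" "\<not> (E w' (d i) \<and> E w (d (Suc i)))" for i
    using no_consecutive_outside[OF d np n, of w w'] no_consecutive_outside[OF d np n, of w' w] w range_d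
    by auto
  have sub: "{i. i < ?l \<and> E w' (d i)} \<subseteq> {i. i < ?l \<and> odd i}"
  proof (rule subsetI, rule ccontr)
    fix i assume "i \<in> {i. i < ?l \<and> E w' (d i)}" "i \<notin> {i. i < ?l \<and> odd i}"
    then have i: "i < ?l" "E w' (d i)" "\<not> odd i" by auto
    show False
    proof (cases "i = 2 * h")
      case True
      then have "E w (d (2 * h - 1))" "i = Suc (2 * h - 1)" using h_pos by (auto simp: w_nbrs)
      then show False using consec(1) i by metis
    next
      case False
      then have "E w (d (Suc i))" using i by (intro w_nbrs[THEN iffD2]) auto
      then show False using consec(2) i by blast
    qed
  qed
  have "{i. i < ?l \<and> odd i} = (\<lambda>j. 2 * j + 1) ` {..<h}"
    by (auto elim!: oddE)
  then have "card {i. i < ?l \<and> odd i} \<le> h" by (simp add: card_image_le[of "{..<h}", simplified])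
  moreover have "h \<le> card {i. i < ?l \<and> E w' (d i)}"
    using outside_nbrs_on_cycle_card[OF d np w(2), of 0] w range_d by simp
  ultimately have "{i. i < ?l \<and> E w' (d i)} = {i. i < ?l \<and> odd i}"
    using sub by (intro card_seteq) auto
  then have w'_nbrs: "E w' (d i) \<longleftrightarrow> odd i" if "i < ?l" for i using that by auto
  define xs ys where "xs = map d [1..<2 * b]" and "ys = map d [2 * b..<1 + ?l]"
  have "[1..<1 + ?l] = [1..<2 * b] @ [2 * b..<1 + ?l]"
    using assms(4,5) upt_add_eq_append[of 1 "2 * b" "1 + ?l - 2 * b"] by simp
  then have "path (xs @ ys)"
    using cyc_arc[OF d order_refl, of 1] unfolding xs_def ys_def map_append[symmetric] by metis
  then have parts: "path xs" "path ys" "set xs \<inter> set ys = {}"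
    unfolding path_append by blast+
  have out: "w \<notin> set xs" "w' \<notin> set xs" "w \<notin> set ys" "w' \<notin> set ys"
    using w range_d unfolding xs_def ys_def by auto
  have ends: "hd xs = d 1" "last xs = d (2 * b - 1)" "xs \<noteq> []"
    using assms(4) by (simp_all add: xs_def hd_map last_map)
  have "E w (hd xs)" "E (last xs) w'"
    unfolding ends edge_commute[of _ w'] using assms(3-5) by (simp_all add: w_nbrs w'_nbrs)
  then have "path (w # xs @ [w'])"
    unfolding path_Cons path_snoc using parts(1) w(1-3) out ends(3) by simp
  moreover have "set ys \<inter> set (w # xs @ [w']) = {}" using parts(3) out by auto
  moreover have "2 * a \<le> length ys" "2 * b + 1 \<le> length (w # xs @ [w'])"
    using assms(3-5) by (simp_all add: xs_def ys_def)
  ultimately show ?thesis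
    using has_two_pathsI[OF parts(2)] by blast
qed

section \<open>A cycle of length $2h$ that misses an edge\<close>

context
  fixes c x y
  assumes c: "cyc (2 * h) c" and no_path: "\<not> has_path (2 * h + 3)" and no_cyc: "\<And>d. \<not> cyc (2 * h + 1) d"
    and x: "x \<notin> range c" and y: "y \<notin> range c" and xy: "E x y"
begin

lemma no_consecutive_nbrs: "u \<in> V \<Longrightarrow> u \<notin> range c \<Longrightarrow> E u (c i) \<Longrightarrow> \<not> E u (c (Suc i))"
proof
  assume u: "u \<in> V" "u \<notin> range c" "E u (c i)" "E u (c (Suc i))"
  then have "\<exists>d. cyc (2 * h + length [u]) d"
    using h_pos c by (intro cyc_detour[OF c, of "2 * h" "[u]" "Suc i"]) (auto simp: path_singleton cyc_def)
  then show False using no_cyc by simp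
qed

text \<open>
  If the ends of an outside edge attach at distance one or two, the detour through the edge gives a
  cycle of length \<open>2 h + 2\<close> or \<open>2 h + 1\<close>. The former would extend to a path of order \<open>2 h + 3\<close>.
\<close>

lemma edge_attachment_gap:
  assumes "E x (c i)"
  shows "\<not> E y (c (Suc i))" "\<not> E y (c (Suc (Suc i)))"
proof -
  have p: "path [x, y]" using xy edge_irrefl edge_in_V edge_in_V' by (auto simp: path_def)
  show "\<not> E y (c (Suc i))"
  proof
    assume "E y (c (Suc i))"
    then have "\<exists>d. cyc (2 * h + length [x, y]) d"
      using assms x y p h_pos c by (intro cyc_detour[OF c, of "2 * h" "[x, y]" "Suc i"]) (auto simp: cyc_def)
    then obtain d where "cyc (2 * h + 2) d" by auto
    then show False using cyc_extend_path[of "2 * h + 2" d] order_ge no_path by (simp add: numeral_3_eq_3)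
  qed
  show "\<not> E y (c (Suc (Suc i)))"
  proof
    assume "E y (c (Suc (Suc i)))"
    moreover have "Suc (Suc i) + (2 * h - 1) - 1 = i + 2 * h" using h_pos by simp
    ultimately have "\<exists>d. cyc (2 * h - 1 + length [x, y]) d"
      using assms x y p h_pos c
      by (intro cyc_detour[OF c, of "2 * h - 1" "[x, y]" "Suc (Suc i)"]) (auto simp: cyc_def)
    moreover have "2 * h - 1 + length [x, y] = 2 * h + 1" using h_pos by simp
    ultimately show False using no_cyc by simp
  qed
qed

lemma attached_edge_nbrs:
  assumes "E y (c j)" "E x u"
  shows "u \<in> range c \<union> {y}"
proof (rule ccontr)
  assume "u \<notin> range c \<union> {y}"
  moreover from this have "path [y, x, u]"
    using assms(2) xy edge_irrefl edge_in_V edge_in_V' edge_sym[OF xy] by (auto simp: path_def)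
  ultimately show False
    using cyc_extend[OF c, of "[y, x, u]" j] assms(1) x y no_path by (auto simp: numeral_3_eq_3)
qed

end

text \<open>
  The positions of the neighbours of \<open>x\<close>, and those of \<open>y\<close> moved by one and by two, are pairwise
  disjoint subsets of a period and have at least \<open>h - 1\<close> elements each. So \<open>3 (h - 1) \<le> 2 h\<close>. On
  the other hand the attachments \<open>c i \<noteq> c j\<close> are at distance at least three both ways round, which
  needs \<open>2 h \<ge> 6\<close>.
\<close>

lemma six_cycle_of_attached_edge:
  assumes c: "cyc (2 * h) c" and no: "\<not> has_path (2 * h + 3)" "\<And>d. \<not> cyc (2 * h + 1) d"
    and x: "x \<notin> range c" and y: "y \<notin> range c" and xy: "E x y"
    and att: "E x (c i)" "E y (c j)" "c i \<noteq> c j"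
  shows "h = 3 \<and> (\<exists>d. cyc 6 d \<and> range d = range c \<and> E x (d 0) \<and> E y (d 3))"
proof -
  note yx = edge_sym[OF xy]
  define d where "d k = c (i + k)" for k
  have d: "cyc (2 * h) d" and rd: "range d = range c"
    using cyc_shift[OF c] range_shift[OF c] by (simp_all add: d_def[abs_def])
  have x': "x \<notin> range d" and y': "y \<notin> range d" using x y rd by auto
  have "c j \<in> range d" using rd by auto
  then obtain k where k: "k < 2 * h" "c j = d k" unfolding cyc_range[OF d] by auto
  have xd: "E x (d 0)" "E x (d (2 * h))" and yd: "E y (d k)"
    using att k c by (auto simp: d_def cyc_def)
  note gx = edge_attachment_gap[OF d no x' y' xy] and gy = edge_attachment_gap[OF d no y' x' yx]
  have "k \<noteq> 0" using att(3) k by (auto simp: d_def intro: ccontr)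
  moreover have "k \<noteq> 1" "k \<noteq> 2" using gx[OF xd(1)] yd by (auto simp: numeral_2_eq_2)
  moreover have "Suc k \<noteq> 2 * h" "Suc (Suc k) \<noteq> 2 * h" using gy[OF yd] xd(2) by auto
  ultimately have k': "3 \<le> k" "k + 3 \<le> 2 * h" using k(1) by auto
  define X where "X s = {i. i < 2 * h \<and> E x (d (s + i))}" for s
  define Y where "Y s = {i. i < 2 * h \<and> E y (d (s + i))}" for s
  \<comment> \<open>attachments of \<open>x\<close> and \<open>y\<close> are neither consecutive nor two apart, and those of \<open>y\<close> alone are not consecutive\<close>
  have disj: "X 0 \<inter> Y 1 = {}" "X 0 \<inter> Y 2 = {}" "Y 1 \<inter> Y 2 = {}"
    using gx no_consecutive_nbrs[OF d no x' y' xy edge_in_V'[OF xy] y'] by (auto simp: X_def Y_def)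
  have "u \<in> range d \<union> {y}" if "E x u" for u
    using attached_edge_nbrs[OF d no x' y' xy yd that] .
  from nbrs_outside_card[OF d edge_in_V[OF xy] this] have hX: "h \<le> card (X 0) + 1" by (simp add: X_def)
  have "u \<in> range (\<lambda>i. d (s + i)) \<union> {x}" if "E y u" for u s
    unfolding range_shift[OF d] using attached_edge_nbrs[OF d no y' x' yx xd(1) that] .
  from nbrs_outside_card[OF cyc_shift[OF d] edge_in_V'[OF xy] this]
  have hY: "h \<le> card (Y s) + 1" for s by (simp add: Y_def)
  have fin: "finite (X s)" "finite (Y s)" for s by (auto simp: X_def Y_def)
  have "card (X 0) + card (Y 1) + card (Y 2) = card (X 0 \<union> Y 1 \<union> Y 2)"
    using disj fin by (simp add: card_Un_disjoint Int_Un_distrib2)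
  also have "\<dots> \<le> card {..<2 * h}" by (rule card_mono) (auto simp: X_def Y_def)
  finally have "h \<le> 3" using hX hY[of 1] hY[of 2] by simp
  then have "h = 3" "k = 3" using k' by auto
  then show ?thesis using d rd xd yd by auto
qed

text \<open>
  Any other attachment of an outside vertex \<open>u\<close> is next to \<open>d 0\<close> or \<open>d 3\<close>; going from there round the
  whole cycle and then through the edge \<open>x y\<close> makes a path of order nine. If \<open>u\<close> is an end of this
  edge, the distance bounds on attachments apply.
\<close>

lemma outside_six_cycle_nbrs_subset:
  assumes h: "h = 3" and d: "cyc 6 d" and no: "\<not> has_path 9" "\<And>d. \<not> cyc 7 d"
    and x: "x \<notin> range d" and y: "y \<notin> range d" and xy: "E x y" and att: "E x (d 0)" "E y (d 3)"
    and u: "u \<in> V" "u \<notin> range d" "E u (d k)"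
  shows "d k \<in> {d 0, d 3}"
proof -
  note yx = edge_sym[OF xy]
  have d': "cyc (2 * h) d" and no': "\<not> has_path (2 * h + 3)" "\<And>d. \<not> cyc (2 * h + 1) d"
    using h d no by auto
  have per: "d (i + 6) = d i" for i using d by (simp add: cyc_def)
  have d6: "d 6 = d 0" "d 8 = d 2" "d 9 = d 3" using per[of 0] per[of 2] per[of 3] by simp_all
  have distinct_xy: "x \<noteq> y" using xy edge_irrefl by auto
  have xyV: "x \<in> V" "y \<in> V" using xy edge_in_V edge_in_V' by auto
  have k6: "d k = d (k mod 6)" using cyc_mod[OF d] by metis
  then have "E u (d (k mod 6))" using u(3) by metis
  moreover have "k mod 6 = 0 \<or> k mod 6 = 1 \<or> k mod 6 = 2 \<or> k mod 6 = 3 \<or> k mod 6 = 4 \<or> k mod 6 = 5"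
    by presburger
  moreover have "\<not> E u (d 1) \<and> \<not> E u (d 2) \<and> \<not> E u (d 4) \<and> \<not> E u (d 5)"
  proof (cases "u = x \<or> u = y")
    case True
    note gx = edge_attachment_gap[OF d' no' x y xy] and gy = edge_attachment_gap[OF d' no' y x yx]
    note nx = no_consecutive_nbrs[OF d' no' x y xy u(1,2)]
    from True show ?thesis
    proof
      assume u: "u = x"
      then have "\<not> E u (d 1)" "\<not> E u (d 5)"
        using nx[of 0] nx[of 5] att(1) d6(1) by auto
      moreover have "\<not> E u (d 2)" "\<not> E u (d 4)"
        using gx(1)[of 2] gy(1)[OF att(2)] att(2) u by auto
      ultimately show ?thesis by blast
    next
      assume u: "u = y"
      then have "\<not> E u (d 1)" "\<not> E u (d 2)"
        using gx[OF att(1)] by (auto simp: numeral_2_eq_2)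
      moreover have "\<not> E u (d 4)" "\<not> E u (d 5)"
        using nx[of 3] gy(1)[of 5] att d6(1) u by auto
      ultimately show ?thesis by blast
    qed
  next
    case False
    have no_9: False if "path zs" "length zs = 6" "set zs = range d" "E u (hd zs)"
      "E (last zs) v" "E v w" "v \<notin> range d" "w \<notin> range d" "u \<noteq> v" "u \<noteq> w" for zs v w
    proof -
      have "path [v, w]" using that edge_irrefl edge_in_V edge_in_V' by (auto simp: path_def)
      then have "path (zs @ [v, w])" unfolding path_append using that by auto
      moreover have "u \<notin> set (zs @ [v, w])" "zs \<noteq> []" using that u by auto
      ultimately have "path (u # zs @ [v, w])"
        unfolding path_Cons[of u] using u(1) that(4) by simp
      then show False using no(1) has_pathI[of "u # zs @ [v, w]" 9] that(2) by simp
    qed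
    have arc: "path (map d [i..<i + 6])" "hd (map d [i..<i + 6]) = d i"
      "last (map d [i..<i + 6]) = d (i + 5)" "set (map d [i..<i + 6]) = range d" for i
    proof -
      show *: "path (map d [i..<i + 6])" using cyc_arc[OF d order_refl] .
      show "hd (map d [i..<i + 6]) = d i" "last (map d [i..<i + 6]) = d (i + 5)"
        by (simp_all add: hd_map last_map add.commute)
      have "card (set (map d [i..<i + 6])) = length (map d [i..<i + 6])"
        using * distinct_card unfolding path_def by blast
      moreover have "finite (range d)" unfolding cyc_range[OF d] by simp
      ultimately show "set (map d [i..<i + 6]) = range d"
        using cyc_card[OF d] by (intro card_subset_eq) auto
    qed
    have key: "\<not> (E u (d i) \<and> E (d (i + 5)) v)" "\<not> (E u (d (i + 5)) \<and> E (d i) v)"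
      if "E v w" "v \<notin> range d" "w \<notin> range d" "u \<noteq> v" "u \<noteq> w" for i v w
      using no_9[of "map d [i..<i + 6]" v w] no_9[of "rev (map d [i..<i + 6])" v w] that
      unfolding path_rev hd_rev last_rev set_rev length_rev arc(2-4) using arc(1) by auto
    have "u \<noteq> x" "u \<noteq> y" using False by auto
    moreover have "E (d 0) x" "E (d 3) y" using att edge_sym by blast+
    ultimately show ?thesis
      using key(1)[OF xy x y, of 1] key(2)[OF xy x y, of 0] key(1)[OF yx y x, of 4] key(2)[OF yx y x, of 3]
      by (simp add: d6)
  qed
  ultimately have "k mod 6 = 0 \<or> k mod 6 = 3" by metis
  then show ?thesis unfolding k6 by auto
qed

text \<open>
  An outside vertex has at most two neighbours on the cycle, hence an outside neighbour. It has only
  one: the outside vertices with two outside neighbours form a set closed under adjacency, since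
  a path of order three outside cannot start next to the cycle and a vertex that is not adjacent
  to the cycle has three outside neighbours.
\<close>

lemma outside_six_cycle_nbrs:
  assumes h: "h = 3" and d: "cyc 6 d" and no: "\<not> has_path 9" "\<And>d. \<not> cyc 7 d"
    and x: "x \<notin> range d" and y: "y \<notin> range d" and xy: "E x y" and att: "E x (d 0)" "E y (d 3)"
    and v: "v \<in> V" "v \<notin> range d"
  shows "\<exists>v'. v' \<notin> range d \<and> {u. E v u} = {d 0, d 3, v'}"
proof -
  define O' where "O' u = {v. E u v \<and> v \<notin> range d}" for u
  have fin: "finite (O' u)" for u
    using finite_subset[OF _ finite_V, of "O' u"] edge_in_V' by (auto simp: O'_def)
  have nbrs: "{w. E u w} \<subseteq> {d 0, d 3} \<union> O' u" if "u \<in> V" "u \<notin> range d" for u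
    using outside_six_cycle_nbrs_subset[OF h d no x y xy att that] by (auto simp: O'_def)
  have short: "\<not> E u1 (d k)" if "E u1 u2" "E u2 u3" "u1 \<noteq> u3" "u1 \<notin> range d" "u2 \<notin> range d" "u3 \<notin> range d"
    for u1 u2 u3 k
  proof
    assume "E u1 (d k)"
    moreover have "path [u1, u2, u3]" using that edge_irrefl edge_in_V edge_in_V' by (auto simp: path_def)
    ultimately show False using cyc_extend[OF d, of "[u1, u2, u3]" k] that no by auto
  qed
  have lots: "3 \<le> card (O' u)" if "u \<in> V" "\<And>k. \<not> E u (d k)" for u
  proof -
    have "{w. E u w} = O' u" using that by (auto simp: O'_def)
    then show ?thesis using degree_ge[OF that(1)] h by simp
  qed
  \<comment> \<open>the outside vertices with at least two outside neighbours; this set is closed under adjacency\<close>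
  define U where "U = {u \<in> V. u \<notin> range d \<and> 2 \<le> card (O' u)}"
  have "U = {}"
  proof (rule ccontr)
    assume "U \<noteq> {}"
    moreover have "w \<in> U" if "u \<in> U" "E u w" for u w
    proof -
      have u: "u \<in> V" "u \<notin> range d" "2 \<le> card (O' u)" using that by (auto simp: U_def)
      have other: "\<exists>t\<in>O' z. t \<noteq> s" if "2 \<le> card (O' z)" for z s
      proof (rule ccontr)
        assume "\<not> ?thesis"
        then have "O' z \<subseteq> {s}" by auto
        then have "card (O' z) \<le> card {s}" by (rule card_mono[rotated]) simp
        then show False using that by simp
      qed
      have step: "\<not> E t (d k)" if "t \<in> O' u" for t k
      proof -
        obtain s where "s \<in> O' u" "s \<noteq> t" using other[OF u(3)] by blast
        then show ?thesis using short[of t u s k] that u edge_sym[of u t] by (auto simp: O'_def)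
      qed
      obtain t where t: "t \<in> O' u" using other[OF u(3)] by blast
      have "t \<in> V" using t edge_in_V' by (auto simp: O'_def)
      then have "3 \<le> card (O' t)" using lots step[OF t] by blast
      then obtain s where s: "s \<in> O' t" "s \<noteq> u" using other[of t u] by auto
      have "\<not> E u (d k)" for k
        using short[of u t s k] s t u by (auto simp: O'_def)
      then have w: "w \<in> O' u" using that(2) by (auto simp: O'_def)
      then have "w \<in> V" "w \<notin> range d" using edge_in_V' by (auto simp: O'_def)
      moreover have "3 \<le> card (O' w)" using lots[OF \<open>w \<in> V\<close>] step[OF w] by blast
      ultimately show ?thesis by (simp add: U_def)
    qed
    moreover have "U \<subseteq> V" by (auto simp: U_def)
    ultimately have "U = V" using closed_eq_V[of U] by blast
    moreover have "d 0 \<in> V" "d 0 \<notin> U" using cyc_in_V[OF d] by (auto simp: U_def)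
    ultimately show False by simp
  qed
  then have "card (O' v) \<le> 1" using v by (auto simp: U_def)
  then have same: "\<forall>s\<in>O' v. \<forall>t\<in>O' v. s = t" using card_le_Suc0_iff_eq[OF fin, of v] by simp
  have "\<exists>v'. O' v \<subseteq> {v'}"
  proof (cases "O' v = {}")
    case False
    then obtain v' where "v' \<in> O' v" by blast
    then show ?thesis using same by blast
  qed simp
  moreover have "3 \<le> card {w. E v w}" using degree_ge[OF v(1)] h by simp
  moreover have "{w. E v w} \<subseteq> {d 0, d 3} \<union> O' v" using nbrs[OF v] .
  ultimately obtain v' where v': "O' v \<subseteq> {v'}" "{w. E v w} \<subseteq> {d 0, d 3, v'}" by blast
  have "card {d 0, d 3, v'} \<le> 3" by (simp add: card_insert_if)
  then have eq: "{w. E v w} = {d 0, d 3, v'}"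
    using v'(2) \<open>3 \<le> card {w. E v w}\<close> by (intro card_seteq) auto
  moreover have "v' \<notin> range d"
  proof
    assume "v' \<in> range d"
    then have "O' v = {}" using v' by (auto simp: O'_def)
    then have "{w. E v w} \<subseteq> {d 0, d 3}" using nbrs[OF v] by simp
    then have "card {w. E v w} \<le> card {d 0, d 3}" by (rule card_mono[rotated]) simp
    also have "\<dots> \<le> 2" by (simp add: card_insert_if)
    finally show False using \<open>3 \<le> card {w. E v w}\<close> by simp
  qed
  ultimately show ?thesis by blast
qed

text \<open>
  Apart from a possible edge \<open>p q\<close>, the graph is the join of \<open>p, q\<close> with a perfect matching.
\<close>

definition joined_matching_at :: "'a \<Rightarrow> 'a \<Rightarrow> bool" where
  "joined_matching_at p q \<longleftrightarrow> p \<in> V \<and> q \<in> V \<and> p \<noteq> q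
     \<and> (\<forall>v\<in>V - {p, q}. \<exists>v'\<in>V - {p, q}. {u. E v u} = {p, q, v'})"

lemma outside_closed_six_path_nbrs:
  assumes h: "h = 3" and zs: "path [z0, z1, z2, z3, z4, z5]" "E z5 z0"
    and no: "\<not> has_path 9" "\<And>d. \<not> cyc 7 d"
    and xy: "x \<notin> {z0, z1, z2, z3, z4, z5}" "y \<notin> {z0, z1, z2, z3, z4, z5}" "E x y" "E x z0" "E y z3"
    and v: "v \<in> V" "v \<notin> {z0, z1, z2, z3, z4, z5}"
  shows "\<exists>v'. v' \<notin> {z0, z1, z2, z3, z4, z5} \<and> {u. E v u} = {z0, z3, v'}"
proof -
  let ?zs = "[z0, z1, z2, z3, z4, z5]"
  define d where "d i = ?zs ! (i mod 6)" for i
  have closed: "?zs \<noteq> []" "E (last ?zs) (hd ?zs)" and len: "length ?zs = 6"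
    using zs by simp_all
  have d: "cyc 6 d" "range d = {z0, z1, z2, z3, z4, z5}"
    using cyc_of_path[OF zs(1) closed] unfolding len d_def[abs_def] by simp_all
  moreover have "d 0 = z0" "d 3 = z3" by (simp_all add: d_def)
  ultimately show ?thesis
    using outside_six_cycle_nbrs[OF h d(1) no, of x y v] xy v by simp
qed

text \<open>
  The three pairs \<open>d 1, d 2\<close>, \<open>d 4, d 5\<close> and \<open>x, y\<close> are interchangeable: any two of them together with
  \<open>d 0\<close> and \<open>d 3\<close> form a six-cycle, and the third is an outside edge attached to \<open>d 0\<close> and \<open>d 3\<close>. So the
  description of the outside vertices applies to every vertex but \<open>d 0\<close> and \<open>d 3\<close>. The two paths exist
  for \<open>a < 3\<close> because a fourth pair is available.
\<close>

lemma two_paths_or_joined_matching: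
  assumes c: "cyc (2 * h) c" and no_path: "\<not> has_path (2 * h + 3)" and no_cyc: "\<And>d. \<not> cyc (2 * h + 1) d"
    and "x \<notin> range c" "y \<notin> range c" "E x y" "E x (c i)" "E y (c j)" "c i \<noteq> c j"
    and ab: "1 \<le> a" "1 \<le> b" "a + b = h + 1"
  shows "has_two_paths (2 * a) (2 * b + 1) \<or> (a = 3 \<and> b = 1 \<and> h = 3 \<and> (\<exists>p q. joined_matching_at p q))"
proof -
  obtain d where h: "h = 3" and d: "cyc 6 d" and range_d: "range d = range c"
    and att: "E x (d 0)" "E y (d 3)"
    using six_cycle_of_attached_edge[OF c no_path no_cyc assms(4-9)] by blast
  have no: "\<not> has_path 9" "\<And>e. \<not> cyc 7 e" using no_path no_cyc h by auto
  have upt: "[0..<6] = [0, 1, 2, 3, 4, 5 :: nat]" by (simp add: upt_rec)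
  have C: "path [d 0, d 1, d 2, d 3, d 4, d 5]"
    using cyc_arc[OF d order_refl, of 0] by (simp add: upt)
  have edges: "E (d 0) (d 1)" "E (d 1) (d 2)" "E (d 2) (d 3)" "E (d 3) (d 4)" "E (d 4) (d 5)" "E (d 5) (d 0)"
  proof -
    have e: "E (d i) (d (Suc i))" "d (i + 6) = d i" for i using d by (auto simp: cyc_def)
    show "E (d 0) (d 1)" "E (d 1) (d 2)" "E (d 2) (d 3)" "E (d 3) (d 4)" "E (d 4) (d 5)" "E (d 5) (d 0)"
      using e(1)[of 0] e(1)[of 1] e(1)[of 2] e(1)[of 3] e(1)[of 4] e(1)[of 5] e(2)[of 0] by (simp_all add: eval_nat_numeral)
  qed
  have "{..<6} = {0, 1, 2, 3, 4, 5 :: nat}" by auto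
  then have rd: "range d = {d 0, d 1, d 2, d 3, d 4, d 5}" unfolding cyc_range[OF d] by simp
  have xy: "x \<notin> {d 0, d 1, d 2, d 3, d 4, d 5}" "y \<notin> {d 0, d 1, d 2, d 3, d 4, d 5}" "E x y" "x \<noteq> y"
    "x \<in> V" "y \<in> V" "E y x"
    using assms(4-6) range_d rd edge_irrefl edge_in_V edge_in_V' edge_sym[OF assms(6)] by auto
  have rev_att: "E (d 0) x" "E (d 3) y" using att edge_sym by blast+
  have distinct: "distinct [d 0, d 1, d 2, d 3, d 4, d 5]" and dV: "set [d 0, d 1, d 2, d 3, d 4, d 5] \<subseteq> V"
    using C unfolding path_def by blast+
  note n1 = outside_closed_six_path_nbrs[OF h C edges(6) no xy(1-3) att]
  have "path [d 0, x, y, d 3, d 4, d 5]"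
    unfolding path_def using distinct dV xy edges rev_att att by auto
  then have n2: "\<exists>v'. v' \<notin> {d 0, x, y, d 3, d 4, d 5} \<and> {u. E v u} = {d 0, d 3, v'}"
    if "v \<in> V" "v \<notin> {d 0, x, y, d 3, d 4, d 5}" for v
    using that distinct xy edges edge_sym[OF edges(1)]
    by (intro outside_closed_six_path_nbrs[OF h, where x = "d 1" and y = "d 2"] no) auto
  have "path [d 0, d 1, d 2, d 3, y, x]"
    unfolding path_def using distinct dV xy edges rev_att att by auto
  then have n3: "\<exists>v'. v' \<notin> {d 0, d 1, d 2, d 3, y, x} \<and> {u. E v u} = {d 0, d 3, v'}"
    if "v \<in> V" "v \<notin> {d 0, d 1, d 2, d 3, y, x}" for v
    using that distinct xy edges edge_sym[OF edges(4)] edge_sym[OF edges(5)] att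
    by (intro outside_closed_six_path_nbrs[OF h, where x = "d 5" and y = "d 4"] no) auto
  have "\<exists>v'\<in>V - {d 0, d 3}. {u. E v u} = {d 0, d 3, v'}" if v: "v \<in> V - {d 0, d 3}" for v
  proof -
    have "\<exists>v'. v' \<notin> {d 0, d 3} \<and> {u. E v u} = {d 0, d 3, v'}"
    proof -
      consider "v \<notin> {d 0, d 1, d 2, d 3, d 4, d 5}" | "v = d 1 \<or> v = d 2" | "v = d 4 \<or> v = d 5"
        using v by blast
      then show ?thesis
      proof cases
        case 1
        then show ?thesis using n1[of v] v by blast
      next
        case 2
        then have "v \<notin> {d 0, x, y, d 3, d 4, d 5}" using distinct xy by auto
        then show ?thesis using n2[of v] v by blast
      next
        case 3
        then have "v \<notin> {d 0, d 1, d 2, d 3, y, x}" using distinct xy by auto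
        then show ?thesis using n3[of v] v by blast
      qed
    qed
    then show ?thesis using edge_in_V' by blast
  qed
  then have "joined_matching_at (d 0) (d 3)"
    using distinct dV unfolding joined_matching_at_def by simp
  moreover have "has_two_paths (2 * a) (2 * b + 1)" if not3: "a \<noteq> 3"
  proof -
    \<comment> \<open>as \<open>n \<ge> 9\<close>, there is a ninth vertex \<open>w\<close>, whose partner \<open>w'\<close> is new as well\<close>
    let ?S = "{d 0, d 1, d 2, d 3, d 4, d 5, x, y}"
    have "card ?S \<le> 8" using card_length[of "[d 0, d 1, d 2, d 3, d 4, d 5, x, y]"] by simp
    then have "\<not> V \<subseteq> ?S" using order_ge h card_mono[of ?S V] by auto
    then obtain w where w: "w \<in> V" "w \<notin> ?S" by blast
    obtain w' where w': "w' \<notin> {d 0, d 1, d 2, d 3, d 4, d 5}" "{u. E w u} = {d 0, d 3, w'}"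
      using n1[of w] w by blast
    have ww': "E w w'" "E w (d 0)" using w'(2) by blast+
    have "\<not> E x w" using n1[of x] xy w by blast
    moreover have "\<not> E y w" using n1[of y] xy w by blast
    ultimately have w'S: "w' \<notin> ?S" "w' \<noteq> w" "w' \<in> V"
      using w' ww' edge_sym edge_irrefl edge_in_V' by auto
    have "a = 1 \<and> b = 3 \<or> a = 2 \<and> b = 2" using ab h not3 by auto
    then show ?thesis
    proof
      assume ab: "a = 1 \<and> b = 3"
      have "path [x, y]" using xy by (simp add: path_def)
      moreover have "path [w, d 0, d 1, d 2, d 3, d 4, d 5]"
        using C w ww' by (simp add: path_Cons[of w])
      ultimately show ?thesis using ab xy w
        by (intro has_two_pathsI[of "[x, y]" "[w, d 0, d 1, d 2, d 3, d 4, d 5]"]) auto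
    next
      assume ab: "a = 2 \<and> b = 2"
      have "path [w', w, d 0, d 1]" using w w'S ww' edge_sym[OF ww'(1)] distinct dV edges by (auto simp: path_def)
      moreover have "path [x, y, d 3, d 4, d 5]" using xy att distinct dV edges by (auto simp: path_def)
      ultimately show ?thesis using ab xy w w'S distinct
        by (intro has_two_pathsI[of "[w', w, d 0, d 1]" "[x, y, d 3, d 4, d 5]"]) auto
    qed
  qed
  ultimately show ?thesis using ab h by (cases "a = 3") auto
qed

section \<open>Crossing chords at the ends of a longest path\<close>

lemma degree_as_positions:
  assumes "distinct xs" "\<And>u. E v u \<Longrightarrow> u \<in> set xs"
  shows "card {i. i < length xs \<and> E v (xs ! i)} = card {u. E v u}"
proof -
  have "inj_on ((!) xs) {i. i < length xs \<and> E v (xs ! i)}"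
    using assms(1) by (auto simp: inj_on_def nth_eq_iff_index_eq)
  moreover have "(!) xs ` {i. i < length xs \<and> E v (xs ! i)} = {u. E v u}"
    using assms(2) by (auto simp: in_set_conv_nth image_iff) 
  ultimately show ?thesis by (metis card_image)
qed

text \<open>
  Let \<open>A\<close> be the set of positions just before neighbours of the first vertex and \<open>B\<close> the set of
  positions of neighbours of the last vertex. They are disjoint, since otherwise the vertices of the
  path would span a cycle; so at most \<open>length xs - 1 - 2 * h\<close> positions before the last belong to neither.
  If \<open>i\<close> and \<open>j\<close> are the ends of a crossing pair of chords at minimal distance, then no position strictly
  between \<open>i\<close> and \<open>j - 1\<close> belongs to \<open>A\<close> or \<open>B\<close>, which bounds the distance.
\<close>

lemma longest_path_crossing:
  assumes xs: "path xs" "xs \<noteq> []" "length xs < card V" "\<not> has_path (Suc (length xs))"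
  shows "2 * h + 1 \<le> length xs"
    and "(\<exists>i j. i + 1 < j \<and> j < length xs \<and> j \<le> i + 1 + (length xs - 2 * h)
             \<and> E (last xs) (xs ! i) \<and> E (hd xs) (xs ! j))
      \<or> (\<forall>i j. i < length xs \<longrightarrow> j < length xs \<longrightarrow> E (last xs) (xs ! i) \<longrightarrow> E (hd xs) (xs ! j) \<longrightarrow> j \<le> i)"
proof -
  let ?m = "length xs"
  define A where "A = {i. i < ?m - 1 \<and> E (hd xs) (xs ! Suc i)}"
  define B where "B = {i. i < ?m - 1 \<and> E (last xs) (xs ! i)}"
  have m: "0 < ?m" using xs(2) by simp
  have hd: "hd xs = xs ! 0" and last: "last xs = xs ! (?m - 1)"
    using xs(2) by (simp_all add: hd_conv_nth last_conv_nth)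
  have V: "hd xs \<in> V" "last xs \<in> V" using xs(1,2) by (auto simp: path_def)
  have dist: "distinct xs" using xs(1) by (simp add: path_def)
  have "{i. i < ?m \<and> E (hd xs) (xs ! i)} \<subseteq> Suc ` A"
  proof
    fix i assume i: "i \<in> {i. i < ?m \<and> E (hd xs) (xs ! i)}"
    then have "i \<noteq> 0" using hd edge_irrefl by (auto intro: ccontr)
    then show "i \<in> Suc ` A" using i by (intro image_eqI[of _ _ "i - 1"]) (auto simp: A_def)
  qed
  then have "card {i. i < ?m \<and> E (hd xs) (xs ! i)} \<le> card A"
    by (intro surj_card_le[of A]) (auto simp: A_def)
  then have hA: "h \<le> card A"
    using degree_as_positions[OF dist longest_path_hd_nbrs[OF xs(1,2,4)]] degree_ge[OF V(1)] by simp
  have "{i. i < ?m \<and> E (last xs) (xs ! i)} \<subseteq> B"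
  proof
    fix i assume i: "i \<in> {i. i < ?m \<and> E (last xs) (xs ! i)}"
    then have "i \<noteq> ?m - 1" using last edge_irrefl by (auto intro: ccontr)
    then show "i \<in> B" using i by (auto simp: B_def)
  qed
  then have "card {i. i < ?m \<and> E (last xs) (xs ! i)} \<le> card B"
    by (intro card_mono) (auto simp: B_def)
  then have hB: "h \<le> card B"
    using degree_as_positions[OF dist longest_path_last_nbrs[OF xs(1,2,4)]] degree_ge[OF V(2)] by simp
  have disj: "A \<inter> B = {}"
  proof (rule ccontr)
    assume "A \<inter> B \<noteq> {}"
    then obtain i where "i \<in> A" "i \<in> B" by blast
    then have i: "Suc i < ?m" "E (hd xs) (xs ! Suc i)" "E (last xs) (xs ! i)"
      unfolding A_def B_def by auto
    let ?ys = "take (Suc i) xs @ rev (drop (Suc i) xs)"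
    have "path (take (Suc i) xs @ drop (Suc i) xs)" using xs(1) by simp
    then have "path ?ys"
      using i edge_sym[OF i(3)] unfolding path_append
      by (simp add: path_rev hd_rev take_Suc_conv_app_nth last_drop)
    moreover have "hd ?ys = hd xs" "last ?ys = xs ! Suc i" "?ys \<noteq> []" "length ?ys = ?m"
      using i xs(2) by (auto simp: hd_append last_rev hd_drop_conv_nth)
    ultimately show False
      using no_closed_path[of ?ys] xs(3,4) edge_sym[OF i(2)] by simp
  qed
  have fin: "finite A" "finite B" by (auto simp: A_def B_def)
  have AB: "A \<union> B \<subseteq> {..<?m - 1}" by (auto simp: A_def B_def)
  have cAB: "card (A \<union> B) = card A + card B" using fin disj by (simp add: card_Un_disjoint)
  moreover have "card (A \<union> B) \<le> ?m - 1" using card_mono[OF _ AB] by simp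
  ultimately show long: "2 * h + 1 \<le> ?m" using hA hB h_pos by linarith
  define P where "P g i j \<longleftrightarrow> i < j \<and> j = i + g \<and> j < ?m \<and> E (last xs) (xs ! i) \<and> E (hd xs) (xs ! j)" for g i j
  show "(\<exists>i j. i + 1 < j \<and> j < ?m \<and> j \<le> i + 1 + (?m - 2 * h) \<and> E (last xs) (xs ! i) \<and> E (hd xs) (xs ! j))
      \<or> (\<forall>i j. i < ?m \<longrightarrow> j < ?m \<longrightarrow> E (last xs) (xs ! i) \<longrightarrow> E (hd xs) (xs ! j) \<longrightarrow> j \<le> i)"
  proof (cases "\<exists>g i j. P g i j")
    case False
    have "j \<le> i" if "i < ?m" "j < ?m" "E (last xs) (xs ! i)" "E (hd xs) (xs ! j)" for i j
    proof (rule ccontr)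
      assume "\<not> j \<le> i"
      then have "P (j - i) i j" using that by (simp add: P_def)
      then show False using False by blast
    qed
    then show ?thesis by blast
  next
    case True
    \<comment> \<open>a crossing pair of chords with the smallest distance\<close>
    define g where "g = (LEAST g. \<exists>i j. P g i j)"
    have "\<exists>i j. P g i j" unfolding g_def by (rule LeastI_ex) (use True in blast)
    then obtain i j where ij: "P g i j" by blast
    have least: "g \<le> g'" if "P g' i' j'" for g' i' j'
      unfolding g_def using that by (intro Least_le) blast
    have "Suc i \<noteq> j"
    proof
      assume "Suc i = j"
      then have "i \<in> A \<inter> B" using ij by (auto simp: A_def B_def P_def)
      then show False using disj by blast
    qed
    have "l \<notin> A \<union> B" if "i < l" "Suc l < j" for l
    proof
      assume "l \<in> A \<union> B"
      then consider "E (hd xs) (xs ! Suc l)" | "E (last xs) (xs ! l)" by (auto simp: A_def B_def)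
      then show False
      proof cases
        case 1
        then have "P (Suc l - i) i (Suc l)" using that ij by (auto simp: P_def)
        from least[OF this] show False using that ij unfolding P_def by linarith
      next
        case 2
        then have "P (j - l) l j" using that ij by (auto simp: P_def)
        from least[OF this] show False using that ij unfolding P_def by linarith
      qed
    qed
    then have "A \<union> B \<subseteq> {..<?m - 1} - {i<..<j - 1}" using AB by fastforce
    then have "card (A \<union> B) \<le> card ({..<?m - 1} - {i<..<j - 1})" by (intro card_mono) auto
    also have "\<dots> = ?m - 1 - (j - 1 - Suc i)"
      using ij by (subst card_Diff_subset) (auto simp: P_def)
    finally have "j \<le> i + 1 + (?m - 2 * h)" using cAB hA hB long ij unfolding P_def by linarith
    then show ?thesis using ij \<open>Suc i \<noteq> j\<close> unfolding P_def
      by (intro disjI1 exI[of _ i] exI[of _ j]) auto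
  qed
qed

text \<open>
  The cycle runs from the first vertex to position \<open>i\<close>, jumps to the last vertex and runs back to
  position \<open>j\<close>; it misses the positions strictly between \<open>i\<close> and \<open>j\<close>.
\<close>

lemma cycle_of_crossing:
  assumes "path xs" "i + 1 < j" "j < length xs" "E (last xs) (xs ! i)" "E (hd xs) (xs ! j)"
  shows "\<exists>c. cyc (length xs + i + 1 - j) c \<and> range c = set (take (Suc i) xs) \<union> set (drop j xs)"
proof -
  let ?ys = "take (Suc i) xs @ rev (drop j xs)"
  have "path (take j xs @ drop j xs)" using assms(1) by simp
  then have "set (take j xs) \<inter> set (drop j xs) = {}" unfolding path_append by blast
  moreover have "set (take (Suc i) xs) \<subseteq> set (take j xs)" using assms(2) by (intro set_take_subset_set_take) simp
  ultimately have "set (take (Suc i) xs) \<inter> set (rev (drop j xs)) = {}" unfolding set_rev by blast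
  moreover have "path (take (Suc i) xs)" "path (rev (drop j xs))"
    using path_take path_drop assms(1) path_rev by blast+
  moreover have "last (take (Suc i) xs) = xs ! i" "hd (rev (drop j xs)) = last xs"
    using assms by (simp_all add: take_Suc_conv_app_nth hd_rev last_drop)
  ultimately have "path ?ys"
    unfolding path_append using edge_sym[OF assms(4)] by simp
  moreover have "E (last ?ys) (hd ?ys)"
    using assms edge_sym[OF assms(5)] by (auto simp: hd_append last_rev hd_drop_conv_nth)
  moreover have "?ys \<noteq> []" using assms(3) by auto
  moreover have "length ?ys = length xs + i + 1 - j" using assms(2,3) by simp
  moreover have "set ?ys = set (take (Suc i) xs) \<union> set (drop j xs)" by simp
  ultimately show ?thesis using cyc_of_path[of ?ys] by metis
qed

text \<open>
  The threshold \<open>t\<close> is the first neighbour of the last vertex. Both ends have at least \<open>h\<close> neighbours, on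
  either side of \<open>t\<close>, and this leaves little freedom for \<open>t\<close> when \<open>length xs\<close> is close to \<open>2 h\<close>.
\<close>

lemma no_crossing_threshold:
  assumes xs: "path xs" "xs \<noteq> []" "\<not> has_path (Suc (length xs))"
    and no_crossing: "\<And>i j. i < length xs \<Longrightarrow> j < length xs \<Longrightarrow> E (last xs) (xs ! i) \<Longrightarrow> E (hd xs) (xs ! j) \<Longrightarrow> j \<le> i"
  obtains t where "h \<le> t" "t + h < length xs" "E (last xs) (xs ! t)"
    "{j. j < length xs \<and> E (hd xs) (xs ! j)} \<subseteq> {1..t}"
    "{i. i < length xs \<and> E (last xs) (xs ! i)} \<subseteq> {t..<length xs - 1}"
    "h \<le> card {j. j < length xs \<and> E (hd xs) (xs ! j)}"
    "h \<le> card {i. i < length xs \<and> E (last xs) (xs ! i)}"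
proof -
  let ?m = "length xs"
  let ?A = "{j. j < ?m \<and> E (hd xs) (xs ! j)}" and ?B = "{i. i < ?m \<and> E (last xs) (xs ! i)}"
  have hd: "hd xs = xs ! 0" and last: "last xs = xs ! (?m - 1)"
    using xs(2) by (simp_all add: hd_conv_nth last_conv_nth)
  have V: "hd xs \<in> V" "last xs \<in> V" using xs(1,2) by (auto simp: path_def)
  have dist: "distinct xs" using xs(1) by (simp add: path_def)
  have hA: "h \<le> card ?A"
    using degree_as_positions[OF dist longest_path_hd_nbrs[OF xs]] degree_ge[OF V(1)] by simp
  have hB: "h \<le> card ?B"
    using degree_as_positions[OF dist longest_path_last_nbrs[OF xs]] degree_ge[OF V(2)] by simp
  then have "?B \<noteq> {}" using h_pos by (metis card.empty not_one_le_zero order_trans)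
  define t where "t = Min ?B"
  have "t \<in> ?B" unfolding t_def using \<open>?B \<noteq> {}\<close> by (intro Min_in) auto
  then have t: "t < ?m" "E (last xs) (xs ! t)" by auto
  have min: "t \<le> i" if "i \<in> ?B" for i unfolding t_def using that by (intro Min_le) auto
  have subA: "?A \<subseteq> {1..t}"
  proof
    fix j assume j: "j \<in> ?A"
    then have "j \<noteq> 0" using hd edge_irrefl by (metis mem_Collect_eq)
    then show "j \<in> {1..t}" using no_crossing[OF t(1) _ t(2), of j] j by simp
  qed
  have subB: "?B \<subseteq> {t..<?m - 1}"
  proof
    fix i assume i: "i \<in> ?B"
    then have "i \<noteq> ?m - 1" using last edge_irrefl by (metis mem_Collect_eq)
    moreover have "i < ?m" using i by blast
    ultimately show "i \<in> {t..<?m - 1}" using min[OF i] by simp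
  qed
  have "card ?A \<le> t" using card_mono[OF _ subA] by simp
  moreover have "card ?B \<le> ?m - 1 - t" using card_mono[OF _ subB] by simp
  ultimately have "h \<le> t" "t + h < ?m" using hA hB t(1) h_pos by auto
  then show ?thesis using that[OF _ _ t(2) subA subB hA hB] by blast
qed

text \<open>
  Reversing an initial segment makes any predecessor of a neighbour of the first vertex the first
  vertex of a path with the same vertices and the same end. So what holds for the end of a longest
  path holds for all these predecessors.
\<close>

lemma switch_front:
  assumes "path xs" "Suc i < length xs" "E (hd xs) (xs ! Suc i)"
  shows "path (rev (take (Suc i) xs) @ drop (Suc i) xs)"
    and "hd (rev (take (Suc i) xs) @ drop (Suc i) xs) = xs ! i"
proof -
  have "path (take (Suc i) xs @ drop (Suc i) xs)" using assms(1) by simp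
  then have "path (take (Suc i) xs)" "path (drop (Suc i) xs)"
    "set (take (Suc i) xs) \<inter> set (drop (Suc i) xs) = {}"
    unfolding path_append by blast+
  moreover have "xs \<noteq> []" using assms(2) by auto
  ultimately show "path (rev (take (Suc i) xs) @ drop (Suc i) xs)"
    unfolding path_append using assms(2,3) by (simp add: path_rev last_rev hd_drop_conv_nth)
  show "hd (rev (take (Suc i) xs) @ drop (Suc i) xs) = xs ! i"
    using assms(2) by (simp add: take_Suc_conv_app_nth)
qed

lemma switch_back:
  assumes "path xs" "Suc i < length xs" "E (last xs) (xs ! i)"
  shows "path (take (Suc i) xs @ rev (drop (Suc i) xs))"
    and "last (take (Suc i) xs @ rev (drop (Suc i) xs)) = xs ! Suc i"
proof -
  have "path (take (Suc i) xs @ drop (Suc i) xs)" using assms(1) by simp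
  then have "path (take (Suc i) xs)" "path (drop (Suc i) xs)"
    "set (take (Suc i) xs) \<inter> set (drop (Suc i) xs) = {}"
    unfolding path_append by blast+
  moreover have "last (take (Suc i) xs) = xs ! i" "hd (rev (drop (Suc i) xs)) = last xs"
    using assms(2) by (simp_all add: take_Suc_conv_app_nth hd_rev last_drop)
  ultimately show "path (take (Suc i) xs @ rev (drop (Suc i) xs))"
    unfolding path_append using assms(2,3) edge_sym by (simp add: path_rev)
  show "last (take (Suc i) xs @ rev (drop (Suc i) xs)) = xs ! Suc i"
    using assms(2) by (simp add: last_rev hd_drop_conv_nth)
qed

lemma switch_front_nbrs:
  assumes "path xs" "\<not> has_path (Suc (length xs))" "Suc i < length xs" "E (hd xs) (xs ! Suc i)" "E (xs ! i) u"
  shows "u \<in> set xs"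
proof -
  let ?ys = "rev (take (Suc i) xs) @ drop (Suc i) xs"
  have len: "length ?ys = length xs" using assms(3) by simp
  have set: "set ?ys = set xs" by (metis append_take_drop_id set_append set_rev)
  have ne: "?ys \<noteq> []" using assms(3) by auto
  show ?thesis
    using longest_path_hd_nbrs[OF switch_front(1)[OF assms(1,3,4)] ne, of u] assms(2,5)
    unfolding len set switch_front(2)[OF assms(1,3,4)] by blast
qed

lemma switch_back_nbrs:
  assumes "path xs" "\<not> has_path (Suc (length xs))" "Suc i < length xs" "E (last xs) (xs ! i)" "E (xs ! Suc i) u"
  shows "u \<in> set xs"
proof -
  let ?ys = "take (Suc i) xs @ rev (drop (Suc i) xs)"
  have len: "length ?ys = length xs" using assms(3) by simp
  have set: "set ?ys = set xs" by (metis append_take_drop_id set_append set_rev)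
  have ne: "?ys \<noteq> []" using assms(3) by auto
  show ?thesis
    using longest_path_last_nbrs[OF switch_back(1)[OF assms(1,3,4)] ne, of u] assms(2,5)
    unfolding len set switch_back(2)[OF assms(1,3,4)] by blast
qed

text \<open>
  A path away from \<open>X\<close> that cannot be prolonged. All neighbours of its end lie on it or in \<open>X\<close>, so the
  minimum degree forces it to be long when few vertices of \<open>X\<close> are available.
\<close>

lemma obtain_maximal_avoiding:
  assumes "w \<in> V" "w \<notin> X"
  obtains ws where "path ws" "ws \<noteq> []" "hd ws = w" "set ws \<inter> X = {}"
    "\<And>u. E (last ws) u \<Longrightarrow> u \<in> X \<union> (set ws - {last ws})"
proof -
  let ?P = "\<lambda>ws. path ws \<and> ws \<noteq> [] \<and> hd ws = w \<and> set ws \<inter> X = {}"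
  have "\<forall>ws. ?P ws \<longrightarrow> length ws < Suc (card V)"
    using path_length_le by fastforce
  moreover have "?P [w]" using assms by (simp add: path_singleton)
  ultimately obtain ws where ws: "?P ws" "\<forall>y. ?P y \<longrightarrow> length y \<le> length ws"
    using ex_has_greatest_nat[of ?P "[w]" length "Suc (card V)"] by auto
  have "u \<in> X \<union> (set ws - {last ws})" if "E (last ws) u" for u
  proof (rule ccontr)
    assume u: "u \<notin> X \<union> (set ws - {last ws})"
    moreover have "u \<noteq> last ws" using that edge_irrefl by auto
    ultimately have "?P (ws @ [u])"
      using ws(1) that edge_in_V'[OF that] by (auto simp: path_snoc)
    then show False using ws(2) by fastforce
  qed
  then show ?thesis using that ws(1) by blast
qed

section \<open>Longest paths of order $2h+1$ without crossing chords\<close>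

definition block :: "'a \<Rightarrow> 'a \<Rightarrow> 'a set" where
  "block c v = insert v ({u. E v u} - {c})"

text \<open>
  A graph whose blocks are copies of \<open>K\<^bsub>h+1\<^esub>\<close> that share the vertex \<open>c\<close>: the closed neighbourhoods
  with \<open>c\<close> removed partition the remaining vertices into classes of size \<open>h\<close>.
\<close>

definition windmill_at :: "'a \<Rightarrow> bool" where
  "windmill_at c \<longleftrightarrow> c \<in> V \<and> (\<forall>v\<in>V - {c}. E v c \<and> card (block c v) = h
     \<and> (\<forall>w\<in>block c v. block c w = block c v))"

context
  assumes no_path: "\<not> has_path (2 * h + 2)" and no_cyc: "\<And>d. \<not> cyc (2 * h) d"
begin

lemma tight_path_hd_nbrs:
  assumes xs: "path xs" "length xs = 2 * h + 1"
  shows "{u. E (hd xs) u} = set (take (h + 1) xs) - {hd xs}"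
    and "i < h \<Longrightarrow> E (hd xs) (xs ! Suc i)"
proof -
  have ne: "xs \<noteq> []" and np: "\<not> has_path (Suc (length xs))" and lt: "length xs < card V"
    using xs no_path order_ge by auto
  have dist: "distinct xs" using xs(1) by (simp add: path_def)
  have no_crossing: "j \<le> i" if "i < length xs" "j < length xs" "E (last xs) (xs ! i)" "E (hd xs) (xs ! j)" for i j
  proof -
    have "False" if *: "i + 1 < j" "j < length xs" "j \<le> i + 1 + (length xs - 2 * h)"
      "E (last xs) (xs ! i)" "E (hd xs) (xs ! j)" for i j
    proof -
      have "length xs + i + 1 - j = 2 * h" using * xs(2) by simp
      then show False using cycle_of_crossing[OF xs(1) *(1,2,4,5)] no_cyc by metis
    qed
    then show ?thesis using longest_path_crossing(2)[OF xs(1) ne lt np] that by blast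
  qed
  let ?A = "{j. j < length xs \<and> E (hd xs) (xs ! j)}"
  obtain t where "E (last xs) (xs ! t)"
      "{i. i < length xs \<and> E (last xs) (xs ! i)} \<subseteq> {t..<length xs - 1}"
      "h \<le> card {i. i < length xs \<and> E (last xs) (xs ! i)}"
    and t: "h \<le> t" "t + h < length xs" "?A \<subseteq> {1..t}" "h \<le> card ?A"
    by (rule no_crossing_threshold[OF xs(1) ne np no_crossing])
  then have "t = h" using xs(2) by simp
  then have A: "?A = {1..h}" using t by (intro card_seteq) auto
  show "E (hd xs) (xs ! Suc i)" if "i < h"
  proof -
    have "Suc i \<in> ?A" unfolding A using that by simp
    then show ?thesis by simp
  qed
  have "{u. E (hd xs) u} = (!) xs ` ?A"
    using longest_path_hd_nbrs[OF xs(1) ne np] by (auto simp: in_set_conv_nth image_iff)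
  also have "\<dots> = (!) xs ` ({0..<h + 1} - {0})" unfolding A by (rule arg_cong[where f = "(`) ((!) xs)"]) auto
  also have "\<dots> = (!) xs ` {0..<h + 1} - (!) xs ` {0}"
    using dist xs(2) by (intro inj_on_image_set_diff[of _ "{0..<length xs}"]) (auto simp: inj_on_def nth_eq_iff_index_eq)
  also have "\<dots> = set (take (h + 1) xs) - {hd xs}"
    using xs(2) ne nth_image[of "h + 1" xs] by (simp add: hd_conv_nth)
  finally show "{u. E (hd xs) u} = set (take (h + 1) xs) - {hd xs}" .
qed

text \<open>
  Switching makes each of the first \<open>h\<close> vertices the first vertex of a path of the same order with the
  same set of first \<open>h + 1\<close> vertices. So these vertices form a clique, and only the middle vertex can
  have other neighbours.
\<close>

lemma tight_path_front_nbrs: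
  assumes xs: "path xs" "length xs = 2 * h + 1" and v: "v \<in> set (take h xs)"
  shows "{u. E v u} = set (take (h + 1) xs) - {v}"
proof -
  obtain i where i: "i < h" "v = xs ! i" using v xs(2) by (auto simp: in_set_conv_nth)
  let ?ys = "rev (take (Suc i) xs) @ drop (Suc i) xs"
  have ys: "path ?ys" "hd ?ys = v" "length ?ys = 2 * h + 1"
    using switch_front[OF xs(1) _ tight_path_hd_nbrs(2)[OF xs i(1)]] i xs(2) by simp_all
  have "take (h + 1) xs = take (Suc i + (h - i)) xs" using i by simp
  also have "\<dots> = take (Suc i) xs @ take (h - i) (drop (Suc i) xs)" by (rule take_add)
  finally have "set (take (h + 1) ?ys) = set (take (h + 1) xs)" using i xs(2) by (simp add: Suc_diff_le)
  then show ?thesis using tight_path_hd_nbrs(1)[OF ys(1,3)] ys(2) by simp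
qed

lemma tight_path_back_nbrs:
  assumes xs: "path xs" "length xs = 2 * h + 1" and v: "v \<in> set (drop (h + 1) xs)"
  shows "{u. E v u} = set (drop h xs) - {v}"
proof -
  have "path (rev xs)" "length (rev xs) = 2 * h + 1" using xs by (simp_all add: path_rev)
  moreover have "take h (rev xs) = rev (drop (h + 1) xs)" "take (h + 1) (rev xs) = rev (drop h xs)"
    using xs(2) by (simp_all add: take_rev)
  ultimately show ?thesis using tight_path_front_nbrs[of "rev xs" v] v by simp
qed

text \<open>
  Every neighbour \<open>w\<close> of the middle vertex \<open>c\<close> outside \<open>xs\<close> lies in the first half of some path of order \<open>2 h + 1\<close>
  with middle vertex \<open>c\<close>: a maximal path that starts in \<open>w\<close> and avoids the second half \<open>drop h xs\<close> has an
  end whose neighbours are all on it, except for \<open>c\<close>, so it has order exactly \<open>h\<close> and can replace the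
  first half of \<open>xs\<close>. By connectivity these halves cover all vertices but \<open>c\<close>, and each of them is a
  clique of order \<open>h\<close> joined to \<open>c\<close> only. The path \<open>ys\<close> is such a clique outside \<open>xs\<close>.
\<close>

lemma windmill_of_tight_path:
  assumes xs: "path xs" "length xs = 2 * h + 1"
  shows "\<exists>c. windmill_at c \<and> (\<exists>ys. path ys \<and> length ys = h \<and> set xs \<inter> set ys = {})"
proof -
  define c where "c = xs ! h"
  have split: "take (h + 1) ys = take h ys @ [ys ! h]" "drop h ys = ys ! h # drop (h + 1) ys"
    "set ys = set (take h ys) \<union> {ys ! h} \<union> set (drop (h + 1) ys)" if "length ys = 2 * h + 1" for ys :: "'a list"
  proof -
    show *: "take (h + 1) ys = take h ys @ [ys ! h]" "drop h ys = ys ! h # drop (h + 1) ys"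
      using that by (simp_all add: take_Suc_conv_app_nth Cons_nth_drop_Suc)
    have "set ys = set (take (h + 1) ys @ drop (h + 1) ys)" by simp
    then show "set ys = set (take h ys) \<union> {ys ! h} \<union> set (drop (h + 1) ys)" unfolding * by auto
  qed
  \<comment> \<open>the vertices in the first half of some path of order \<open>2 h + 1\<close> with the middle vertex \<open>c\<close>\<close>
  define U where "U = {v \<in> V. v = c \<or> (\<exists>ys. path ys \<and> length ys = 2 * h + 1 \<and> ys ! h = c \<and> v \<in> set (take h ys))}"
  have rev_xs: "path (rev xs)" "length (rev xs) = 2 * h + 1" "rev xs ! h = c"
    "set (take h (rev xs)) = set (drop (h + 1) xs)"
    using xs by (simp_all add: path_rev rev_nth c_def take_rev)
  have "c \<in> set xs" using xs(2) by (simp add: c_def)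
  then have cV: "c \<in> V" using xs(1) unfolding path_def by blast
  have xsU: "set xs \<subseteq> U"
  proof
    fix v assume v: "v \<in> set xs"
    then have "v \<in> V" using xs(1) by (auto simp: path_def)
    moreover have "v \<in> set (take h xs) \<or> v = c \<or> v \<in> set (take h (rev xs))"
      using v split(3)[OF xs(2)] rev_xs(4) c_def by auto
    ultimately show "v \<in> U"
      using xs rev_xs(1-3) c_def[symmetric] unfolding U_def mem_Collect_eq by metis
  qed
  have "w \<in> U" if uw: "u \<in> U" "E u w" for u w
  proof (cases "u = c")
    case False
    then obtain ys where ys: "path ys" "length ys = 2 * h + 1" "ys ! h = c" "u \<in> set (take h ys)"
      using uw(1) by (auto simp: U_def)
    then have "w \<in> set (take (h + 1) ys)" using tight_path_front_nbrs[OF ys(1,2,4)] uw(2) by blast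
    then have "w \<in> set (take h ys) \<or> w = c" using split(1)[OF ys(2)] ys(3) by auto
    then show ?thesis unfolding U_def using ys edge_in_V'[OF uw(2)] by blast
  next
    case True
    show ?thesis
    proof (rule ccontr)
      assume "w \<notin> U"
      then have "w \<notin> set (drop h xs)" using xsU set_drop_subset by fastforce
      then obtain ws where ws: "path ws" "ws \<noteq> []" "hd ws = w" "set ws \<inter> set (drop h xs) = {}"
        and maximal: "\<And>u. E (last ws) u \<Longrightarrow> u \<in> set (drop h xs) \<union> (set ws - {last ws})"
        using obtain_maximal_avoiding[OF edge_in_V'[OF uw(2)]] by blast
      have drop: "path (drop h xs)" "hd (drop h xs) = c"
        using xs by (simp_all add: path_drop hd_drop_conv_nth c_def)
      have long: "path (rev ws @ drop h xs)"
        unfolding path_append using ws drop uw True edge_sym[OF uw(2)] by (simp add: path_rev last_rev)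
      then have short: "length ws \<le> h"
        using no_path has_pathI[OF long, of "2 * h + 2"] xs(2) by (cases "length ws \<le> h") auto
      have "{u. E (last ws) u} \<subseteq> {c} \<union> (set ws - {last ws})"
      proof
        fix z assume "z \<in> {u. E (last ws) u}"
        then have z: "E (last ws) z" by simp
        have "z \<notin> set (drop (h + 1) xs)"
        proof
          assume "z \<in> set (drop (h + 1) xs)"
          from tight_path_back_nbrs[OF xs this] edge_sym[OF z] have "last ws \<in> set (drop h xs)" by blast
          then show False using ws(2,4) last_in_set by blast
        qed
        then show "z \<in> {c} \<union> (set ws - {last ws})"
          using maximal[OF z] split(2)[OF xs(2)] by (auto simp: c_def)
      qed
      then have "card {u. E (last ws) u} \<le> card ({c} \<union> (set ws - {last ws}))" by (intro card_mono) auto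
      also have "\<dots> \<le> card {c} + card (set ws - {last ws})" by (rule card_Un_le)
      also have "\<dots> = card (set ws)" using ws(2) card_Suc_Diff1[of "set ws" "last ws"] by simp
      also have "\<dots> \<le> length ws" by (rule card_length)
      finally have "length ws = h"
        using short degree_ge[of "last ws"] ws(1,2) unfolding path_def by (meson last_in_set le_antisym order_trans subsetD)
      then have "(rev ws @ drop h xs) ! h = c" "w \<in> set (take h (rev ws @ drop h xs))"
        "length (rev ws @ drop h xs) = 2 * h + 1"
        using ws(2,3) xs(2) hd_in_set[OF ws(2)] by (auto simp: nth_append c_def)
      then have "w \<in> U" unfolding U_def using long edge_in_V'[OF uw(2)] by blast
      then show False using \<open>w \<notin> U\<close> by simp
    qed
  qed
  moreover have "U \<subseteq> V" "U \<noteq> {}" using cV by (auto simp: U_def)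
  ultimately have "U = V" using closed_eq_V[of U] by blast
  then have cover: "\<exists>ys. path ys \<and> length ys = 2 * h + 1 \<and> ys ! h = c \<and> v \<in> set (take h ys)" if "v \<in> V" "v \<noteq> c" for v
    using that by (auto simp: U_def)
  have block_eq: "E v c" "block c v = set (take h ys)" "c \<notin> set (take h ys)"
    if ys: "path ys" "length ys = 2 * h + 1" "ys ! h = c" "v \<in> set (take h ys)" for v ys
  proof -
    have "distinct (take (h + 1) ys)" using ys(1) by (simp add: path_def)
    then show c: "c \<notin> set (take h ys)" using split(1)[OF ys(2)] ys(3) by simp
    have "{u. E v u} = insert c (set (take h ys)) - {v}"
      using tight_path_front_nbrs[OF ys(1,2,4)] split(1)[OF ys(2)] ys(3) by simp
    moreover have "v \<noteq> c" using c ys(4) by blast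
    ultimately show "E v c" "block c v = set (take h ys)" unfolding block_def using ys(4) c by auto
  qed
  have "windmill_at c"
    unfolding windmill_at_def
  proof (intro conjI ballI)
    fix v assume "v \<in> V - {c}"
    then obtain ys where ys: "path ys" "length ys = 2 * h + 1" "ys ! h = c" "v \<in> set (take h ys)"
      using cover by blast
    show "E v c" using block_eq(1)[OF ys] .
    have "distinct (take h ys)" using ys(1) by (simp add: path_def)
    then show "card (block c v) = h" using block_eq(2)[OF ys] distinct_card[of "take h ys"] ys(2) by simp
    fix w assume "w \<in> block c v"
    then show "block c w = block c v" using block_eq(2)[OF ys] block_eq(2)[OF ys(1-3)] by simp
  qed (rule cV)
  moreover have "\<exists>ys. path ys \<and> length ys = h \<and> set xs \<inter> set ys = {}"
  proof -
    have "card (set xs) < card V" using card_length[of xs] xs(2) order_ge by linarith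
    then have "\<not> V \<subseteq> set xs" using card_mono[of "set xs" V] by auto
    then obtain w where w: "w \<in> V" "w \<notin> set xs" by blast
    have "c \<in> set xs" using xs(2) by (simp add: c_def)
    then obtain ys where ys: "path ys" "length ys = 2 * h + 1" "ys ! h = c" "w \<in> set (take h ys)"
      using cover w by blast
    have "z \<notin> set (take h ys)" if z: "z \<in> set xs" for z
    proof
      assume zy: "z \<in> set (take h ys)"
      have eq: "block c z = set (take h ys)" "z \<noteq> c" using block_eq[OF ys(1-3) zy] zy by blast+
      then have "z \<in> set (take h xs) \<or> z \<in> set (take h (rev xs))"
        using z split(3)[OF xs(2)] rev_xs(4) c_def by auto
      then have "block c z = set (take h xs) \<or> block c z = set (take h (rev xs))"
        using block_eq(2)[OF xs] block_eq(2)[OF rev_xs(1-3)] c_def by blast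
      then have "w \<in> set (take h xs) \<or> w \<in> set (take h (rev xs))" using eq(1) ys(4) by auto
      then show False using w(2) by (metis in_set_takeD set_rev)
    qed
    moreover have "path (take h ys)" "length (take h ys) = h" using ys by (simp_all add: path_take)
    ultimately show ?thesis by blast
  qed
  ultimately show ?thesis by blast
qed

end

section \<open>Longest paths of order $2h+2$ without crossing chords\<close>

text \<open>
  The part of the path up to its middle vertex \<open>xs ! h\<close> and the branch \<open>ws\<close> form a path of order
  at least \<open>2 h + 1\<close>, and \<open>h + 1\<close> vertices of the path remain. The shorter of the two required
  paths has at most \<open>h + 1\<close> vertices.
\<close>

lemma two_paths_of_third_branch:
  assumes xs: "path xs" "length xs = 2 * h + 2"
    and ws: "path ws" "h \<le> length ws" "set ws \<inter> set xs = {}" "E (hd ws) (xs ! h)"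
    and ab: "1 \<le> a" "1 \<le> b" "a + b = h + 1"
  shows "has_two_paths (2 * a) (2 * b + 1)"
proof -
  have split: "path (take (h + 1) xs)" "path (drop (h + 1) xs)" "set (take (h + 1) xs) \<inter> set (drop (h + 1) xs) = {}"
    using xs(1) path_append[of "take (h + 1) xs" "drop (h + 1) xs"] by simp_all
  have sub: "set (take (h + 1) xs) \<subseteq> set xs" "set (drop (h + 1) xs) \<subseteq> set xs"
    by (rule set_take_subset, rule set_drop_subset)
  have "last (take (h + 1) xs) = xs ! h" using xs(2) by (simp add: take_Suc_conv_app_nth)
  then have long: "path (take (h + 1) xs @ ws)"
    unfolding path_append using split ws sub edge_sym[OF ws(4)] by auto
  have disj: "set (take (h + 1) xs @ ws) \<inter> set (drop (h + 1) xs) = {}"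
    using split(3) sub(2) ws(3) by auto
  have len: "2 * h + 1 \<le> length (take (h + 1) xs @ ws)" "h + 1 = length (drop (h + 1) xs)"
    using xs(2) ws(2) by simp_all
  show ?thesis
  proof (cases "2 * a \<le> h + 1")
    case True
    have "has_two_paths (2 * b + 1) (2 * a)"
      by (rule has_two_pathsI[OF long split(2) disj]) (use True len ab in linarith)+
    then show ?thesis by (rule has_two_paths_sym)
  next
    case False
    show ?thesis
      by (rule has_two_pathsI[OF long split(2) disj]) (use False len ab in linarith)+
  qed
qed

lemma card_nbrs_le:
  assumes "v \<in> V" "\<And>u. E v u \<Longrightarrow> u \<in> X \<union> (set ws - {v})" "v \<in> set ws" "finite X"
  shows "h \<le> card X + (length ws - 1)"
proof -
  have "{u. E v u} \<subseteq> X \<union> (set ws - {v})" using assms(2) by blast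
  then have "card {u. E v u} \<le> card (X \<union> (set ws - {v}))" using assms(4) by (intro card_mono) auto
  also have "\<dots> \<le> card X + card (set ws - {v})" by (rule card_Un_le)
  also have "card (set ws - {v}) = card (set ws) - 1" using assms(3) by simp
  also have "\<dots> \<le> length ws - 1" using card_length[of ws] by linarith
  finally show ?thesis using degree_ge[OF assms(1)] by simp
qed

context
  fixes xs a b
  assumes xs: "path xs" "length xs = 2 * h + 2" and no_path: "\<not> has_path (2 * h + 3)"
    and ab: "1 \<le> a" "1 \<le> b" "a + b = h + 1"
begin

lemma no_longer: "\<not> has_path (Suc (length xs))"
  using no_path xs(2) by (simp add: numeral_3_eq_3)

lemma nonempty: "xs \<noteq> []"
  using xs(2) by auto

text \<open>
  The path falls into halves of order \<open>h + 1\<close> that are linked by the edge in the middle. A maximal path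
  \<open>ws\<close> outside, from \<open>w\<close>, ends in a vertex whose only possible neighbour on \<open>xs\<close> is \<open>xs ! h\<close>: a
  neighbour in the interior of a half would give a longer path by switching, and a neighbour
  \<open>xs ! (h + 1)\<close> would allow inserting \<open>ws\<close> into the path. So \<open>ws\<close> has order at least \<open>h\<close>.
\<close>

lemma two_paths_of_separated_ends:
  assumes front: "\<And>i. i < h \<Longrightarrow> E (hd xs) (xs ! Suc i)"
    and rear: "\<And>i. h + 1 \<le> i \<Longrightarrow> i \<le> 2 * h \<Longrightarrow> E (last xs) (xs ! i)"
    and w: "w \<in> V" "w \<notin> set xs" "E w (xs ! h)"
  shows "has_two_paths (2 * a) (2 * b + 1)"
proof -
  obtain ws where ws: "path ws" "ws \<noteq> []" "hd ws = w" "set ws \<inter> set xs = {}"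
    and maximal: "\<And>u. E (last ws) u \<Longrightarrow> u \<in> set xs \<union> (set ws - {last ws})"
    using obtain_maximal_avoiding[OF w(1,2)] by blast
  let ?e = "last ws"
  have "?e \<in> set ws" using ws(2) by simp
  then have e: "?e \<in> set ws" "?e \<in> V" "?e \<notin> set xs" using ws(1,4) by (auto simp: path_def)
  have "u \<in> {xs ! h} \<union> (set ws - {?e})" if u: "E ?e u" for u
  proof (cases "u \<in> set xs")
    case True
    then obtain i where i: "i < 2 * h + 2" "u = xs ! i" using xs(2) by (auto simp: in_set_conv_nth)
    have ue: "E (xs ! i) ?e" using u i edge_sym by blast
    have "\<not> i < h" using switch_front_nbrs[OF xs(1) no_longer _ front ue] e(3) xs(2) by auto
    moreover have "i \<noteq> 2 * h + 1"
      using longest_path_last_nbrs[OF xs(1) nonempty no_longer, of ?e] ue e(3) xs(2) by (auto simp: last_conv_nth[OF nonempty])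
    moreover have "\<not> (h + 2 \<le> i \<and> i \<le> 2 * h + 1)"
    proof
      assume i': "h + 2 \<le> i \<and> i \<le> 2 * h + 1"
      then have "Suc (i - 1) = i" "E (last xs) (xs ! (i - 1))" by (auto intro: rear)
      then show False using switch_back_nbrs[OF xs(1) no_longer, of "i - 1" ?e] ue e(3) i xs(2) by simp
    qed
    moreover have "i \<noteq> h + 1"
    proof
      assume i': "i = h + 1"
      have split: "path (take (h + 1) xs)" "path (drop (h + 1) xs)" "set (take (h + 1) xs) \<inter> set (drop (h + 1) xs) = {}"
        using xs(1) path_append[of "take (h + 1) xs" "drop (h + 1) xs"] by simp_all
      have sub: "set (take (h + 1) xs) \<subseteq> set xs" "set (drop (h + 1) xs) \<subseteq> set xs"
        by (rule set_take_subset, rule set_drop_subset)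
      have ends: "last (take (h + 1) xs) = xs ! h" "hd (drop (h + 1) xs) = xs ! (h + 1)"
        using xs(2) by (simp_all add: take_Suc_conv_app_nth hd_drop_conv_nth)
      have "path (ws @ drop (h + 1) xs)"
        unfolding path_append using ws split sub u i i' ends by auto
      moreover have "set (take (h + 1) xs) \<inter> set (ws @ drop (h + 1) xs) = {}"
        using ws(4) split(3) sub by auto
      moreover have "E (last (take (h + 1) xs)) (hd (ws @ drop (h + 1) xs))"
        using ends ws(2,3) edge_sym[OF w(3)] by simp
      ultimately have "path (take (h + 1) xs @ ws @ drop (h + 1) xs)"
        unfolding path_append[of "take (h + 1) xs"] using split(1) by blast
      moreover have "2 * h + 3 \<le> length (take (h + 1) xs @ ws @ drop (h + 1) xs)"
        using xs(2) ws(2) by (cases ws) simp_all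
      ultimately show False using no_path has_pathI by blast
    qed
    ultimately have "i = h" using i(1) by linarith
    then show ?thesis using i(2) by simp
  next
    case False
    then show ?thesis using maximal[OF u] by blast
  qed
  from card_nbrs_le[OF e(2) this e(1)] have "h \<le> length ws" using ws(2) by (cases ws) simp_all
  then show ?thesis using two_paths_of_third_branch[OF xs ws(1) _ ws(4) _ ab] ws(3) w(3) by simp
qed

text \<open>
  Both ends are adjacent to the middle vertex \<open>xs ! h\<close>, and the last vertex is adjacent to
  all but at most one of the positions from \<open>h\<close> to \<open>2 * h\<close>. Switching at either end shows that an outside vertex can only be
  adjacent to \<open>xs ! h\<close> and to one further vertex \<open>xs ! t\<close>, where \<open>xs ! (t - 1)\<close> is the exceptional
  non-neighbour of the last vertex. If some outside vertex is adjacent to \<open>xs ! h\<close>, the maximal outside path from there is a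
  third branch, or it is one vertex short and ends next to \<open>xs ! t\<close>; then a long detour exists
  unless \<open>h = 2\<close>. If none is, all outside vertices attach at \<open>xs ! t\<close> alone; as only one vertex can be
  appended there, it would have degree one, although \<open>h \<ge> 2\<close>.
\<close>

lemma two_paths_of_shared_centre:
  assumes front: "\<And>i. i < h \<Longrightarrow> E (hd xs) (xs ! Suc i)"
    and back_h: "E (last xs) (xs ! h)"
    and one_gap: "\<And>i j. h \<le> i \<Longrightarrow> i \<le> 2 * h \<Longrightarrow> h \<le> j \<Longrightarrow> j \<le> 2 * h
        \<Longrightarrow> \<not> E (last xs) (xs ! i) \<Longrightarrow> \<not> E (last xs) (xs ! j) \<Longrightarrow> i = j"
  shows "has_two_paths (2 * a) (2 * b + 1)"
proof -
  have dist: "distinct xs" using xs(1) by (simp add: path_def)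
  have attach: "i = h \<or> h + 2 \<le> i \<and> i \<le> 2 * h \<and> \<not> E (last xs) (xs ! (i - 1))"
    if u: "u \<notin> set xs" "E u (xs ! i)" "i < 2 * h + 2" for u i
  proof -
    have iu: "E (xs ! i) u" using u(2) by (rule edge_sym)
    have "\<not> i < h" using switch_front_nbrs[OF xs(1) no_longer _ front iu] u(1) xs(2) by auto
    moreover have "i \<noteq> 2 * h + 1"
      using longest_path_last_nbrs[OF xs(1) nonempty no_longer, of u] iu u(1) xs(2) by (auto simp: last_conv_nth[OF nonempty])
    moreover have "\<not> E (last xs) (xs ! (i - 1))" if "h < i"
      using switch_back_nbrs[OF xs(1) no_longer, of "i - 1" u] iu u that xs(2) by auto
    moreover have "i \<noteq> h + 1"
    proof
      assume "i = h + 1"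
      then show False using \<open>h < i \<Longrightarrow> \<not> E (last xs) (xs ! (i - 1))\<close> back_h by simp
    qed
    ultimately show ?thesis using u(3) by linarith
  qed
  have attach_set: "z = xs ! h \<or> z = xs ! t"
    if u: "u \<notin> set xs" "E u (xs ! t)" "t < 2 * h + 2" "t \<noteq> h" and v: "v \<notin> set xs" "E v z" "z \<in> set xs" for u v z t
  proof -
    obtain i where i: "i < 2 * h + 2" "z = xs ! i" using v(3) xs(2) by (auto simp: in_set_conv_nth)
    have t: "h + 2 \<le> t" "t \<le> 2 * h" "\<not> E (last xs) (xs ! (t - 1))" using attach[OF u(1-3)] u(4) by auto
    from attach[OF v(1) _ i(1)] v(2) i(2)
    consider "i = h" | "h + 2 \<le> i" "i \<le> 2 * h" "\<not> E (last xs) (xs ! (i - 1))" by blast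
    then show ?thesis
    proof cases
      case 2
      have "i - 1 = t - 1" by (rule one_gap) (use 2 t in auto)
      then have "i = t" using 2(1) t(1) by linarith
      then show ?thesis using i(2) by simp
    qed (use i in simp)
  qed
  have near_gap: "E (last xs) (xs ! (t - 2))"
    if u: "u \<notin> set xs" "E u (xs ! t)" "t < 2 * h + 2" "t \<noteq> h" for u t
  proof (rule ccontr)
    assume n: "\<not> E (last xs) (xs ! (t - 2))"
    have t: "h + 2 \<le> t" "t \<le> 2 * h" "\<not> E (last xs) (xs ! (t - 1))" using attach[OF u(1-3)] u(4) by auto
    have "t - 2 = t - 1" by (rule one_gap) (use n t in auto)
    then show False using t(1) h_pos by linarith
  qed
  show ?thesis
  proof (cases "\<exists>w. w \<in> V \<and> w \<notin> set xs \<and> E w (xs ! h)")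
    case True
    then obtain w where w: "w \<in> V" "w \<notin> set xs" "E w (xs ! h)" by blast
    obtain ws where ws: "path ws" "ws \<noteq> []" "hd ws = w" "set ws \<inter> set xs = {}"
      and maximal: "\<And>u. E (last ws) u \<Longrightarrow> u \<in> set xs \<union> (set ws - {last ws})"
      using obtain_maximal_avoiding[OF w(1,2)] by blast
    let ?e = "last ws"
    have "?e \<in> set ws" using ws(2) by simp
  then have e: "?e \<in> set ws" "?e \<in> V" "?e \<notin> set xs" using ws(1,4) by (auto simp: path_def)
    show ?thesis
    proof (cases "h \<le> length ws")
      case True
      then show ?thesis using two_paths_of_third_branch[OF xs ws(1) _ ws(4) _ ab] ws(3) w(3) by simp
    next
      case short: False
      have "\<exists>t. t < 2 * h + 2 \<and> t \<noteq> h \<and> E ?e (xs ! t)"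
      proof (rule ccontr)
        assume none: "\<not> ?thesis"
        have "u \<in> {xs ! h} \<union> (set ws - {?e})" if u: "E ?e u" for u
          using maximal[OF u] none u xs(2) by (auto simp: in_set_conv_nth)
        from card_nbrs_le[OF e(2) this e(1)] show False using short ws(2) by (cases ws) simp_all
      qed
      then obtain t where t0: "t < 2 * h + 2" "t \<noteq> h" "E ?e (xs ! t)" by blast
      then have t: "h + 2 \<le> t" "t \<le> 2 * h" using attach[OF e(3) t0(3,1)] by auto
      have "u \<in> {xs ! h, xs ! t} \<union> (set ws - {?e})" if u: "E ?e u" for u
        using maximal[OF u] attach_set[OF e(3) t0(3,1,2) e(3) u] by blast
      from card_nbrs_le[OF e(2) this e(1)] have "h \<le> card {xs ! h, xs ! t} + (length ws - 1)" by simp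
      moreover have "card {xs ! h, xs ! t} \<le> 2" by (simp add: card_insert_if)
      ultimately have r: "length ws = h - 1" using short ws(2) by (cases ws) simp_all
      \<comment> \<open>the detour through \<open>?L\<close>, \<open>ws\<close>, \<open>?R\<close> and back through \<open>?M\<close> misses only \<open>xs ! (t - 1)\<close>\<close>
      let ?L = "take (h + 1) xs" and ?M = "drop (h + 1) (take (t - 1) xs)" and ?R = "drop t xs"
      have LMR: "?L @ ?M @ [xs ! (t - 1)] @ ?R = xs"
      proof -
        have "?L @ ?M = take (t - 1) xs"
        proof -
          have "min (h + 1) (t - 1) = h + 1" using t by linarith
          then have "take (h + 1) (take (t - 1) xs) = ?L" by (simp only: take_take)
          then show ?thesis using append_take_drop_id[of "h + 1" "take (t - 1) xs"] by simp
        qed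
        moreover have "[xs ! (t - 1)] @ ?R = drop (t - 1) xs"
          using t xs(2) Cons_nth_drop_Suc[of "t - 1" xs] by simp
        ultimately have "(?L @ ?M) @ ([xs ! (t - 1)] @ ?R) = xs" by (simp only: append_take_drop_id)
        then show ?thesis by (simp only: append_assoc)
      qed
      then have "path (?L @ ?M @ [xs ! (t - 1)] @ ?R)" using xs(1) by simp
      then have pL: "path ?L" and pM: "path ?M" and pR: "path ?R"
        and disj: "set ?L \<inter> set ?M = {}" "set ?L \<inter> set ?R = {}" "set ?M \<inter> set ?R = {}"
        unfolding path_append by auto
      have sub: "set ?L \<subseteq> set xs" "set ?M \<subseteq> set xs" "set ?R \<subseteq> set xs"
        using arg_cong[OF LMR, of set] unfolding set_append by blast+
      have ends: "last ?L = xs ! h" "hd ?R = xs ! t" "last ?R = last xs" "?L \<noteq> []" "?R \<noteq> []"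
        using xs(2) t by (auto simp: take_Suc_conv_app_nth hd_drop_conv_nth)
      have lastM: "last ?M = xs ! (t - 2)" if "?M \<noteq> []"
      proof -
        have "h + 1 < length (take (t - 1) xs)" using that unfolding drop_eq_Nil by linarith
        then have "last ?M = last (take (t - 1) xs)" by (rule last_drop)
        moreover have "t - 1 = Suc (t - 2)" "t - 2 < length xs" using t xs(2) by linarith+
        ultimately show ?thesis by (simp only: take_Suc_conv_app_nth last_snoc)
      qed
      have "path (?R @ rev ?M)"
        unfolding path_append using pR pM disj ends lastM near_gap[OF e(3) t0(3,1,2)]
        by (auto simp: path_rev hd_rev)
      then have "path (ws @ ?R @ rev ?M)"
        unfolding path_append[of ws] using ws(1,4) sub ends t0(3) by auto
      moreover have "set ?L \<inter> set (ws @ ?R @ rev ?M) = {}" using disj ws(4) sub(1) by auto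
      moreover have "E (last ?L) (hd (ws @ ?R @ rev ?M))" using ends(1) ws(2,3) edge_sym[OF w(3)] by simp
      ultimately have "path (?L @ ws @ ?R @ rev ?M)" unfolding path_append[of ?L] using pL by blast
      moreover have "length (?L @ ws @ ?R @ rev ?M) = 2 * h + 1 + length ws" using xs(2) t by simp
      ultimately have "length ws \<le> 1" using no_path has_pathI[of "?L @ ws @ ?R @ rev ?M" "2 * h + 3"] by linarith
      then have lw: "length ws = 1" "h = 2" using r ws(2) by (cases ws; simp)+
      then have "ws = [w]" using ws(2,3) by (cases ws) auto
      have t4: "t = 4" using t lw(2) by simp
      obtain x0 x1 x2 x3 x4 x5 where xs_eq: "xs = [x0, x1, x2, x3, x4, x5]"
        using xs(2) lw(2) by (auto simp: eval_nat_numeral length_Suc_conv)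
      have w': "w \<notin> set xs" "E w x2" "E w x4" "E x2 w"
        using w t0(3) t4 lw(2) xs_eq \<open>ws = [w]\<close> edge_sym[OF w(3)] by simp_all
      have edges: "E x0 x1" "E x1 x2" "E x2 x3" "E x3 x4" "E x4 x5" and V: "set xs \<subseteq> V"
        using xs(1) xs_eq by (auto simp: path_def)
      have "a = 1 \<and> b = 2 \<or> a = 2 \<and> b = 1" using ab lw(2) by auto
      then show ?thesis
      proof
        assume "a = 1 \<and> b = 2"
        moreover have "path [x0, x1]" "path [x3, x2, w, x4, x5]"
          using edges w' V dist w(1) edge_sym[OF edges(3)] unfolding xs_eq path_def by auto
        ultimately show ?thesis
          using dist w' unfolding xs_eq by (intro has_two_pathsI[of "[x0, x1]" "[x3, x2, w, x4, x5]"]) auto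
      next
        assume "a = 2 \<and> b = 1"
        moreover have "path [x0, x1, x2, w]" "path [x3, x4, x5]"
          using edges w' V dist w(1) unfolding xs_eq path_def by auto
        ultimately show ?thesis
          using dist w' unfolding xs_eq by (intro has_two_pathsI[of "[x0, x1, x2, w]" "[x3, x4, x5]"]) auto
      qed
    qed
  next
    case none: False
    have "card (set xs) < card V" using card_length[of xs] xs(2) order_ge by linarith
    then have "set xs \<noteq> V" by auto
    moreover have "set xs \<subseteq> V" "set xs \<noteq> {}" using xs by (auto simp: path_def)
    ultimately obtain u w where uw: "u \<in> set xs" "w \<in> V - set xs" "E u w" using exists_edge_out by metis
    then obtain t where t0: "t < 2 * h + 2" "E w (xs ! t)"
      using edge_sym xs(2) by (metis in_set_conv_nth)
    have w: "w \<in> V" "w \<notin> set xs" using uw(2) by auto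
    have "t \<noteq> h" using none w t0(2) by blast
    then have t: "h + 2 \<le> t" "t \<le> 2 * h" using attach[OF w(2) t0(2,1)] by auto
    have "\<exists>z. E w z \<and> z \<noteq> xs ! t"
    proof (rule ccontr)
      assume "\<not> ?thesis"
      then have "{z. E w z} \<subseteq> {xs ! t}" by blast
      then have "card {z. E w z} \<le> card {xs ! t}" by (intro card_mono) auto
      then show False using degree_ge[OF w(1)] t by simp
    qed
    then obtain z where z: "E w z" "z \<noteq> xs ! t" by blast
    have "z \<notin> set xs"
      using attach_set[OF w(2) t0(2,1) \<open>t \<noteq> h\<close> w(2) z(1)] none w z by blast
    \<comment> \<open>leaving out \<open>xs ! (t - 1)\<close> frees \<open>xs ! t\<close> as an end, to which both \<open>w\<close> and \<open>z\<close> can be appended\<close>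
    let ?L = "take (t - 1) xs" and ?R = "drop t xs"
    have "take t xs = ?L @ [xs ! (t - 1)]" using t xs(2) take_Suc_conv_app_nth[of "t - 1" xs] by simp
    then have "path (?L @ [xs ! (t - 1)] @ ?R)" using xs(1) by (metis append.assoc append_take_drop_id)
    then have LR: "path ?L" "path ?R" "set ?L \<inter> set ?R = {}" unfolding path_append by auto
    have sub: "set ?L \<subseteq> set xs" "set ?R \<subseteq> set xs" by (rule set_take_subset, rule set_drop_subset)
    have t': "t - 1 = Suc (t - 2)" "t - 2 < length xs" "t < length xs" using t xs(2) by linarith+
    have "last ?L = xs ! (t - 2)" using t'(1,2) by (simp only: take_Suc_conv_app_nth last_snoc)
    moreover have "hd ?R = xs ! t" "last ?R = last xs" "?R \<noteq> []"
      using t'(3) by (simp_all add: hd_drop_conv_nth last_drop)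
    moreover have "?L \<noteq> []" using t'(1) nonempty by auto
    ultimately have ends: "last ?L = xs ! (t - 2)" "hd ?R = xs ! t" "last ?R = last xs" "?L \<noteq> []" "?R \<noteq> []"
      by blast+
    have "path [w, z]" using w z edge_in_V' edge_irrefl by (auto simp: path_def)
    then have "path (rev ?R @ [w, z])"
      unfolding path_append using LR sub ends w z \<open>z \<notin> set xs\<close> edge_sym[OF t0(2)]
      by (auto simp: path_rev last_rev)
    moreover have "set ?L \<inter> set (rev ?R @ [w, z]) = {}" using LR(3) sub w \<open>z \<notin> set xs\<close> by auto
    moreover have "E (last ?L) (hd (rev ?R @ [w, z]))"
      using ends near_gap[OF w(2) t0(2,1) \<open>t \<noteq> h\<close>] edge_sym by (simp add: hd_append hd_rev)
    ultimately have "path (?L @ rev ?R @ [w, z])" unfolding path_append[of ?L] using LR(1) by blast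
    moreover have "length (?L @ rev ?R @ [w, z]) = 2 * h + 3" using xs(2) t by simp
    ultimately show ?thesis using no_path has_path_def by blast
  qed
qed

end

text \<open>
  The threshold between the neighbours of the two ends is \<open>h\<close> or \<open>h + 1\<close>. If one of the ends is adjacent
  to position \<open>h\<close>, counted from the opposite end, then up to reversal both ends share a centre;
  otherwise their neighbourhoods are separated, and an outside vertex attaches at one of the two middle
  vertices.
\<close>

lemma two_paths_of_no_crossing:
  assumes xs: "path xs" "length xs = 2 * h + 2" and no_path: "\<not> has_path (2 * h + 3)"
    and ab: "1 \<le> a" "1 \<le> b" "a + b = h + 1"
    and no_crossing: "\<And>i j. i < length xs \<Longrightarrow> j < length xs \<Longrightarrow> E (last xs) (xs ! i) \<Longrightarrow> E (hd xs) (xs ! j) \<Longrightarrow> j \<le> i"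
  shows "has_two_paths (2 * a) (2 * b + 1)"
proof -
  have np: "\<not> has_path (Suc (length xs))" and ne: "xs \<noteq> []"
    using no_path xs(2) by (auto simp: numeral_3_eq_3)
  let ?A = "{j. j < length xs \<and> E (hd xs) (xs ! j)}" and ?B = "{i. i < length xs \<and> E (last xs) (xs ! i)}"
  obtain t where t: "h \<le> t" "t + h < length xs" "E (last xs) (xs ! t)"
    "?A \<subseteq> {1..t}" "?B \<subseteq> {t..<length xs - 1}" "h \<le> card ?A" "h \<le> card ?B"
    by (rule no_crossing_threshold[OF xs(1) ne np no_crossing])
  have rev: "path (rev xs)" "length (rev xs) = 2 * h + 2" using xs by (simp_all add: path_rev)
  have rev_ends: "hd (rev xs) = last xs" "last (rev xs) = hd xs" using ne by (simp_all add: hd_rev last_rev)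
  have rev_pos: "rev xs ! i = xs ! (2 * h + 1 - i)" if "i < 2 * h + 2" for i
    using that xs(2) by (simp add: rev_nth)
  have gap: "i = j"
    if "S \<subseteq> {s..s + h}" "h \<le> card S" "i \<in> {s..s + h} - S" "j \<in> {s..s + h} - S" for S :: "nat set" and s i j
  proof (rule ccontr)
    assume "i \<noteq> j"
    have "S \<subseteq> {s..s + h} - {i, j}" using that by blast
    then have "card S \<le> card ({s..s + h} - {i, j})" by (intro card_mono) auto
    also have "\<dots> = card {s..s + h} - card {i, j}" using that by (intro card_Diff_subset) auto
    finally show False using that(2) \<open>i \<noteq> j\<close> h_pos by simp
  qed
  consider "t = h" | "t = h + 1" using t(1,2) xs(2) by linarith
  then show ?thesis
  proof cases
    case 1
    then have A: "?A = {1..h}" using t by (intro card_seteq) auto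
    have front: "E (hd xs) (xs ! Suc i)" if "i < h" for i
    proof -
      have "Suc i \<in> ?A" unfolding A using that by simp
      then show ?thesis by simp
    qed
    have B: "?B \<subseteq> {h..h + h}" using t(5) 1 xs(2) by auto
    have "i = j" if "h \<le> i" "i \<le> 2 * h" "h \<le> j" "j \<le> 2 * h" "\<not> E (last xs) (xs ! i)" "\<not> E (last xs) (xs ! j)" for i j
      by (rule gap[OF B t(7)]) (use that in auto)
    then show ?thesis
      using two_paths_of_shared_centre[OF xs no_path ab front] t(3) 1 by blast
  next
    case 2
    have "card {h + 1..<length xs - 1} = h" using xs(2) by simp
    then have B: "?B = {h + 1..<length xs - 1}" using t(5,7) 2 by (intro card_seteq) auto
    have rear: "E (last xs) (xs ! i)" if "h + 1 \<le> i" "i \<le> 2 * h" for i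
    proof -
      have "i \<in> ?B" unfolding B using that xs(2) by simp
      then show ?thesis by simp
    qed
    have rev_front: "E (hd (rev xs)) (rev xs ! Suc i)" if "i < h" for i
      unfolding rev_ends using that by (subst rev_pos) (auto intro: rear)
    show ?thesis
    proof (cases "E (hd xs) (xs ! (h + 1))")
      case True
      have A: "?A \<subseteq> {1..1 + h}" using t(4) 2 by auto
      have "i = j"
        if ij: "h \<le> i" "i \<le> 2 * h" "h \<le> j" "j \<le> 2 * h"
          "\<not> E (last (rev xs)) (rev xs ! i)" "\<not> E (last (rev xs)) (rev xs ! j)" for i j
      proof -
        have pos: "2 * h + 1 - l \<in> {1..1 + h}" if "h \<le> l" "l \<le> 2 * h" for l
          using that unfolding atLeastAtMost_iff by linarith
        have "\<not> E (hd xs) (xs ! (2 * h + 1 - i))" "\<not> E (hd xs) (xs ! (2 * h + 1 - j))"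
          using ij rev_pos[of i] rev_pos[of j] unfolding rev_ends by auto
        then have "2 * h + 1 - i \<in> {1..1 + h} - ?A" "2 * h + 1 - j \<in> {1..1 + h} - ?A"
          using pos ij by blast+
        then have "2 * h + 1 - i = 2 * h + 1 - j" by (rule gap[OF A t(6)])
        then show ?thesis using ij by linarith
      qed
      moreover have "E (last (rev xs)) (rev xs ! h)" using True rev_pos[of h] unfolding rev_ends by simp
      ultimately show ?thesis
        using two_paths_of_shared_centre[OF rev no_path ab rev_front] by blast
    next
      case False
      have "?A \<subseteq> {1..h}"
      proof
        fix j assume j: "j \<in> ?A"
        then have "j \<noteq> h + 1" using False by blast
        moreover have "j \<in> {1..h + 1}" using j t(4) 2 by blast
        ultimately show "j \<in> {1..h}" by simp
      qed
      then have A: "?A = {1..h}" using t(6) by (intro card_seteq) auto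
      have front: "E (hd xs) (xs ! j)" if "1 \<le> j" "j \<le> h" for j
      proof -
        have "j \<in> ?A" unfolding A using that by simp
        then show ?thesis by simp
      qed
      have "card (set xs) < card V" using card_length[of xs] xs(2) order_ge by linarith
      then have "set xs \<noteq> V" by auto
      moreover have "set xs \<subseteq> V" "set xs \<noteq> {}" using xs(1) ne by (auto simp: path_def)
      ultimately obtain u w where uw: "u \<in> set xs" "w \<in> V - set xs" "E u w" using exists_edge_out by metis
      then obtain i where i: "i < 2 * h + 2" "u = xs ! i" using xs(2) by (metis in_set_conv_nth)
      have w: "w \<in> V" "w \<notin> set xs" "E (xs ! i) w" "E w (xs ! i)" using uw i(2) edge_sym by auto
      have "\<not> i < h" using switch_front_nbrs[OF xs(1) np _ front w(3)] w(2) xs(2) by auto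
      moreover have "i \<noteq> 2 * h + 1"
        using longest_path_last_nbrs[OF xs(1) ne np, of w] w(2,3) xs(2) by (auto simp: last_conv_nth[OF ne])
      moreover have "\<not> (h + 2 \<le> i \<and> i \<le> 2 * h + 1)"
      proof
        assume i': "h + 2 \<le> i \<and> i \<le> 2 * h + 1"
        then have "Suc (i - 1) = i" "E (last xs) (xs ! (i - 1))" by (auto intro: rear)
        then show False using switch_back_nbrs[OF xs(1) np, of "i - 1" w] w(2,3) i xs(2) by simp
      qed
      ultimately consider "i = h" | "i = h + 1" using i(1) by linarith
      then show ?thesis
      proof cases
        case 1
        show ?thesis
          by (rule two_paths_of_separated_ends[OF xs no_path ab front rear w(1,2)]) (use w(4) 1 in auto)
      next
        case 2
        have "E (last (rev xs)) (rev xs ! i)" if "h + 1 \<le> i" "i \<le> 2 * h" for i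
          unfolding rev_ends using that by (subst rev_pos) (auto intro!: front)
        moreover have "E w (rev xs ! h)" using w(4) 2 rev_pos[of h] by simp
        moreover have "w \<notin> set (rev xs)" using w(2) by simp
        ultimately show ?thesis
          using two_paths_of_separated_ends[OF rev no_path ab rev_front _ w(1)] by blast
      qed
    qed
  qed
qed

section \<open>Two disjoint paths or an exceptional structure\<close>

text \<open>
  Crossing chords at distance two give a cycle of length \<open>2 h + 1\<close>, and at distance three a cycle
  of length \<open>2 h\<close> that misses two consecutive vertices of the path. These are attached to the two
  distinct cycle vertices next to them on the path.
\<close>

lemma outcome_of_near_spanning_path:
  assumes xs: "path xs" "length xs = 2 * h + 2" and no_path: "\<not> has_path (2 * h + 3)"
    and ab: "1 \<le> a" "1 \<le> b" "a + b = h + 1"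
  shows "has_two_paths (2 * a) (2 * b + 1) \<or> (a = 3 \<and> b = 1 \<and> h = 3 \<and> (\<exists>p q. joined_matching_at p q))"
proof (cases "\<exists>d. cyc (2 * h + 1) d")
  case True
  then show ?thesis using two_paths_of_odd_cycle[OF _ no_path ab] by blast
next
  case False
  then have no_cyc: "\<not> cyc (2 * h + 1) d" for d by blast
  have np: "\<not> has_path (Suc (length xs))" and ne: "xs \<noteq> []" and lt: "length xs < card V"
    using no_path xs(2) order_ge by (auto simp: numeral_3_eq_3)
  from longest_path_crossing(2)[OF xs(1) ne lt np] consider
    i j where "i + 1 < j" "j < length xs" "j \<le> i + 1 + (length xs - 2 * h)"
      "E (last xs) (xs ! i)" "E (hd xs) (xs ! j)"
    | "\<And>i j. i < length xs \<Longrightarrow> j < length xs \<Longrightarrow> E (last xs) (xs ! i) \<Longrightarrow> E (hd xs) (xs ! j) \<Longrightarrow> j \<le> i"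
    by blast
  then show ?thesis
  proof cases
    case 2
    then show ?thesis using two_paths_of_no_crossing[OF xs no_path ab] by blast
  next
    case 1
    obtain c where c: "cyc (length xs + i + 1 - j) c" "range c = set (take (Suc i) xs) \<union> set (drop j xs)"
      using cycle_of_crossing[OF xs(1) 1(1,2,4,5)] by blast
    have "j \<noteq> i + 2"
    proof
      assume "j = i + 2"
      then have "length xs + i + 1 - j = 2 * h + 1" using xs(2) by simp
      then show False using c(1) no_cyc by simp
    qed
    then have j: "j = i + 3" using 1(1,3) xs(2) by linarith
    then have cyc: "cyc (2 * h) c" using c(1) xs(2) by simp
    have dist: "distinct xs" using xs(1) by (simp add: path_def)
    have out: "xs ! l \<notin> range c" if "i < l" "l < j" for l
      using that dist 1(2) unfolding c(2)
      by (auto simp: in_set_conv_nth nth_eq_iff_index_eq)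
    have "xs ! i \<in> set (take (Suc i) xs)" using 1(1,2) by (simp add: take_Suc_conv_app_nth)
    moreover have "xs ! j \<in> set (drop j xs)" using 1(2) by (metis Cons_nth_drop_Suc list.set_intros(1))
    ultimately have "xs ! i \<in> range c" "xs ! j \<in> range c" using c(2) by blast+
    then obtain i' j' where ij': "xs ! i = c i'" "xs ! j = c j'" by blast
    have edge: "E (xs ! l) (xs ! Suc l)" if "Suc l < length xs" for l using path_nth_edge[OF xs(1) that] .
    have "E (xs ! (i + 1)) (xs ! (i + 2))" "E (xs ! (i + 1)) (c i')" "E (xs ! (i + 2)) (c j')"
      using edge[of i] edge[of "i + 1"] edge[of "i + 2"] 1(2) j edge_sym[of "xs ! i"] unfolding ij'[symmetric]
      by (simp_all add: eval_nat_numeral)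
    moreover have "c i' \<noteq> c j'" unfolding ij'[symmetric] using dist 1(1,2) by (simp add: nth_eq_iff_index_eq)
    moreover have "xs ! (i + 1) \<notin> range c" "xs ! (i + 2) \<notin> range c" using out j by simp_all
    ultimately show ?thesis
      using two_paths_or_joined_matching[OF cyc no_path no_cyc] ab by blast
  qed
qed

text \<open>
  A longest path has order exactly \<open>2 h + 1\<close>. In a windmill the shorter of the two required paths fits into a
  block outside this path if it has at most \<open>h\<close> vertices; both have more only if \<open>a = b\<close> or
  \<open>a = b + 1\<close>.
\<close>

lemma outcome_of_short_longest_path:
  assumes no_path: "\<not> has_path (2 * h + 2)" and ab: "1 \<le> a" "1 \<le> b" "a + b = h + 1"
  shows "has_two_paths (2 * a) (2 * b + 1) \<or> (\<exists>A\<subseteq>V. card A = h \<and> (\<forall>u v. E u v \<longrightarrow> u \<in> A \<or> v \<in> A))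
    \<or> ((a = b \<or> a = b + 1) \<and> (\<exists>c. windmill_at c))"
proof (cases "\<exists>d. cyc (2 * h) d")
  case True
  then show ?thesis using vertex_cover_of_even_cycle no_path by blast
next
  case False
  have "card V \<noteq> 0" using order_ge by linarith
  then obtain v where "v \<in> V" by fastforce
  then have "path [v]" by (simp add: path_singleton)
  moreover have "\<forall>xs. path xs \<longrightarrow> length xs < Suc (card V)" using path_length_le by fastforce
  ultimately obtain xs where xs: "path xs" "\<forall>ys. path ys \<longrightarrow> length ys \<le> length xs"
    using ex_has_greatest_nat[of path "[v]" length "Suc (card V)"] by blast
  then have np: "\<not> has_path (Suc (length xs))" unfolding has_path_def by fastforce
  have "length [v] \<le> length xs" using xs(2) \<open>path [v]\<close> by blast
  then have ne: "xs \<noteq> []" by auto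
  have le: "length xs \<le> 2 * h + 1"
    using has_pathI[OF xs(1), of "2 * h + 2"] no_path by (cases "length xs \<le> 2 * h + 1") auto
  then have "2 * h + 1 \<le> length xs"
    using longest_path_crossing(1)[OF xs(1) ne _ np] order_ge by linarith
  then have len: "length xs = 2 * h + 1" using le by simp
  obtain c ys where c: "windmill_at c" and ys: "path ys" "length ys = h" "set xs \<inter> set ys = {}"
    using windmill_of_tight_path[OF no_path _ xs(1) len] False by blast
  show ?thesis
  proof (cases "a = b \<or> a = b + 1")
    case True
    then show ?thesis using c by blast
  next
    case False
    then consider "2 * a \<le> h" | "2 * b + 1 \<le> h" using ab by linarith
    then have "has_two_paths (2 * a) (2 * b + 1)"
    proof cases
      case 1
      have "has_two_paths (2 * b + 1) (2 * a)"
        by (rule has_two_pathsI[OF xs(1) ys(1,3)]) (use 1 ab ys(2) len in linarith)+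
      then show ?thesis by (rule has_two_paths_sym)
    next
      case 2
      show ?thesis
        by (rule has_two_pathsI[OF xs(1) ys(1,3)]) (use 2 ab ys(2) len in linarith)+
    qed
    then show ?thesis ..
  qed
qed

theorem two_paths_or_exceptional:
  assumes ab: "1 \<le> a" "1 \<le> b" "a + b = h + 1"
  shows "has_two_paths (2 * a) (2 * b + 1)
    \<or> (\<exists>A\<subseteq>V. card A = h \<and> (\<forall>u v. E u v \<longrightarrow> u \<in> A \<or> v \<in> A))
    \<or> (a = 3 \<and> b = 1 \<and> h = 3 \<and> (\<exists>p q. joined_matching_at p q))
    \<or> ((a = b \<or> a = b + 1) \<and> (\<exists>c. windmill_at c))"
proof (cases "has_path (2 * h + 3)")
  case True
  then have "has_path (2 * a + (2 * b + 1))" using has_path_mono ab(3) by fastforce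
  then show ?thesis using has_two_paths_of_long_path by blast
next
  case no_path: False
  show ?thesis
  proof (cases "has_path (2 * h + 2)")
    case True
    then obtain xs where "path xs" "length xs = 2 * h + 2" by (auto simp: has_path_def)
    then show ?thesis using outcome_of_near_spanning_path[OF _ _ no_path ab] by blast
  next
    case False
    then show ?thesis using outcome_of_short_longest_path[OF False ab] by blast
  qed
qed

end

section \<open>Recognising the exceptional graphs\<close>

text \<open>
  Apart from one or two vertices joined to everything, the exceptional graphs consist of disjoint copies
  of one complete graph. Numbering the blocks of a partition, and the elements of each block, yields the
  coordinates of an isomorphism.
\<close>

lemma equal_blocks_indexing:
  assumes fin: "finite W"
    and B: "\<And>v. v \<in> W \<Longrightarrow> v \<in> B v" "\<And>v. v \<in> W \<Longrightarrow> B v \<subseteq> W" "\<And>v. v \<in> W \<Longrightarrow> card (B v) = s"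
      "\<And>v w. v \<in> W \<Longrightarrow> w \<in> B v \<Longrightarrow> B w = B v"
  obtains t f where "bij_betw f W ({1..t} \<times> {..<s})" "card W = t * s"
    "\<forall>u\<in>W. \<forall>v\<in>W. fst (f u) = fst (f v) \<longleftrightarrow> B u = B v"
proof -
  define t where "t = card (B ` W)"
  obtain g where g: "bij_betw g (B ` W) {1..t}"
    using ex_bij_betw_finite_nat[of "B ` W"] ex_bij_betw_nat_finite_1[of "B ` W"] fin
    unfolding t_def by (metis bij_betw_inv finite_imageI)
  have "\<forall>b\<in>B ` W. \<exists>e. bij_betw e b {..<s}"
  proof
    fix b assume "b \<in> B ` W"
    then obtain v where v: "v \<in> W" "b = B v" by blast
    then have "finite b" "card b = s" using finite_subset[OF B(2)[OF v(1)] fin] B(3)[OF v(1)] by auto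
    then show "\<exists>e. bij_betw e b {..<s}" using ex_bij_betw_finite_nat by (metis atLeast0LessThan)
  qed
  then obtain e where e: "\<And>b. b \<in> B ` W \<Longrightarrow> bij_betw (e b) b {..<s}" by metis
  define f where "f v = (g (B v), e (B v) v)" for v
  have g_eq: "g (B u) = g (B v) \<longleftrightarrow> B u = B v" if "u \<in> W" "v \<in> W" for u v
    using inj_on_eq_iff[OF bij_betw_imp_inj_on[OF g]] that by simp
  have "inj_on f W"
  proof (rule inj_onI)
    fix u v assume uv: "u \<in> W" "v \<in> W" "f u = f v"
    then have "B u = B v" "e (B u) u = e (B u) v" using g_eq by (auto simp: f_def)
    moreover have "inj_on (e (B u)) (B u)" using e uv(1) bij_betw_imp_inj_on by blast
    moreover have "u \<in> B u" "v \<in> B v" using B(1) uv by blast+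
    ultimately show "u = v" using inj_onD by metis
  qed
  moreover have "f ` W = {1..t} \<times> {..<s}"
  proof (intro equalityI subsetI)
    fix p assume "p \<in> f ` W"
    then obtain v where v: "v \<in> W" "p = f v" by blast
    then have "g (B v) \<in> {1..t}" using bij_betwE[OF g] by simp
    moreover have "e (B v) v \<in> {..<s}" using bij_betwE[OF e[of "B v"]] B(1) v by simp
    ultimately show "p \<in> {1..t} \<times> {..<s}" using v by (simp add: f_def)
  next
    fix p assume p: "p \<in> {1..t} \<times> {..<s}"
    then have "fst p \<in> g ` B ` W" "snd p \<in> {..<s}" using bij_betw_imp_surj_on[OF g] by auto
    then obtain v where v: "v \<in> W" "g (B v) = fst p" by (auto simp del: lessThan_iff)
    have "snd p \<in> e (B v) ` B v"
      using bij_betw_imp_surj_on[OF e[of "B v"]] v(1) \<open>snd p \<in> {..<s}\<close> by simp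
    then obtain u where u: "u \<in> B v" "e (B v) u = snd p" by force
    then have "u \<in> W" "B u = B v" using B(2,4) v(1) by blast+
    then have "f u = p" using u v by (simp add: f_def)
    then show "p \<in> f ` W" using \<open>u \<in> W\<close> by blast
  qed
  ultimately have bij: "bij_betw f W ({1..t} \<times> {..<s})" by (simp add: bij_betw_def)
  moreover have "card W = t * s" using bij_betw_same_card[OF bij] by simp
  moreover have "\<forall>u\<in>W. \<forall>v\<in>W. fst (f u) = fst (f v) \<longleftrightarrow> B u = B v"
    using g_eq by (simp add: f_def)
  ultimately show ?thesis by (rule that)
qed

lemma isomorphic_L_graph:
  fixes G :: "'a pair_pre_digraph"
  assumes G: "pair_graph G" and c: "c \<in> pverts G" "\<And>v. v \<in> pverts G - {c} \<Longrightarrow> (v, c) \<in> parcs G"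
    and B: "\<And>v. v \<in> pverts G - {c} \<Longrightarrow> B v = insert v ({u. (v, u) \<in> parcs G} - {c})"
      "\<And>v. v \<in> pverts G - {c} \<Longrightarrow> card (B v) = h"
      "\<And>v w. v \<in> pverts G - {c} \<Longrightarrow> w \<in> B v \<Longrightarrow> B w = B v"
  shows "\<exists>t. card (pverts G) = t * h + 1 \<and> isomorphic G (L_graph t h)"
proof -
  let ?V = "pverts G" and ?W = "pverts G - {c}"
  have G': "finite ?V" "parcs G \<subseteq> ?V \<times> ?V" "sym (parcs G)" "irrefl (parcs G)"
    using G by (simp_all add: pair_graph_iff)
  have BW: "v \<in> B v" "B v \<subseteq> ?W" if "v \<in> ?W" for v
    using B(1)[OF that] G'(2) that by auto
  obtain t f where f: "bij_betw f ?W ({1..t} \<times> {..<h})" "card ?W = t * h"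
    "\<forall>u\<in>?W. \<forall>v\<in>?W. fst (f u) = fst (f v) \<longleftrightarrow> B u = B v"
  proof (rule equal_blocks_indexing[of ?W B h])
    show "finite ?W" using G'(1) by simp
    show "v \<in> B v" "B v \<subseteq> ?W" "card (B v) = h" if "v \<in> ?W" for v
      using BW[OF that] B(2)[OF that] by blast+
    show "B w = B v" if "v \<in> ?W" "w \<in> B v" for v w using B(3)[OF that] .
  qed
  have edge_iff: "(u, v) \<in> parcs G \<longleftrightarrow> u \<noteq> v \<and> B u = B v" if "u \<in> ?W" "v \<in> ?W" for u v
  proof
    assume uv: "(u, v) \<in> parcs G"
    then have "v \<in> B u" using B(1)[OF that(1)] that by blast
    then have "B u = B v" using B(3)[OF that(1)] by simp
    moreover have "u \<noteq> v" using uv G'(4) by (auto simp: irrefl_def)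
    ultimately show "u \<noteq> v \<and> B u = B v" by simp
  next
    assume "u \<noteq> v \<and> B u = B v"
    then show "(u, v) \<in> parcs G" using BW(1)[OF that(2)] B(1)[OF that(1)] by auto
  qed
  define \<phi> where "\<phi> v = (if v = c then Inl (0::nat) else Inr (f v))" for v
  have "bij_betw \<phi> ?V (pverts (L_graph t h))"
  proof -
    have "inj_on \<phi> ?V"
      using f(1) by (auto simp: inj_on_def \<phi>_def bij_betw_def)
    moreover have "\<phi> ` ?V = insert (Inl (0::nat)) (Inr ` f ` ?W)"
      using c(1) by (auto simp: \<phi>_def image_iff)
    moreover have "\<dots> = pverts (L_graph t h)"
      using f(1) by (auto simp: bij_betw_def L_graph_def graph_join_def copies_def disjoint_Union_def complete_graph_def)
    ultimately show ?thesis by (simp add: bij_betw_def)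
  qed
  moreover have "parcs (L_graph t h) = map_prod \<phi> \<phi> ` parcs G"
  proof -
    have L: "parcs (L_graph t h) = {(Inr (i, j), Inr (i, j')) | i j j'. i \<in> {1..t} \<and> j < h \<and> j' < h \<and> j \<noteq> j'}
       \<union> {(Inl 0, Inr (i, j)) | i j. i \<in> {1..t} \<and> j < h} \<union> {(Inr (i, j), Inl 0) | i j. i \<in> {1..t} \<and> j < h}"
      by (auto simp: L_graph_def graph_join_def disjoint_union_def copies_def disjoint_Union_def complete_graph_def image_iff)
    have arc_iff: "(u, v) \<in> parcs G \<longleftrightarrow>
        u \<in> ?W \<and> v \<in> ?W \<and> u \<noteq> v \<and> B u = B v \<or> u = c \<and> v \<in> ?W \<or> v = c \<and> u \<in> ?W" for u v
    proof -
      have V: "u \<in> ?V \<and> v \<in> ?V \<and> u \<noteq> v" if "(u, v) \<in> parcs G"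
        using that G'(2,4) unfolding irrefl_def by blast
      show ?thesis
      proof (cases "u \<in> ?W \<and> v \<in> ?W")
        case True
        then show ?thesis using edge_iff[of u v] by simp
      next
        case False
        have "(u, v) \<in> parcs G" if "u = c \<and> v \<in> ?W \<or> v = c \<and> u \<in> ?W"
          using that c(2) symD[OF G'(3) c(2)] by metis
        then show ?thesis using False V by blast
      qed
    qed
    have onto: "\<exists>v\<in>?W. f v = (i, j)" if "i \<in> {1..t}" "j < h" for i j
      using f(1) that unfolding bij_betw_def by (metis (no_types, lifting) SigmaI imageE lessThan_iff)
    have into: "f v \<in> {1..t} \<times> {..<h}" if "v \<in> ?W" for v
      using f(1) that by (auto simp: bij_betw_def)
    show ?thesis
    proof (intro equalityI subsetI)
      fix e assume "e \<in> parcs (L_graph t h)"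
      then consider i j j' where "e = (Inr (i, j), Inr (i, j'))" "i \<in> {1..t}" "j < h" "j' < h" "j \<noteq> j'"
        | i j where "e = (Inl 0, Inr (i, j))" "i \<in> {1..t}" "j < h"
        | i j where "e = (Inr (i, j), Inl 0)" "i \<in> {1..t}" "j < h"
        unfolding L by blast
      then show "e \<in> map_prod \<phi> \<phi> ` parcs G"
      proof cases
        case 1
        obtain u v where uv: "u \<in> ?W" "v \<in> ?W" "f u = (i, j)" "f v = (i, j')"
          using onto 1 by metis
        have "B u = B v" using f(3)[rule_format, OF uv(1,2)] uv(3,4) by simp
        moreover have "u \<noteq> v" using uv(3,4) 1(5) by auto
        ultimately have "(u, v) \<in> parcs G" using edge_iff[OF uv(1,2)] by blast
        moreover have "e = map_prod \<phi> \<phi> (u, v)" using uv 1 by (simp add: \<phi>_def)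
        ultimately show ?thesis by blast
      next
        case 2
        obtain v where v: "v \<in> ?W" "f v = (i, j)" using onto 2 by metis
        then have "(c, v) \<in> parcs G" "e = map_prod \<phi> \<phi> (c, v)" using 2 by (auto simp: \<phi>_def arc_iff)
        then show ?thesis by blast
      next
        case 3
        obtain v where v: "v \<in> ?W" "f v = (i, j)" using onto 3 by metis
        then have "(v, c) \<in> parcs G" "e = map_prod \<phi> \<phi> (v, c)" using 3 by (auto simp: \<phi>_def arc_iff)
        then show ?thesis by blast
      qed
    next
      fix e assume "e \<in> map_prod \<phi> \<phi> ` parcs G"
      then obtain u v where uv: "(u, v) \<in> parcs G" "e = (\<phi> u, \<phi> v)" by auto
      from uv(1) consider "u \<in> ?W" "v \<in> ?W" "u \<noteq> v" "B u = B v" | "u = c" "v \<in> ?W" | "v = c" "u \<in> ?W"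
        unfolding arc_iff by blast
      then show "e \<in> parcs (L_graph t h)"
      proof cases
        case 1
        then have "fst (f u) = fst (f v)" "f u \<noteq> f v"
          using f(3) inj_onD[OF bij_betw_imp_inj_on[OF f(1)]] by metis+
        then have "snd (f u) \<noteq> snd (f v)" by (simp add: prod_eq_iff)
        then have "(Inr (f u), Inr (f v)) \<in> parcs (L_graph t h)"
          using into[OF 1(1)] into[OF 1(2)] \<open>fst (f u) = fst (f v)\<close> unfolding L
          by (cases "f u"; cases "f v") auto
        then show ?thesis using 1 uv(2) by (simp add: \<phi>_def)
      next
        case 2
        then show ?thesis using into[of v] uv(2) unfolding L by (cases "f v") (auto simp: \<phi>_def)
      next
        case 3
        then show ?thesis using into[of u] uv(2) unfolding L by (cases "f u") (auto simp: \<phi>_def)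
      qed
    qed
  qed
  ultimately have "isomorphic G (L_graph t h)"
    unfolding isomorphic_iff[OF G] by blast
  moreover have "card ?V = t * h + 1"
    using f(2) c(1) G'(1) by (metis Suc_eq_plus1 card_Suc_Diff1)
  ultimately show ?thesis by blast
qed

lemma contained_in_joined_matching:
  assumes G: "pair_graph G" and pq: "p \<in> pverts G" "q \<in> pverts G" "p \<noteq> q"
    and nbr: "\<And>v. v \<in> pverts G - {p, q} \<Longrightarrow> \<exists>v'\<in>pverts G - {p, q}. {u. (v, u) \<in> parcs G} = {p, q, v'}"
  shows "even (card (pverts G)) \<and>
    contained_in G (graph_join (complete_graph 2) (copies ((card (pverts G) - 2) div 2) (complete_graph 2)))"
proof -
  let ?V = "pverts G" and ?W = "pverts G - {p, q}"
  have G': "finite ?V" "parcs G \<subseteq> ?V \<times> ?V" "sym (parcs G)" "irrefl (parcs G)"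
    using G by (simp_all add: pair_graph_iff)
  obtain m where m: "\<And>v. v \<in> ?W \<Longrightarrow> m v \<in> ?W" "\<And>v. v \<in> ?W \<Longrightarrow> {u. (v, u) \<in> parcs G} = {p, q, m v}"
    using nbr by metis
  have mm: "m (m v) = v" if "v \<in> ?W" for v
  proof -
    have "(v, m v) \<in> parcs G" using m(2)[OF that] by blast
    then have "(m v, v) \<in> parcs G" using G'(3) by (auto simp: sym_def)
    then have "v \<in> {p, q, m (m v)}" using m(2)[OF m(1)[OF that]] by blast
    then show ?thesis using that by auto
  qed
  have ne: "m v \<noteq> v" if "v \<in> ?W" for v
    using m(2)[OF that] G'(4) by (auto simp: irrefl_def)
  define B where "B v = {v, m v}" for v
  obtain t f where f: "bij_betw f ?W ({1..t} \<times> {..<2::nat})" "card ?W = t * 2"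
    "\<forall>u\<in>?W. \<forall>v\<in>?W. fst (f u) = fst (f v) \<longleftrightarrow> B u = B v"
  proof (rule equal_blocks_indexing[of ?W B 2])
    show "finite ?W" using G'(1) by simp
    show "v \<in> B v" if "v \<in> ?W" for v by (simp add: B_def)
    show "B v \<subseteq> ?W" if "v \<in> ?W" for v using that m(1)[OF that] by (auto simp: B_def)
    show "card (B v) = 2" if "v \<in> ?W" for v using ne[OF that] by (simp add: B_def)
    show "B w = B v" if "v \<in> ?W" "w \<in> B v" for v w using that mm[OF that(1)] by (auto simp: B_def)
  qed
  have cW: "card ?V = card ?W + 2"
    using pq G'(1) card_Diff_subset[of "{p, q}" ?V] card_mono[of ?V "{p, q}"] by simp
  then have t: "t = (card ?V - 2) div 2" using f(2) by simp
  have into: "f v \<in> {1..t} \<times> {..<2}" if "v \<in> ?W" for v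
    using f(1) that by (auto simp: bij_betw_def)
  let ?H = "graph_join (complete_graph 2) (copies t (complete_graph 2))"
  define \<phi> where "\<phi> v = (if v = p then Inl (0::nat) else if v = q then Inl 1 else Inr (f v))" for v
  have H: "pverts ?H = {Inl 0, Inl 1} \<union> Inr ` ({1..t} \<times> {..<2::nat})"
    "parcs ?H = {(Inl 0, Inl 1), (Inl 1, Inl 0)}
       \<union> {(Inr (i, j), Inr (i, j')) | i j j'. i \<in> {1..t} \<and> j < 2 \<and> j' < 2 \<and> j \<noteq> j'}
       \<union> {(Inl l, Inr (i, j)) | l i j. l < 2 \<and> i \<in> {1..t} \<and> j < 2} \<union> {(Inr (i, j), Inl l) | l i j. l < 2 \<and> i \<in> {1..t} \<and> j < 2}"
    by (auto simp: graph_join_def disjoint_union_def copies_def disjoint_Union_def complete_graph_def image_iff less_2_cases_iff)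
  have "pair_graph ?H"
    unfolding copies_def
    by (intro pair_graph_graph_join pair_graph_disjoint_Union pair_graph_complete_graph) simp
  moreover have "inj_on \<phi> ?V"
  proof (rule inj_onI)
    fix u v assume uv: "u \<in> ?V" "v \<in> ?V" "\<phi> u = \<phi> v"
    show "u = v"
    proof (cases "u \<in> ?W \<and> v \<in> ?W")
      case True
      then have "f u = f v" using uv(3) by (simp add: \<phi>_def)
      then show ?thesis using inj_onD[OF bij_betw_imp_inj_on[OF f(1)]] True by blast
    next
      case False
      then show ?thesis using uv by (auto simp: \<phi>_def split: if_splits)
    qed
  qed
  moreover have "\<phi> ` ?V \<subseteq> pverts ?H"
  proof (rule image_subsetI)
    fix v assume "v \<in> ?V"
    then show "\<phi> v \<in> pverts ?H" using into[of v] unfolding H(1) by (auto simp: \<phi>_def)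
  qed
  moreover have "map_prod \<phi> \<phi> ` parcs G \<subseteq> parcs ?H"
  proof
    fix e assume "e \<in> map_prod \<phi> \<phi> ` parcs G"
    then obtain u v where uv: "(u, v) \<in> parcs G" "e = (\<phi> u, \<phi> v)" by auto
    have "u \<in> ?V" "v \<in> ?V" "u \<noteq> v" using uv(1) G'(2,4) by (auto simp: irrefl_def)
    then consider "u \<in> ?W" "v \<in> ?W" | "u \<in> {p, q}" "v \<in> ?W" | "v \<in> {p, q}" "u \<in> ?W" | "u = p" "v = q" | "u = q" "v = p"
      by blast
    then show "e \<in> parcs ?H"
    proof cases
      case 1
      have "v = m u" using m(2)[OF 1(1)] uv(1) 1 by auto
      then have "B u = B v" using mm[OF 1(1)] by (auto simp: B_def)
      then have "fst (f u) = fst (f v)" using f(3) 1 by blast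
      moreover have "f u \<noteq> f v" using inj_onD[OF bij_betw_imp_inj_on[OF f(1)] _ 1] \<open>u \<noteq> v\<close> by blast
      ultimately have "(Inr (f u), Inr (f v)) \<in> parcs ?H"
        using into[OF 1(1)] into[OF 1(2)] unfolding H(2) by (cases "f u"; cases "f v") auto
      then show ?thesis using 1 uv(2) by (simp add: \<phi>_def)
    next
      case 2
      then show ?thesis using into[OF 2(2)] uv(2) unfolding H(2) by (cases "f v") (auto simp: \<phi>_def)
    next
      case 3
      then show ?thesis using into[OF 3(2)] uv(2) unfolding H(2) by (cases "f u") (auto simp: \<phi>_def)
    next
      case 4
      then show ?thesis using uv(2) pq(3) unfolding H(2) by (simp add: \<phi>_def)
    next
      case 5
      then show ?thesis using uv(2) pq(3) unfolding H(2) by (simp add: \<phi>_def)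
    qed
  qed
  ultimately have "contained_in G ?H" unfolding contained_in_iff[OF G \<open>pair_graph ?H\<close>] by blast
  moreover have "even (card ?V)" using cW f(2) by simp
  ultimately show ?thesis unfolding t by blast
qed

lemma contained_in_S_graph:
  fixes G :: "'a pair_pre_digraph"
  assumes G: "pair_graph G" and A: "A \<subseteq> pverts G" "card A = h"
    and cover: "\<And>u v. (u, v) \<in> parcs G \<Longrightarrow> u \<in> A \<or> v \<in> A"
  shows "contained_in G (S_graph (card (pverts G)) h)"
proof -
  let ?V = "pverts G" and ?n = "card (pverts G)"
  have G': "finite ?V" "parcs G \<subseteq> ?V \<times> ?V" "irrefl (parcs G)"
    using G by (simp_all add: pair_graph_iff)
  have fin: "finite A" "finite (?V - A)" using G'(1) A(1) finite_subset by auto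
  have card: "card (?V - A) = ?n - h" using A fin(1) by (simp add: card_Diff_subset)
  obtain \<alpha> where \<alpha>: "bij_betw \<alpha> A {..<h}"
    using ex_bij_betw_finite_nat[OF fin(1)] A(2) by (auto simp: atLeast0LessThan)
  obtain \<beta> where \<beta>: "bij_betw \<beta> (?V - A) {..<?n - h}"
    using ex_bij_betw_finite_nat[OF fin(2)] card by (auto simp: atLeast0LessThan)
  define \<phi> :: "'a \<Rightarrow> nat + nat" where "\<phi> v = (if v \<in> A then Inl (\<alpha> v) else Inr (\<beta> v))" for v
  have \<alpha>_lt: "\<alpha> v < h" if "v \<in> A" for v using \<alpha> that by (auto simp: bij_betw_def)
  have \<beta>_lt: "\<beta> v < ?n - h" if "v \<in> ?V" "v \<notin> A" for v using \<beta> that by (auto simp: bij_betw_def)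
  have S: "pverts (S_graph ?n h) = Inl ` {..<h} \<union> Inr ` {..<?n - h}"
    "parcs (S_graph ?n h) = {(Inl i, Inl j) | i j. i < h \<and> j < h \<and> i \<noteq> j}
      \<union> {(Inl i, Inr j) | i j. i < h \<and> j < ?n - h} \<union> {(Inr j, Inl i) | i j. i < h \<and> j < ?n - h}"
  proof -
    have K: "pverts (complete_graph m) = {..<m}" "parcs (complete_graph m) = {(i, j). i < m \<and> j < m \<and> i \<noteq> j}"
      "pverts (complement_graph (complete_graph m)) = {..<m}" "parcs (complement_graph (complete_graph m)) = {}" for m
      by (auto simp: complete_graph_def complement_graph_def)
    show "pverts (S_graph ?n h) = Inl ` {..<h} \<union> Inr ` {..<?n - h}"
      by (simp add: S_graph_def graph_join_def K Plus_def)
    show "parcs (S_graph ?n h) = {(Inl i, Inl j) | i j. i < h \<and> j < h \<and> i \<noteq> j}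
      \<union> {(Inl i, Inr j) | i j. i < h \<and> j < ?n - h} \<union> {(Inr j, Inl i) | i j. i < h \<and> j < ?n - h}"
      unfolding S_graph_def graph_join_def disjoint_union_def K by auto
  qed
  have pS: "pair_graph (S_graph ?n h)"
    unfolding S_graph_def
    by (intro pair_graph_graph_join pair_graph_complement_graph pair_graph_complete_graph)
  have inj: "inj_on \<alpha> A" "inj_on \<beta> (?V - A)" using \<alpha> \<beta> bij_betw_imp_inj_on by blast+
  have "inj_on \<phi> ?V"
  proof (rule inj_onI)
    fix u v assume uv: "u \<in> ?V" "v \<in> ?V" "\<phi> u = \<phi> v"
    then show "u = v"
      using inj_onD[OF inj(1), of u v] inj_onD[OF inj(2), of u v]
      by (cases "u \<in> A"; cases "v \<in> A") (auto simp: \<phi>_def)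
  qed
  moreover have "\<phi> ` ?V \<subseteq> pverts (S_graph ?n h)"
    unfolding S(1) using \<alpha>_lt \<beta>_lt by (auto simp: \<phi>_def)
  moreover have "map_prod \<phi> \<phi> ` parcs G \<subseteq> parcs (S_graph ?n h)"
  proof
    fix e assume "e \<in> map_prod \<phi> \<phi> ` parcs G"
    then obtain u v where uv: "(u, v) \<in> parcs G" "e = (\<phi> u, \<phi> v)" by auto
    have V: "u \<in> ?V" "v \<in> ?V" "u \<noteq> v" using uv(1) G'(2,3) by (auto simp: irrefl_def)
    consider "u \<in> A" "v \<in> A" | "u \<in> A" "v \<notin> A" | "u \<notin> A" "v \<in> A" using cover[OF uv(1)] by blast
    then show "e \<in> parcs (S_graph ?n h)"
    proof cases
      case 1
      then have "\<alpha> u \<noteq> \<alpha> v" using inj_onD[OF inj(1)] V(3) by blast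
      then show ?thesis using 1 \<alpha>_lt uv(2) unfolding S(2) by (simp add: \<phi>_def)
    qed (use V \<alpha>_lt \<beta>_lt uv(2) in \<open>simp_all add: S(2) \<phi>_def\<close>)
  qed
  ultimately show ?thesis unfolding contained_in_iff[OF G pS] by blast
qed

section \<open>From two paths to the linear forest\<close>

lemma pair_graph_linear_forest:
  "pair_graph (disjoint_union (disjoint_Union {1..k} (\<lambda>i. path_graph (2 * a i))) (path_graph (2 * b + 1)))"
  for k :: nat
  by (intro pair_graph_disjoint_union pair_graph_disjoint_Union pair_graph_path_graph) simp

text \<open>
  The list \<open>ys\<close> is cut into consecutive segments of orders \<open>2 a\<^sub>1, \<dots>, 2 a\<^bsub>k-1\<^esub>\<close> and \<open>2 b + 1\<close>, and \<open>xs\<close>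
  is the last even component. In \<open>ys @ xs\<close> the function \<open>pos\<close> gives the place of every vertex of the
  forest, and \<open>off i\<close> is the start of the \<open>i\<close>-th segment; only the step from \<open>ys\<close> to \<open>xs\<close> need not be an
  edge, and no component runs across it.
\<close>

lemma contained_in_of_two_paths:
  fixes G :: "'a pair_pre_digraph" and a :: "nat \<Rightarrow> nat" and k b :: nat
  defines "F \<equiv> disjoint_union (disjoint_Union {1..k} (\<lambda>i. path_graph (2 * a i))) (path_graph (2 * b + 1))"
  assumes G: "pair_graph G"
    and xs: "distinct xs" "set xs \<subseteq> pverts G" "successively (\<lambda>u v. (u, v) \<in> parcs G) xs"
    and ys: "distinct ys" "set ys \<subseteq> pverts G" "successively (\<lambda>u v. (u, v) \<in> parcs G) ys"
    and disj: "set xs \<inter> set ys = {}"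
    and len: "length xs = 2 * a k" "length ys = 2 * (\<Sum>i=1..<k. a i) + 2 * b + 1"
  shows "contained_in F G"
proof -
  define off where "off i = 2 * (\<Sum>l=1..<i. a l)" for i
  have off_step: "off i + 2 * a i \<le> off i'" if "1 \<le> i" "i < i'" for i i'
  proof -
    have "(\<Sum>l=1..<i. a l) + a i = (\<Sum>l=1..<Suc i. a l)" using that(1) by simp
    also have "\<dots> \<le> (\<Sum>l=1..<i'. a l)" using that by (intro sum_mono2) auto
    finally show ?thesis by (simp add: off_def)
  qed
  have len_ys: "length ys = off k + (2 * b + 1)" using len(2) by (simp add: off_def)
  define pos where "pos v = (case v of Inl (i, j) \<Rightarrow> (if i = k then length ys + j else off i + j) | Inr j \<Rightarrow> off k + j)"
    for v :: "nat \<times> nat + nat"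
  let ?zs = "ys @ xs"
  define f where "f v = ?zs ! pos v" for v
  have verts: "pverts F = {Inl (i, j) | i j. 1 \<le> i \<and> i \<le> k \<and> j < 2 * a i} \<union> {Inr j | j. j < 2 * b + 1}"
    by (auto simp: F_def disjoint_union_def disjoint_Union_def path_graph_def)
  have edge: "(?zs ! l, ?zs ! Suc l) \<in> parcs G" if "Suc l < length ?zs" "Suc l \<noteq> length ys" for l
  proof (cases "Suc l < length ys")
    case True
    then show ?thesis using ys(3) by (simp add: successively_conv_nth nth_append)
  next
    case False
    then have "Suc (l - length ys) < length xs" "Suc l - length ys = Suc (l - length ys)" "length ys \<le> l"
      using that by auto
    then show ?thesis using xs(3) by (simp add: successively_conv_nth nth_append)
  qed
  have pos_less: "pos v < length ?zs" if "v \<in> pverts F" for v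
  proof -
    have "off i + j < length ?zs" if "1 \<le> i" "i \<le> k" "i \<noteq> k" "j < 2 * a i" for i j
      using off_step[of i k] that len_ys by simp
    moreover have "off k + j < length ?zs" if "j < 2 * b + 1" for j using that len_ys by simp
    ultimately show ?thesis using that len(1) unfolding verts by (auto simp: pos_def)
  qed
  have pos_inj: "inj_on pos (pverts F)"
  proof -
    have ltk: "off i + j < off k" if "1 \<le> i" "i \<le> k" "i \<noteq> k" "j < 2 * a i" for i j
      using off_step[of i k] that by linarith
    have II: "i = i' \<and> j = j'"
      if "off i + j = off i' + j'" "1 \<le> i" "1 \<le> i'" "j < 2 * a i" "j' < 2 * a i'" for i j i' j'
      using off_step[of i i'] off_step[of i' i] that by (cases i i' rule: linorder_cases) auto
    have Ik: "off i + j \<noteq> length ys + j'" "off i + j \<noteq> off k + j'"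
      if "1 \<le> i" "i \<le> k" "i \<noteq> k" "j < 2 * a i" for i j j'
      using ltk[OF that] len_ys by linarith+
    show ?thesis
    proof (rule inj_onI)
      fix u v assume u: "u \<in> pverts F" and v: "v \<in> pverts F" and eq: "pos u = pos v"
      from u consider i j where "u = Inl (i, j)" "1 \<le> i" "i \<le> k" "j < 2 * a i" | j where "u = Inr j" "j < 2 * b + 1"
        unfolding verts by blast
      note u_cases = this
      from v consider i j where "v = Inl (i, j)" "1 \<le> i" "i \<le> k" "j < 2 * a i" | j where "v = Inr j" "j < 2 * b + 1"
        unfolding verts by blast
      note v_cases = this
      show "u = v"
      proof (cases rule: u_cases)
        case u1: (1 i j)
        show ?thesis
        proof (cases rule: v_cases)
          case v1: (1 i' j')
          show ?thesis
            using eq u1 v1 II[of i j i' j'] Ik(1)[of i j j'] Ik(1)[of i' j' j]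
            by (cases "i = k"; cases "i' = k") (auto simp: pos_def)
        next
          case v2: (2 j')
          show ?thesis using eq u1 v2 Ik(2)[of i j j'] len_ys by (cases "i = k") (auto simp: pos_def)
        qed
      next
        case u2: (2 j)
        show ?thesis
        proof (cases rule: v_cases)
          case v1: (1 i' j')
          show ?thesis using eq u2 v1 Ik(2)[of i' j' j] len_ys by (cases "i' = k") (auto simp: pos_def)
        next
          case v2: (2 j')
          show ?thesis using eq u2 v2 by (simp add: pos_def)
        qed
      qed
    qed
  qed
  have "distinct ?zs" using xs(1) ys(1) disj by auto
  then have "inj_on f (pverts F)"
    using pos_inj pos_less unfolding f_def inj_on_def by (metis nth_eq_iff_index_eq)
  moreover have "f ` pverts F \<subseteq> pverts G"
  proof (rule image_subsetI)
    fix v assume "v \<in> pverts F"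
    then have "f v \<in> set ?zs" unfolding f_def by (intro nth_mem pos_less)
    then show "f v \<in> pverts G" using xs(2) ys(2) by auto
  qed
  moreover have "map_prod f f ` parcs F \<subseteq> parcs G"
  proof -
    have sym: "(y, x) \<in> parcs G" if "(x, y) \<in> parcs G" for x y
      using G that by (auto simp: pair_graph_iff sym_def)
    have piece: "(f (Inl (i, j)), f (Inl (i, Suc j))) \<in> parcs G" if "1 \<le> i" "i \<le> k" "Suc j < 2 * a i" for i j
    proof (cases "i = k")
      case True
      then show ?thesis using edge[of "length ys + j"] that len(1) by (simp add: f_def pos_def)
    next
      case False
      then have "off i + Suc j < off k" using off_step[of i k] that by linarith
      then show ?thesis using edge[of "off i + j"] False len_ys by (simp add: f_def pos_def)
    qed
    have odd: "(f (Inr j), f (Inr (Suc j))) \<in> parcs G" if "Suc j < 2 * b + 1" for j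
      using edge[of "off k + j"] that len_ys by (simp add: f_def pos_def)
    have arcs: "parcs F = {(Inl (i, j), Inl (i, j')) | i j j'. 1 \<le> i \<and> i \<le> k \<and> j < 2 * a i \<and> j' < 2 * a i \<and> (j' = Suc j \<or> j = Suc j')}
        \<union> {(Inr j, Inr j') | j j'. j < 2 * b + 1 \<and> j' < 2 * b + 1 \<and> (j' = Suc j \<or> j = Suc j')}"
      unfolding F_def disjoint_union_def disjoint_Union_def path_graph_def by (auto simp: image_iff)
    show ?thesis
    proof
      fix e assume "e \<in> map_prod f f ` parcs F"
      then obtain u v where uv: "(u, v) \<in> parcs F" "e = (f u, f v)" by auto
      from uv(1) consider
        i j j' where "u = Inl (i, j)" "v = Inl (i, j')" "1 \<le> i" "i \<le> k" "j < 2 * a i" "j' < 2 * a i" "j' = Suc j \<or> j = Suc j'"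
        | j j' where "u = Inr j" "v = Inr j'" "j < 2 * b + 1" "j' < 2 * b + 1" "j' = Suc j \<or> j = Suc j'"
        unfolding arcs by blast
      then show "e \<in> parcs G"
      proof cases
        case 1
        from 1(7) show ?thesis
        proof
          assume "j' = Suc j"
          then show ?thesis using piece[of i j] 1 uv(2) by simp
        next
          assume "j = Suc j'"
          then show ?thesis using sym[OF piece[of i j']] 1 uv(2) by simp
        qed
      next
        case 2
        from 2(5) show ?thesis
        proof
          assume "j' = Suc j"
          then show ?thesis using odd[of j] 2 uv(2) by simp
        next
          assume "j = Suc j'"
          then show ?thesis using sym[OF odd[of j']] 2 uv(2) by simp
        qed
      qed
    qed
  qed
  ultimately show ?thesis
    unfolding F_def contained_in_iff[OF pair_graph_linear_forest G] by blast
qed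

lemma isomorphic_disjoint_Union_singleton:
  assumes "pair_graph (G i)" "pair_graph H"
  shows "isomorphic (disjoint_union (disjoint_Union {i} G) H) (disjoint_union (G i) H)"
proof -
  have P: "pair_graph (disjoint_union (disjoint_Union {i} G) H)"
    using assms by (intro pair_graph_disjoint_union pair_graph_disjoint_Union) auto
  have "bij_betw (map_sum snd id) (pverts (disjoint_union (disjoint_Union {i} G) H)) (pverts (disjoint_union (G i) H))"
  proof -
    have "inj_on (map_sum snd id) (pverts (disjoint_union (disjoint_Union {i} G) H))"
      by (auto simp: inj_on_def disjoint_union_def disjoint_Union_def)
    moreover have "map_sum snd id ` (pverts (disjoint_union (disjoint_Union {i} G) H)) = pverts (disjoint_union (G i) H)"
    proof -
      have "pverts (disjoint_Union {i} G) = Pair i ` pverts (G i)" by (auto simp: disjoint_Union_def)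
      then show ?thesis by (simp add: disjoint_union_def Plus_def image_Un image_image)
    qed
    ultimately show ?thesis by (simp add: bij_betw_def)
  qed
  moreover have "parcs (disjoint_union (G i) H)
      = map_prod (map_sum snd id) (map_sum snd id) ` parcs (disjoint_union (disjoint_Union {i} G) H)"
    by (simp add: disjoint_union_def disjoint_Union_def image_Un image_image prod.map_comp o_def map_prod_def case_prod_beta)
  ultimately show ?thesis unfolding isomorphic_iff[OF P] by blast
qed

section \<open>Linear forests in connected graphs of given minimum degree\<close>

lemma closed_set_of_connected:
  assumes "connected (with_proj G)" "U \<subseteq> pverts G" "U \<noteq> {}"
    and closed: "\<And>u v. u \<in> U \<Longrightarrow> (u, v) \<in> parcs G \<Longrightarrow> v \<in> U" and sym: "sym (parcs G)"
  shows "U = pverts G"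
proof -
  let ?S = "with_proj (mk_symmetric (with_proj G))"
  obtain u where u: "u \<in> U" using assms(3) by blast
  have "v \<in> U" if "v \<in> pverts G" for v
  proof -
    have "u \<rightarrow>\<^sup>*\<^bsub>?S\<^esub> v"
      using assms(1) u that assms(2) by (auto simp: connected_def strongly_connected_def mk_symmetric_def)
    then show ?thesis
      unfolding reachable_def
    proof (induction rule: rtrancl_on_induct)
      case base
      show ?case by (rule u)
    next
      case (step x y)
      then have "(x, y) \<in> parcs G \<or> (y, x) \<in> parcs G"
        by (auto simp: mk_symmetric_def arcs_ends_def arc_to_ends_def)
      then show ?case using closed[OF step.IH] sym by (auto dest: symD)
    qed
  qed
  then show ?thesis using assms(2) by blast
qed

lemma min_degree_graph_of_pair_graph:
  assumes G: "pair_graph G" "connected (with_proj G)" and n: "2 * h + 3 \<le> card (pverts G)"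
    and deg: "h \<le> min_degree G" "1 \<le> h"
  shows "min_degree_graph (pverts G) (\<lambda>u v. (u, v) \<in> parcs G) h"
proof -
  have G': "finite (pverts G)" "parcs G \<subseteq> pverts G \<times> pverts G" "sym (parcs G)" "irrefl (parcs G)"
    using G(1) by (simp_all add: pair_graph_iff)
  show ?thesis
  proof
    show "finite (pverts G)" by (rule G')
    show "u \<in> pverts G" if "(u, v) \<in> parcs G" for u v using that G'(2) by blast
    show "(v, u) \<in> parcs G" if "(u, v) \<in> parcs G" for u v using that G'(3) by (rule symD[rotated])
    show "(u, u) \<notin> parcs G" for u using G'(4) by (simp add: irrefl_def)
    show "U = pverts G" if "U \<subseteq> pverts G" "U \<noteq> {}" "\<And>u v. u \<in> U \<Longrightarrow> (u, v) \<in> parcs G \<Longrightarrow> v \<in> U" for U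
      using closed_set_of_connected[OF G(2) that G'(3)] .
    show "h \<le> card {u. (v, u) \<in> parcs G}" if "v \<in> pverts G" for v
    proof -
      have "min_degree G \<le> out_degree (with_proj G) v"
        unfolding min_degree_def using G'(1) that by (intro Min_le) auto
      also have "\<dots> = card (Pair v ` {u. (v, u) \<in> parcs G})"
        unfolding out_degree_def out_arcs_def by (rule arg_cong[of _ _ card]) auto
      also have "\<dots> = card {u. (v, u) \<in> parcs G}" by (simp add: card_image inj_on_def)
      finally show ?thesis using deg(1) by simp
    qed
    show "1 \<le> h" "2 * h + 3 \<le> card (pverts G)" by (rule deg(2), rule n)
  qed
qed

theorem theorem1p9:
  fixes G :: "'a pair_pre_digraph"
    and a :: "nat \<Rightarrow> nat" and k b\<^sub>1 h n :: nat
  defines "F \<equiv> disjoint_union (disjoint_Union {1..k} (\<lambda>i. path_graph (2 * a i)))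
                               (path_graph (2 * b\<^sub>1 + 1))"
  assumes "k \<ge> 1" and "antimono_on {1..k} a" and "a k \<ge> 1" and "b\<^sub>1 \<ge> 1"
    and "h = (\<Sum>i=1..k. a i) + b\<^sub>1 - 1" and "h \<ge> 1"
    and "pair_graph G" and "connected (with_proj G)"
    and "card (pverts G) = n" and "n \<ge> 2 * h + 3"
    and "min_degree G \<ge> h"
  shows "contained_in F G
    \<or> contained_in G (S_graph n h)
    \<or> (isomorphic F (disjoint_union (path_graph 6) (path_graph 3)) \<and> even n
        \<and> contained_in G (graph_join (complete_graph 2) (copies ((n - 2) div 2) (complete_graph 2))))
    \<or> ((isomorphic F (disjoint_union (path_graph (2 * b\<^sub>1)) (path_graph (2 * b\<^sub>1 + 1)))
          \<or> isomorphic F (disjoint_union (path_graph (2 * b\<^sub>1 + 2)) (path_graph (2 * b\<^sub>1 + 1))))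
        \<and> (\<exists>t. n = t * h + 1 \<and> isomorphic G (L_graph t h)))"
proof -
  note F_def = assms(1) and k = assms(2) and antimono = assms(3) and ak = assms(4) and b1 = assms(5)
    and h = assms(6) and G = assms(8) and n = assms(10)
  interpret min_degree_graph "pverts G" "\<lambda>u v. (u, v) \<in> parcs G" h
    using min_degree_graph_of_pair_graph[OF assms(8,9)] assms(7,10-12) by simp
  \<comment> \<open>the two paths take the last even component and all other components, respectively\<close>
  define b where "b = (\<Sum>i=1..<k. a i) + b\<^sub>1"
  have "{1..k} = insert k {1..<k}" using k by auto
  then have sum: "(\<Sum>i=1..k. a i) = a k + (\<Sum>i=1..<k. a i)" by simp
  have ab: "1 \<le> a k" "1 \<le> b" "a k + b = h + 1"
    using ak b1 h sum by (simp_all add: b_def)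
  \<comment> \<open>for \<open>k \<ge> 2\<close> the part \<open>a (k - 1) \<ge> a k\<close> is contained in \<open>b\<close>, besides \<open>b\<^sub>1 \<ge> 1\<close>\<close>
  have single: "k = 1" if "b \<le> a k"
  proof (rule ccontr)
    assume "k \<noteq> 1"
    then have k2: "1 \<le> k - 1" "k - 1 \<in> {1..<k}" "k - 1 \<in> {1..k}" "k \<in> {1..k}" using k by auto
    have "a k \<le> a (k - 1)" using monotone_onD[OF antimono k2(3,4)] by simp
    also have "\<dots> \<le> (\<Sum>i=1..<k. a i)" using k2(2) by (intro member_le_sum) auto
    finally show False using that b1 by (simp add: b_def)
  qed
  have iso: "isomorphic F (disjoint_union (path_graph (2 * a k)) (path_graph (2 * b\<^sub>1 + 1)))" "b = b\<^sub>1"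
    if "b \<le> a k"
    using isomorphic_disjoint_Union_singleton[of "\<lambda>i. path_graph (2 * a i)" 1 "path_graph (2 * b\<^sub>1 + 1)"]
      single[OF that] by (simp_all add: F_def b_def pair_graph_path_graph)
  from two_paths_or_exceptional[OF ab] consider
    "has_two_paths (2 * a k) (2 * b + 1)"
    | A where "A \<subseteq> pverts G" "card A = h" "\<forall>u v. (u, v) \<in> parcs G \<longrightarrow> u \<in> A \<or> v \<in> A"
    | p q where "a k = 3" "b = 1" "joined_matching_at p q"
    | c where "a k = b \<or> a k = b + 1" "windmill_at c"
    by blast
  then show ?thesis
  proof cases
    case 1
    then obtain xs ys where "path xs" "path ys" "set xs \<inter> set ys = {}" "length xs = 2 * a k" "length ys = 2 * b + 1"
      unfolding has_two_paths_def by blast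
    then have "contained_in F G"
      unfolding F_def path_def by (intro contained_in_of_two_paths[OF G]) (auto simp: b_def)
    then show ?thesis ..
  next
    case 2
    then have "contained_in G (S_graph n h)"
      using contained_in_S_graph[OF G 2(1,2)] n by blast
    then show ?thesis by blast
  next
    case 3
    have "isomorphic F (disjoint_union (path_graph 6) (path_graph 3))"
      using iso 3(1,2) by simp
    moreover have "even n \<and> contained_in G (graph_join (complete_graph 2) (copies ((n - 2) div 2) (complete_graph 2)))"
      using contained_in_joined_matching[OF G] 3(3) n unfolding joined_matching_at_def by blast
    ultimately show ?thesis by blast
  next
    case 4
    then have "isomorphic F (disjoint_union (path_graph (2 * b\<^sub>1)) (path_graph (2 * b\<^sub>1 + 1)))
          \<or> isomorphic F (disjoint_union (path_graph (2 * b\<^sub>1 + 2)) (path_graph (2 * b\<^sub>1 + 1)))"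
      using iso by auto
    moreover have "\<exists>t. card (pverts G) = t * h + 1 \<and> isomorphic G (L_graph t h)"
      using 4(2) unfolding windmill_at_def block_def
      by (intro isomorphic_L_graph[OF G, of c "block c"]) (auto simp: block_def)
    ultimately show ?thesis using n by blast
  qed
qed

end
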